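(* The $k$-Rewiring problem (defined in the context) is NP-hard, and it is NP-hard to approximate within any factor. The second assertion means the following: for every factor $\alpha>0$, it is NP-hard to compute, given an instance of $k$-Rewiring that has a feasible solution, a feasible set $O'$ of $k$ rewiring operations with $\Delta(O')\ge \alpha\cdot\Delta(O^* )$, where $O^*$ is an optimal solution of the instance. In particular, for no $\alpha>0$ does a polynomial-time algorithm with this guarantee on all such instances exist unless $\mathrm{P}=\mathrm{NP}$.
   Context: **Recommendation graph.** Let $V$ be a set of $n$ items, partitioned into two disjoint subsets $V=V_n\cup V_h$, called neutral ($V_n$) and harmful ($V_h$). Let $\mathbf S=(s_{uv})\in[0,1]^{n\times n}$ be a matrix of relevance scores. Let $d$ be a positive integer. For each $u\in V$, the recommendation list $\Gamma^+(u)$ consists of the $d$ items $v$ with the largest scores $s_{uv}$. The scores uniquely determine the ranking of these items, and $i_u(v)\in\{1,\dots,d\}$ denotes the rank of $v\in\Gamma^+(u)$. The transition probability from $u$ to $v\in\Gamma^+(u)$ is $p_{uv}=f(i_u(v))$, where $f$ is a non-increasing function with $\sum_{v\in\Gamma^+(u)}p_{uv}=1$. This gives a directed probabilistic $d$-regular graph $G=(V,E,\mathbf M)$ in which every node $u$ has exactly $d$ out-edges $(u,v)$, $v\in\Gamma^+(u)$. The $n\times n$ transition matrix $\mathbf M$ has entry $p_{uv}$ if $(u,v)\in E$ and $0$ otherwise. **Segregation.** For $u\in V_h$, let $T_u(V_n)$ be the first time at which the random walk on $G$ started at $u$, with transition matrix $\mathbf M$, hits a node of $V_n$. The segregation score of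 $u$ is $z_u=\mathbb E_G[T_u(V_n)]$. The segregation of $G$ is $Z(G)=\max_{u\in V_h}z_u$. It is assumed that from every harmful node some neutral node is reachable with positive probability, so that $Z(G)$ is finite. **Rewiring operations.** A rewiring operation $o=(u,v,w)$, with $u,v\in V_h$, $w\in V_n$, $(u,v)\in E$ and $(u,w)\notin E$, deletes the edge $(u,v)$ and inserts the edge $(u,w)$. The item $w$ takes the rank of $v$ in $\Gamma^+(u)$, so $i_u(w)=i_u(v)$, and the new edge receives probability $p_{uw}=p_{uv}$. For a set $O$ of rewiring operations, $G^O$ denotes the graph obtained from $G$ by performing all operations in $O$. Define $\Delta(O)=Z(G)-Z(G^O)$. **Recommendation quality.** For a recommendation list $\Gamma^+(u)$ let $$\mathrm{DCG}(\Gamma^+(u))=\sum_{v\in\Gamma^+(u)}\frac{s_{uv}}{1+\log_2(1+i_u(v))},\qquad L(\Gamma^+(u))=\frac{\mathrm{DCG}(\Gamma^+(u))}{\mathrm{DCG}(\Gamma_0^+(u))},$$ where $\Gamma_0^+(u)$ is the original recommendation list of $u$ (the top-$d$ items by relevance) and $\Gamma^+(u)$ is the current list of $u$, after rewiring. **The $k$-Rewiring problem.** Given a directed probabilistic $d$-regular graph $G=(V,E,\mathbf M)$ in which each node $u\in V$ has out-edges exactly to the $d$ items of its recommendation list $\Gamma^+(u)$ (the top-$d$ items by the relevance scores $s_{uv}$), with transition probabilities $p_{uv}=f(i_u(v))$ for $(u,v)\in E$, and in which every harmful node can reach some neutral node with positive probability (together with the partition $V=V_n\cup V_h$ and the relevance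 scores $\mathbf S$), a positive integer $k$, and a threshold $\tau\in(0,1)$, find a set $O$ of $k$ rewiring operations that maximizes $\Delta(O)$ under the constraint that $L(\Gamma^+(u))\ge\tau$ for each node $u\in V$ in $G^O$. A set $O$ of $k$ rewiring operations satisfying this constraint is called feasible. An optimal solution is a feasible set maximizing $\Delta$. All numerical data in the input are rational. *)

theory Defs
  imports "HOL-Probability.Probability" "HOL-Computational_Algebra.Polynomial"
begin

section \<open>Turing machines\<close>

type_synonym word = "bool list"

text \<open>A tape is two-way infinite: cell contents and head position. Symbol 0 is the blank,
  1 and 2 encode the bits False and True; further symbols are work symbols.\<close>

type_synonym tape = "(int \<Rightarrow> nat) \<times> int"

datatype move = Move_left | Stay | Move_right

text \<open>Deterministic multi-tape machines. State 0 is initial and state 1 is halting. Tape 0 holds the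
  input, tape 1 the output, and tape 2 is the query tape of an oracle machine. If
  \<open>query M = Some (q, r)\<close>, then in state q the machine consults the oracle and resumes
  in state r; if \<open>query M = None\<close>, it is an ordinary machine without access to an oracle.\<close>

record tm =
  n_tapes :: nat
  n_symbols :: nat
  n_states :: nat
  delta :: "nat \<Rightarrow> nat list \<Rightarrow> nat \<times> (nat \<times> move) list"
  query :: "(nat \<times> nat) option"

definition turing_machine :: "tm \<Rightarrow> bool" where
  "turing_machine M \<longleftrightarrow>
     3 \<le> n_tapes M \<and> 3 \<le> n_symbols M \<and> 2 \<le> n_states M \<and>
     (\<forall>q<n_states M. \<forall>ss. length ss = n_tapes M \<and> set ss \<subseteq> {..<n_symbols M} \<longrightarrow>
        fst (delta M q ss) < n_states M \<and>
        length (snd (delta M q ss)) = n_tapes M \<and>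
        fst ` set (snd (delta M q ss)) \<subseteq> {..<n_symbols M}) \<and>
     (\<forall>q r. query M = Some (q, r) \<longrightarrow> q < n_states M \<and> r < n_states M)"

fun act :: "nat \<times> move \<Rightarrow> tape \<Rightarrow> tape" where
  "act (s, m) (c, p) =
     (c(p := s), case m of Move_left \<Rightarrow> p - 1 | Stay \<Rightarrow> p | Move_right \<Rightarrow> p + 1)"

definition blank_tape :: tape where
  "blank_tape = (\<lambda>_. 0, 0)"

definition word_tape :: "word \<Rightarrow> tape" where
  "word_tape w =
     (\<lambda>i. if 0 \<le> i \<and> i < int (length w) then if w ! nat i then 2 else 1 else 0, 0)"

text \<open>The word on a tape is the maximal block of bits that starts at the head and extends to the
  right. Such blocks are finite in every run, since each tape has only finitely many nonblank cells.\<close>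

fun tape_word :: "tape \<Rightarrow> word" where
  "tape_word (c, p) =
     map (\<lambda>j. c (p + int j) = 2) [0..<(LEAST j. c (p + int j) \<notin> {1, 2})]"

type_synonym config = "nat \<times> tape list"

fun delta_step :: "tm \<Rightarrow> config \<Rightarrow> config" where
  "delta_step M (q, ts) =
     (case delta M q (map (\<lambda>(c, p). c p) ts) of (r, as) \<Rightarrow> (r, map2 act as ts))"

text \<open>The oracle's answer replaces the whole content of the query tape.\<close>

fun step :: "tm \<Rightarrow> (word \<Rightarrow> word) \<Rightarrow> config \<Rightarrow> config" where
  "step M g (q, ts) =
     (if q = 1 then (q, ts)
      else case query M of
        None \<Rightarrow> delta_step M (q, ts)
      | Some (q', r) \<Rightarrow>
          if q = q' then (r, ts[2 := word_tape (g (tape_word (ts ! 2)))])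
          else delta_step M (q, ts))"

definition initial :: "tm \<Rightarrow> word \<Rightarrow> config" where
  "initial M x = (0, word_tape x # replicate (n_tapes M - 1) blank_tape)"

text \<open>The halting state is absorbing, so inspecting the configuration after \<open>t\<close> steps
  amounts to halting within \<open>t\<close> steps.\<close>

definition outputs_within :: "tm \<Rightarrow> (word \<Rightarrow> word) \<Rightarrow> word \<Rightarrow> nat \<Rightarrow> word \<Rightarrow> bool" where
  "outputs_within M g x t y \<longleftrightarrow>
     (case (step M g ^^ t) (initial M x) of (q, ts) \<Rightarrow> q = 1 \<and> tape_word (ts ! 1) = y)"


section \<open>Polynomial time, NP, and hardness of search problems\<close>

definition poly_time_computable :: "(word \<Rightarrow> word) \<Rightarrow> bool" where
  "poly_time_computable f \<longleftrightarrow>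
     (\<exists>M (p :: nat poly). turing_machine M \<and> query M = None \<and>
        (\<forall>x. outputs_within M (\<lambda>_. []) x (poly p (length x)) (f x)))"

definition class_P :: "word set set" where
  "class_P = {L. poly_time_computable (\<lambda>x. [x \<in> L])}"

definition self_delimiting :: "word \<Rightarrow> word" where
  "self_delimiting x = concat (map (\<lambda>b. [True, b]) x) @ [False]"

definition class_NP :: "word set set" where
  "class_NP = {L. \<exists>C\<in>class_P. \<exists>p :: nat poly. \<forall>x.
     x \<in> L \<longleftrightarrow> (\<exists>w. length w \<le> poly p (length x) \<and> self_delimiting x @ w \<in> C)}"

text \<open>A search problem is given by the set \<open>D\<close> of its inputs and the relation \<open>R\<close>
  between inputs and admissible answers. Nothing is demanded of a solver outside \<open>D\<close>.\<close>

definition solves :: "(word \<Rightarrow> word) \<Rightarrow> word set \<Rightarrow> (word \<Rightarrow> word \<Rightarrow> bool) \<Rightarrow> bool" where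
  "solves g D R \<longleftrightarrow> (\<forall>x\<in>D. R x (g x))"

text \<open>NP-hardness of a search problem is meant with respect to polynomial-time Turing reductions;
  the reduction has to work for every oracle that solves the problem.\<close>

definition NP_hard_search :: "word set \<Rightarrow> (word \<Rightarrow> word \<Rightarrow> bool) \<Rightarrow> bool" where
  "NP_hard_search D R \<longleftrightarrow>
     (\<forall>L\<in>class_NP. \<exists>M (p :: nat poly). turing_machine M \<and>
        (\<forall>g. solves g D R \<longrightarrow>
           (\<forall>x. outputs_within M g x (poly p (length x)) [x \<in> L])))"


section \<open>Random walks and hitting times\<close>

text \<open>The law on trajectories of the Markov chain started at \<open>u\<close> whose transition
  probabilities out of \<open>x\<close> are given by \<open>K x\<close>, obtained from the
  Ionescu-Tulcea theorem.\<close>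

locale random_walk =
  fixes K :: "nat \<Rightarrow> nat pmf" and u :: nat
begin

definition kernel :: "nat \<Rightarrow> (nat \<Rightarrow> nat) \<Rightarrow> nat measure" where
  "kernel i \<omega> = measure_pmf (case i of 0 \<Rightarrow> return_pmf u | Suc t \<Rightarrow> K (\<omega> t))"

sublocale IT: Ionescu_Tulcea kernel "\<lambda>_. count_space UNIV"
proof (rule Ionescu_Tulcea.intro)
  show "kernel i \<in> (\<Pi>\<^sub>M i\<in>{0..<i}. count_space UNIV) \<rightarrow>\<^sub>M
      subprob_algebra (count_space UNIV)" for i
  proof (cases i)
    case 0
    then show ?thesis
      by (simp add: kernel_def[abs_def] measure_pmf_in_subprob_algebra)
  next
    case (Suc t)
    have "(\<lambda>\<omega>. \<omega> t) \<in> (\<Pi>\<^sub>M i\<in>{0..<i}. count_space UNIV) \<rightarrow>\<^sub>M count_space UNIV"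
      by (rule measurable_component_singleton) (simp add: Suc)
    then have "(\<lambda>\<omega>. measure_pmf (K (\<omega> t))) \<in> (\<Pi>\<^sub>M i\<in>{0..<i}. count_space UNIV) \<rightarrow>\<^sub>M
        subprob_algebra (count_space UNIV)"
      by (rule measurable_compose) (simp add: measure_pmf_in_subprob_algebra)
    with Suc show ?thesis
      by (simp add: kernel_def[abs_def])
  qed
  show "prob_space (kernel i \<omega>)"
    if "\<omega> \<in> space (\<Pi>\<^sub>M i\<in>{0..<i}. count_space UNIV)" for i \<omega>
    by (simp add: kernel_def measure_pmf.prob_space_axioms)
qed

definition trajectories :: "(nat \<Rightarrow> nat) measure" where
  "trajectories = IT.PF.lim"

end

text \<open>The infimum is \<open>\<infinity>\<close> on trajectories that never hit \<open>A\<close>.\<close>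

definition hitting_time :: "nat set \<Rightarrow> (nat \<Rightarrow> nat) \<Rightarrow> ennreal" where
  "hitting_time A \<omega> = (INF t\<in>{t. \<omega> t \<in> A}. of_nat t)"


section \<open>Recommendation graphs\<close>

text \<open>The items are \<open>0, \<dots>, n - 1\<close> where \<open>n = length (harmful I)\<close>, and
  \<open>harmful I ! v\<close> tells whether \<open>v\<close> is harmful. The list \<open>rank_probs I\<close>
  has the entries \<open>f 1, \<dots>, f d\<close>.\<close>

record rewiring_instance =
  harmful :: "bool list"
  scores :: "rat list list"
  rank_probs :: "rat list"
  budget :: nat
  threshold :: rat

definition items :: "rewiring_instance \<Rightarrow> nat set" where
  "items I = {..<length (harmful I)}"

definition harmful_items :: "rewiring_instance \<Rightarrow> nat set" where
  "harmful_items I = {v \<in> items I. harmful I ! v}"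

definition neutral_items :: "rewiring_instance \<Rightarrow> nat set" where
  "neutral_items I = {v \<in> items I. \<not> harmful I ! v}"

definition score :: "rewiring_instance \<Rightarrow> nat \<Rightarrow> nat \<Rightarrow> rat" where
  "score I u v = scores I ! u ! v"

definition list_length :: "rewiring_instance \<Rightarrow> nat" where
  "list_length I = length (rank_probs I)"

text \<open>\<open>xs\<close> lists \<open>list_length I\<close> items with the largest scores for \<open>u\<close>,
  by decreasing score.\<close>

definition top_ranking :: "rewiring_instance \<Rightarrow> nat \<Rightarrow> nat list \<Rightarrow> bool" where
  "top_ranking I u xs \<longleftrightarrow>
     length xs = list_length I \<and> distinct xs \<and> set xs \<subseteq> items I \<and>
     sorted_wrt (\<lambda>v w. score I u w \<le> score I u v) xs \<and>
     (\<forall>v\<in>set xs. \<forall>w\<in>items I - set xs. score I u w \<le> score I u v)"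

text \<open>A graph is represented by the ranked recommendation lists of its nodes.\<close>

type_synonym recommendations = "nat \<Rightarrow> nat list"

definition original :: "rewiring_instance \<Rightarrow> recommendations" where
  "original I u = (THE xs. top_ranking I u xs)"

text \<open>Ranks start at 1.\<close>

definition rank_in :: "nat list \<Rightarrow> nat \<Rightarrow> nat" where
  "rank_in xs v = (THE i. 1 \<le> i \<and> i \<le> length xs \<and> xs ! (i - 1) = v)"

definition transition :: "rewiring_instance \<Rightarrow> recommendations \<Rightarrow> nat \<Rightarrow> nat \<Rightarrow> real" where
  "transition I \<Gamma> u v =
     (if v \<in> set (\<Gamma> u) then of_rat (rank_probs I ! (rank_in (\<Gamma> u) v - 1)) else 0)"

definition segregation_score ::
    "rewiring_instance \<Rightarrow> recommendations \<Rightarrow> nat \<Rightarrow> ennreal" where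
  "segregation_score I \<Gamma> u =
     (\<integral>\<^sup>+\<omega>. hitting_time (neutral_items I) \<omega>
        \<partial>random_walk.trajectories (\<lambda>x. embed_pmf (transition I \<Gamma> x)) u)"

definition segregation :: "rewiring_instance \<Rightarrow> recommendations \<Rightarrow> real" where
  "segregation I \<Gamma> = enn2real (Max (segregation_score I \<Gamma> ` harmful_items I))"

definition valid_instance :: "rewiring_instance \<Rightarrow> bool" where
  "valid_instance I \<longleftrightarrow>
     length (scores I) = length (harmful I) \<and>
     (\<forall>r\<in>set (scores I). length r = length (harmful I) \<and> set r \<subseteq> {0..1}) \<and>
     1 \<le> list_length I \<and>
     sorted_wrt (\<ge>) (rank_probs I) \<and> (\<forall>q\<in>set (rank_probs I). 0 \<le> q) \<and> sum_list (rank_probs I) = 1 \<and>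
     (\<forall>u\<in>items I. \<exists>!xs. top_ranking I u xs) \<and>
     (\<forall>u\<in>harmful_items I. \<exists>v\<in>neutral_items I.
        (u, v) \<in> {(a, b). a \<in> items I \<and> transition I (original I) a b > 0}\<^sup>*) \<and>
     1 \<le> budget I \<and> 0 < threshold I \<and> threshold I < 1"


section \<open>Rewiring\<close>

definition rewiring_operation :: "rewiring_instance \<Rightarrow> nat \<times> nat \<times> nat \<Rightarrow> bool" where
  "rewiring_operation I = (\<lambda>(u, v, w).
     u \<in> harmful_items I \<and> v \<in> harmful_items I \<and> w \<in> neutral_items I \<and>
     v \<in> set (original I u) \<and> w \<notin> set (original I u))"

text \<open>All operations of a set can be performed together only if no edge is deleted or inserted by
  two of them. Then the order does not matter: inserted edges end in neutral items, deleted ones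
  in harmful items, so no operation enables or disables another one.\<close>

definition rewiring_set :: "rewiring_instance \<Rightarrow> (nat \<times> nat \<times> nat) set \<Rightarrow> bool" where
  "rewiring_set I O1 \<longleftrightarrow>
     (\<forall>x\<in>O1. rewiring_operation I x) \<and>
     (\<forall>u v w v' w'. (u, v, w) \<in> O1 \<and> (u, v', w') \<in> O1 \<longrightarrow> (v = v' \<longleftrightarrow> w = w'))"

definition rewired :: "rewiring_instance \<Rightarrow> (nat \<times> nat \<times> nat) set \<Rightarrow> recommendations" where
  "rewired I O1 u =
     map (\<lambda>v. if \<exists>w. (u, v, w) \<in> O1 then THE w. (u, v, w) \<in> O1 else v) (original I u)"

definition gain :: "rewiring_instance \<Rightarrow> (nat \<times> nat \<times> nat) set \<Rightarrow> real" where
  "gain I O1 = segregation I (original I) - segregation I (rewired I O1)"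

definition DCG :: "rewiring_instance \<Rightarrow> nat \<Rightarrow> nat list \<Rightarrow> real" where
  "DCG I u xs = (\<Sum>v\<in>set xs. of_rat (score I u v) / (1 + log 2 (1 + real (rank_in xs v))))"

definition quality :: "rewiring_instance \<Rightarrow> recommendations \<Rightarrow> nat \<Rightarrow> real" where
  "quality I \<Gamma> u = DCG I u (\<Gamma> u) / DCG I u (original I u)"

definition feasible :: "rewiring_instance \<Rightarrow> (nat \<times> nat \<times> nat) set \<Rightarrow> bool" where
  "feasible I O1 \<longleftrightarrow>
     rewiring_set I O1 \<and> finite O1 \<and> card O1 = budget I \<and>
     (\<forall>u\<in>items I. of_rat (threshold I) \<le> quality I (rewired I O1) u)"

definition optimal :: "rewiring_instance \<Rightarrow> (nat \<times> nat \<times> nat) set \<Rightarrow> bool" where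
  "optimal I O1 \<longleftrightarrow> feasible I O1 \<and> (\<forall>O2. feasible I O2 \<longrightarrow> gain I O2 \<le> gain I O1)"

definition approximate_solution ::
    "real \<Rightarrow> rewiring_instance \<Rightarrow> (nat \<times> nat \<times> nat) set \<Rightarrow> bool" where
  "approximate_solution \<alpha> I O1 \<longleftrightarrow>
     feasible I O1 \<and> (\<exists>O2. optimal I O2 \<and> gain I O1 \<ge> \<alpha> * gain I O2)"


section \<open>Encodings and the search problems\<close>

fun binary :: "nat \<Rightarrow> word" where
  "binary m = (if m = 0 then [] else odd m # binary (m div 2))"

declare binary.simps [simp del]

definition enc_nat :: "nat \<Rightarrow> word" where
  "enc_nat m = self_delimiting (binary m)"

text \<open>Only nonnegative rationals occur in instances.\<close>

definition enc_rat :: "rat \<Rightarrow> word" where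
  "enc_rat q = (case quotient_of q of (a, b) \<Rightarrow> enc_nat (nat a) @ enc_nat (nat b))"

definition enc_list :: "('a \<Rightarrow> word) \<Rightarrow> 'a list \<Rightarrow> word" where
  "enc_list e xs = concat (map (\<lambda>x. True # e x) xs) @ [False]"

definition enc_instance :: "rewiring_instance \<Rightarrow> word" where
  "enc_instance I =
     enc_list (\<lambda>b. [b]) (harmful I) @ enc_list (enc_list enc_rat) (scores I) @
     enc_list enc_rat (rank_probs I) @ enc_nat (budget I) @ enc_rat (threshold I)"

definition enc_operations :: "(nat \<times> nat \<times> nat) list \<Rightarrow> word" where
  "enc_operations = enc_list (\<lambda>(u, v, w). enc_nat u @ enc_nat v @ enc_nat w)"

definition rewiring_inputs :: "word set" where
  "rewiring_inputs = {enc_instance I | I. valid_instance I \<and> (\<exists>O1. feasible I O1)}"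

text \<open>\<open>y\<close> encodes, as a list without repetitions, a set of operations with property
  \<open>S I\<close>, where \<open>I\<close> is the instance encoded by \<open>x\<close>.\<close>

definition answer ::
    "(rewiring_instance \<Rightarrow> (nat \<times> nat \<times> nat) set \<Rightarrow> bool) \<Rightarrow> word \<Rightarrow> word \<Rightarrow> bool" where
  "answer S x y \<longleftrightarrow>
     (\<exists>I xs. valid_instance I \<and> x = enc_instance I \<and>
        y = enc_operations xs \<and> distinct xs \<and> S I (set xs))"

end

theory Submission
  imports Defs
begin

text \<open>
  Let \<open>L\<close> be in NP. Its verifier, run for polynomially many steps with all tapes addressed relative
  to their heads, becomes a family of Horn clauses together with clauses that choose the witness; so
  \<open>x \<in> L\<close> iff the clauses are satisfiable. Each literal becomes an item with a loop, which a rewiring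
  operation on it removes, and each clause becomes an item pointing to its literals. There is a clause
  for every pair of complementary literals, and the budget is the number of variables. Hence the
  segregation, the maximum over all clauses, drops substantially iff the operations pick a satisfying
  assignment.

  Moreover every clause points with a tiny probability to one common item, the hub (item 0). An
  operation on the hub yields a positive but tiny gain, and it leaves too few operations for the
  pairs of literals. So if the clauses are satisfiable then a set of operations whose gain is at least
  \<open>\<alpha>\<close> times the optimum has no operation on the hub, and otherwise it must have one. A finite
  automaton can thus read off from any approximate answer whether \<open>x \<in> L\<close>.

  The Turing machines are obtained from structured programs. As transition functions are arbitrary
  functions on finite sets, it suffices that a program has finitely many control states. The
  reduction itself is printed by loops over polynomially bounded registers.
\<close>

section \<open>Structured programs for Turing machines\<close>

text \<open>Segregation is a maximum, so one clause that no operation helps keeps it at its original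
  value. Without the hub an unsatisfiable instance would thus have an optimum of 0, every feasible
  set would be an approximate solution, and telling the two cases apart would require evaluating the
  clauses on the answer. The hub makes every optimum positive, at least e (\<zeta> - 1), where e is
  the probability of the edge to the hub and \<zeta> the mean time of an intact loop. A satisfying
  assignment gains at least p (\<zeta> - 1), where p is the probability of each other edge. The
  ratio m = p / e is chosen above 1 / \<alpha>; as \<alpha> is fixed, m is a constant of the
  reduction. Exact optimisation is the case \<alpha> = 1.

  The relevance scores only prescribe the lists, and the threshold is so low that no choice of loops
  to be cut violates it. The number of tape symbols, clause schemas and item types depends on the
  language alone. The input enters through two coordinates, of polynomial range, and through guards
  that are arithmetic expressions; this is why fixed loops can print the instance.\<close>

type_synonym tapes = "nat \<Rightarrow> tape"

definition syms :: "tapes \<Rightarrow> nat \<Rightarrow> nat" where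
  "syms st i = fst (st i) (snd (st i))"

text \<open>Tapes are addressed by arbitrary numbers, so that parts compose without agreeing on a
  number of tapes. The first argument of \<open>PAct\<close> bounds the tapes it touches; the number
  of tapes of the machine comes from these bounds.\<close>

datatype prog =
    PAct nat "(nat \<Rightarrow> nat) \<Rightarrow> nat \<Rightarrow> nat \<times> move"
  | PQuery
  | PSeq prog prog
  | PIf "(nat \<Rightarrow> nat) \<Rightarrow> bool" prog prog
  | PWhile "(nat \<Rightarrow> nat) \<Rightarrow> bool" prog

definition do_act :: "nat \<Rightarrow> ((nat \<Rightarrow> nat) \<Rightarrow> nat \<Rightarrow> nat \<times> move) \<Rightarrow> tapes \<Rightarrow> tapes" where
  "do_act n f st = (\<lambda>i. if i < n then act (f (syms st) i) (st i) else st i)"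

definition ask :: "(word \<Rightarrow> word) \<Rightarrow> tapes \<Rightarrow> tapes" where
  "ask g st = st(2 := word_tape (g (tape_word (st 2))))"

text \<open>The step count is exact and charges one step for unfolding each control construct,
  because the machine spends one transition on it.\<close>

inductive big :: "(word \<Rightarrow> word) \<Rightarrow> prog \<Rightarrow> tapes \<Rightarrow> nat \<Rightarrow> tapes \<Rightarrow> bool" for g where
  Act: "big g (PAct n f) st 1 (do_act n f st)"
| Query: "big g PQuery st 1 (ask g st)"
| Seq: "big g a st s st' \<Longrightarrow> big g b st' t st'' \<Longrightarrow> big g (PSeq a b) st (Suc (s + t)) st''"
| IfT: "c (syms st) \<Longrightarrow> big g a st s st' \<Longrightarrow> big g (PIf c a b) st (Suc s) st'"
| IfF: "\<not> c (syms st) \<Longrightarrow> big g b st s st' \<Longrightarrow> big g (PIf c a b) st (Suc s) st'"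
| WhileF: "\<not> c (syms st) \<Longrightarrow> big g (PWhile c a) st 1 st"
| WhileT: "c (syms st) \<Longrightarrow> big g a st s st' \<Longrightarrow> big g (PWhile c a) st' t st'' \<Longrightarrow>
    big g (PWhile c a) st (Suc (s + t)) st''"

text \<open>The control state of a running program is the stack of programs still to be executed.\<close>

fun nxt :: "prog list \<Rightarrow> (nat \<Rightarrow> nat) \<Rightarrow> prog list" where
  "nxt [] s = []"
| "nxt (PAct n f # K) s = K"
| "nxt (PQuery # K) s = K"
| "nxt (PSeq a b # K) s = a # b # K"
| "nxt (PIf c a b # K) s = (if c s then a else b) # K"
| "nxt (PWhile c a # K) s = (if c s then a # PWhile c a # K else K)"

fun acts :: "prog list \<Rightarrow> (nat \<Rightarrow> nat) \<Rightarrow> nat \<Rightarrow> nat \<times> move" where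
  "acts (PAct n f # K) s i = (if i < n then f s i else (s i, Stay))"
| "acts _ s i = (s i, Stay)"

definition cstep :: "(word \<Rightarrow> word) \<Rightarrow> prog list \<times> tapes \<Rightarrow> prog list \<times> tapes" where
  "cstep g = (\<lambda>(c, st). (nxt c (syms st),
     case c of PQuery # _ \<Rightarrow> ask g st | _ \<Rightarrow> (\<lambda>i. act (acts c (syms st) i) (st i))))"

lemma act_Stay [simp]: "act (syms st i, Stay) (st i) = st i"
  by (cases "st i") (auto simp: syms_def)

lemma cstep_simps:
  "cstep g (PAct n f # K, st) = (K, do_act n f st)"
  "cstep g (PQuery # K, st) = (K, ask g st)"
  "cstep g (PSeq a b # K, st) = (a # b # K, st)"
  "cstep g (PIf c a b # K, st) = ((if c (syms st) then a else b) # K, st)"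
  "cstep g (PWhile c a # K, st) = (if c (syms st) then a # PWhile c a # K else K, st)"
  by (auto simp: cstep_def do_act_def fun_eq_iff)

text \<open>The stack \<open>K\<close> below the program is arbitrary, so that the induction
  hypothesis applies to the first part of a sequence and to a loop body, which run with the
  remaining program beneath them.\<close>

lemma big_cstep: "big g p st t st' \<Longrightarrow> (cstep g ^^ t) (p # K, st) = (K, st')"
proof (induction arbitrary: K rule: big.induct)
  case (Seq a st s st' b t st'')
  have "(cstep g ^^ Suc (s + t)) (PSeq a b # K, st) = (cstep g ^^ (t + s)) (a # b # K, st)"
    by (simp only: funpow_Suc_right o_apply cstep_simps add.commute)
  then show ?case
    using Seq.IH by (simp add: funpow_add)
next
  case (WhileT c st a s st' t st'')
  have "(cstep g ^^ Suc (s + t)) (PWhile c a # K, st) = (cstep g ^^ (t + s)) (a # PWhile c a # K, st)"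
    using WhileT.hyps by (simp only: funpow_Suc_right o_apply cstep_simps add.commute if_True)
  then show ?case
    using WhileT.IH by (simp add: funpow_add)
qed (simp_all add: cstep_simps funpow_Suc_right del: funpow.simps(2))

text \<open>Covers all stacks that occur while \<open>p\<close> runs on top of \<open>K\<close>,
  without \<open>K\<close> itself. A loop lies beneath its own body and hence returns to the same
  stack; this keeps the set finite.\<close>

fun ctrls :: "prog \<Rightarrow> prog list \<Rightarrow> prog list set" where
  "ctrls (PSeq a b) K = insert (PSeq a b # K) (ctrls a (b # K) \<union> ctrls b K)"
| "ctrls (PIf c a b) K = insert (PIf c a b # K) (ctrls a K \<union> ctrls b K)"
| "ctrls (PWhile c a) K = insert (PWhile c a # K) (ctrls a (PWhile c a # K))"
| "ctrls p K = {p # K}"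

lemma finite_ctrls [simp]: "finite (ctrls p K)"
  by (induction p K rule: ctrls.induct) auto

lemma ctrls_self [simp]: "p # K \<in> ctrls p K"
  by (cases p) auto

lemma nxt_ctrls: "c \<in> ctrls p K \<Longrightarrow> nxt c s \<in> insert K (ctrls p K)"
  by (induction p K rule: ctrls.induct) (auto split: if_splits)

fun query_free :: "prog \<Rightarrow> bool" where
  "query_free PQuery = False"
| "query_free (PAct n f) = True"
| "query_free (PSeq a b) = (query_free a \<and> query_free b)"
| "query_free (PIf c a b) = (query_free a \<and> query_free b)"
| "query_free (PWhile c a) = query_free a"

lemma query_free_ctrls: "query_free p \<Longrightarrow> PQuery # K' \<notin> ctrls p K"
  by (induction p K rule: ctrls.induct) auto

lemma ctrls_length: "c \<in> ctrls p K \<Longrightarrow> length K < length c"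
  by (induction p K rule: ctrls.induct) force+

fun n_used :: "prog \<Rightarrow> nat" where
  "n_used (PAct n f) = n"
| "n_used PQuery = 3"
| "n_used (PSeq a b) = max (n_used a) (n_used b)"
| "n_used (PIf c a b) = max (n_used a) (n_used b)"
| "n_used (PWhile c a) = n_used a"

fun writes_below :: "nat \<Rightarrow> prog \<Rightarrow> bool" where
  "writes_below G (PAct n f) = (\<forall>s i. (\<forall>j. s j < G) \<longrightarrow> i < n \<longrightarrow> fst (f s i) < G)"
| "writes_below G PQuery = True"
| "writes_below G (PSeq a b) = (writes_below G a \<and> writes_below G b)"
| "writes_below G (PIf c a b) = (writes_below G a \<and> writes_below G b)"
| "writes_below G (PWhile c a) = writes_below G a"

lemma ctrls_writes_below: "PAct n f # K' \<in> ctrls p K \<Longrightarrow> writes_below G p \<Longrightarrow> writes_below G (PAct n f)"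
  by (induction p K rule: ctrls.induct) (auto simp del: writes_below.simps(1))

lemma ctrls_n_used: "q # K' \<in> ctrls p K \<Longrightarrow> n_used p \<le> k \<Longrightarrow> n_used q \<le> k"
  by (induction p K rule: ctrls.induct) auto

text \<open>A machine scans \<open>k\<close> tapes, whereas conditions of programs may look at all
  symbols. If the other tapes are blank, the missing symbols are known to be 0.\<close>

definition blank_above :: "nat \<Rightarrow> tapes \<Rightarrow> bool" where
  "blank_above k st \<longleftrightarrow> (\<forall>i\<ge>k. st i = blank_tape)"

lemma cstep_blank_above:
  assumes "c \<in> ctrls p K" "n_used p \<le> k" "blank_above k st"
  shows "blank_above k (snd (cstep g (c, st)))"
proof (cases c)
  case Nil
  with assms show ?thesis using ctrls_length by fastforce
next
  case (Cons q K')
  then have "n_used q \<le> k"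
    using assms ctrls_n_used by metis
  then show ?thesis
    using assms(3) unfolding Cons
    by (cases q) (auto simp: cstep_simps do_act_def ask_def blank_above_def)
qed

text \<open>State 0 must be the initial and state 1 the halting one.\<close>

lemma ex_numbering:
  assumes "finite S" "a \<noteq> b"
  shows "\<exists>\<nu> :: 'a \<Rightarrow> nat. inj_on \<nu> S \<and> \<nu> a = 0 \<and> \<nu> b = 1"
proof -
  obtain h :: "'a \<Rightarrow> nat" where h: "inj_on h S"
    using finite_imp_inj_to_nat_seg[OF assms(1)] by metis
  let ?\<nu> = "\<lambda>c. if c = a then 0 else if c = b then 1 else h c + 2"
  have "inj_on ?\<nu> S"
    using h by (auto simp: inj_on_def)
  then show ?thesis
    using assms(2) by (intro exI[of _ ?\<nu>]) auto
qed

text \<open>The states are the control stacks, with the empty stack as the halting state. A machine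
  has a single query state with a single successor; hence the demand that every query of
  \<open>p\<close> occurs with the same rest \<open>K0\<close>.\<close>

theorem prog_to_tm:
  assumes wb: "writes_below G p" and G: "3 \<le> G" and k: "3 \<le> k" "n_used p \<le> k"
    and uq: "\<And>K. PQuery # K \<in> ctrls p [] \<Longrightarrow> K = K0"
  obtains M where "turing_machine M" "n_tapes M = k"
    "query_free p \<Longrightarrow> query M = None"
    "\<And>g st t st'. blank_above k st \<Longrightarrow> big g p st t st' \<Longrightarrow>
       (step M g ^^ t) (0, map st [0..<k]) = (1, map st' [0..<k])"
proof -
  define S where "S = insert [] (ctrls p [])"
  obtain \<nu> :: "prog list \<Rightarrow> nat" where \<nu>: "inj_on \<nu> S" "\<nu> [p] = 0" "\<nu> [] = 1"
    using ex_numbering[of S "[p]" "[]"] by (auto simp: S_def)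
  \<comment> \<open>The numbering may have gaps. Numbers that code no stack decode to the empty
    stack, which keeps \<open>delta\<close> within its bounds on all states.\<close>
  define cod where "cod n = (if n \<in> \<nu> ` S then the_inv_into S \<nu> n else [])" for n
  have cod: "cod (\<nu> c) = c" if "c \<in> S" for c
    using that \<nu>(1) by (simp add: cod_def the_inv_into_f_f)
  have cod_S: "cod n \<in> S" for n
    using \<nu>(1) by (auto simp: cod_def the_inv_into_f_f) (simp add: S_def)
  have nxt_S: "nxt c s \<in> S" if "c \<in> S" for c s
    using that nxt_ctrls[of c p "[]" s] by (auto simp: S_def)
  define ext where "ext ss = (\<lambda>i. if i < k then ss ! i else 0 :: nat)" for ss
  define qs where "qs = (if PQuery # K0 \<in> S then Some (\<nu> (PQuery # K0), \<nu> K0) else None)"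
  define M where "M = \<lparr>n_tapes = k, n_symbols = G, n_states = Suc (Max (\<nu> ` S)),
    delta = (\<lambda>q ss. (\<nu> (nxt (cod q) (ext ss)), map (acts (cod q) (ext ss)) [0..<k])), query = qs\<rparr>"
  have fin: "finite (\<nu> ` S)"
    by (simp add: S_def)
  have lt: "\<nu> c < n_states M" if "c \<in> S" for c
    using that fin by (simp add: M_def less_Suc_eq_le)
  have K0: "K0 \<in> S" if "PQuery # K0 \<in> S"
    using nxt_S[OF that, of undefined] by simp
  show thesis
  proof
    have acts_less: "fst (acts c s i) < G" if "c \<in> S" "\<And>j. s j < G" for c s i
    proof (cases "\<exists>n f K. c = PAct n f # K")
      case True
      then obtain n f K where c: "c = PAct n f # K" by blast
      then have "writes_below G (PAct n f)"
        using that(1) ctrls_writes_below wb unfolding S_def by blast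
      then show ?thesis using that(2) by (auto simp: c)
    next
      case False
      then have "acts c s i = (s i, Stay)"
        by (cases "(c, s, i)" rule: acts.cases) auto
      then show ?thesis using that by simp
    qed
    have ext_less: "ext ss j < G" if "length ss = k" "set ss \<subseteq> {..<G}" for ss j
      using that G by (auto simp: ext_def dest!: nth_mem)
    have "2 \<le> n_states M"
      using lt[of "[]"] by (simp add: S_def \<nu>)
    moreover have "fst ` set (snd (delta M q ss)) \<subseteq> {..<n_symbols M}"
      if "length ss = k" "set ss \<subseteq> {..<G}" for q ss
      using acts_less[OF cod_S ext_less[OF that]] by (simp add: M_def image_subset_iff)
    ultimately show "turing_machine M"
      using G k lt nxt_S[OF cod_S] lt[OF K0]
      unfolding turing_machine_def by (simp add: M_def qs_def)
    show "n_tapes M = k"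
      by (simp add: M_def)
    show "query M = None" if "query_free p"
      using that query_free_ctrls[of p K0 "[]"] by (auto simp: M_def qs_def S_def)
    fix g st t st'
    assume blank: "blank_above k st" and big: "big g p st t st'"
    have one: "step M g (\<nu> c, map st [0..<k]) = (\<nu> (fst (cstep g (c, st))), map (snd (cstep g (c, st))) [0..<k])"
      if c: "c \<in> S" and bl: "blank_above k st" for c st
    proof (cases "c = []")
      case True
      then show ?thesis
        by (auto simp: cstep_def \<nu>)
    next
      case False
      then have ne: "\<nu> c \<noteq> 1"
        using \<nu> c by (auto simp: inj_on_def S_def)
      have ext: "ext (map ((\<lambda>(c, p). c p) \<circ> st) [0..<k]) = syms st"
        using bl by (auto simp: ext_def syms_def fun_eq_iff blank_above_def blank_tape_def split: prod.splits)
      show ?thesis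
      proof (cases "\<exists>K. c = PQuery # K")
        case True
        then have cK: "c = PQuery # K0"
          using uq c by (auto simp: S_def)
        then have q: "query M = Some (\<nu> c, \<nu> K0)"
          using c by (simp add: M_def qs_def)
        show ?thesis
          using ne k by (simp add: q cK cstep_simps) (auto simp: ask_def nth_list_update numeral_2_eq_2 intro!: nth_equalityI)
      next
        case False
        have "step M g (\<nu> c, map st [0..<k]) = delta_step M (\<nu> c, map st [0..<k])"
        proof (cases "query M")
          case (Some a)
          then have "PQuery # K0 \<in> S" "a = (\<nu> (PQuery # K0), \<nu> K0)"
            by (auto simp: M_def qs_def split: if_splits)
          moreover have "\<nu> c \<noteq> \<nu> (PQuery # K0)"
            using False c \<open>PQuery # K0 \<in> S\<close> \<nu>(1) by (auto simp: inj_on_def)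
          ultimately show ?thesis
            using Some ne by simp
        qed (use ne in simp)
        moreover have "cstep g (c, st) = (nxt c (syms st), \<lambda>i. act (acts c (syms st) i) (st i))"
          using False by (auto simp: cstep_def split: list.splits prog.splits)
        ultimately show ?thesis
          using cod[OF c] by (simp add: M_def ext map2_map_map split: prod.splits)
      qed
    qed
    have many: "(step M g ^^ t) (\<nu> c, map st [0..<k]) =
        (\<nu> (fst ((cstep g ^^ t) (c, st))), map (snd ((cstep g ^^ t) (c, st))) [0..<k])"
      if "c \<in> S" "blank_above k st" for c st t
      using that
    proof (induction t arbitrary: c st)
      case (Suc t)
      obtain c1 st1 where c1: "cstep g (c, st) = (c1, st1)" by fastforce
      have "c1 \<in> S"
        using nxt_S[OF Suc.prems(1)] c1 by (auto simp: cstep_def)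
      moreover have "blank_above k st1"
      proof (cases "c = []")
        case True
        then show ?thesis using c1 Suc.prems by (auto simp: cstep_def)
      next
        case False
        then show ?thesis
          using cstep_blank_above[of c p "[]" k st g] Suc.prems k c1 by (auto simp: S_def)
      qed
      ultimately show ?case
        using Suc.IH[of c1 st1] one[OF Suc.prems] c1
        by (simp add: funpow_Suc_right del: funpow.simps(2))
    qed simp
    show "(step M g ^^ t) (0, map st [0..<k]) = (1, map st' [0..<k])"
      using many[of "[p]" st t] big_cstep[OF big, of "[]"] blank by (simp add: \<nu> S_def)
  qed
qed

section \<open>Bounded arithmetic programs\<close>

definition runs :: "(word \<Rightarrow> word) \<Rightarrow> prog \<Rightarrow> tapes \<Rightarrow> nat \<Rightarrow> tapes \<Rightarrow> bool" where
  "runs g p st B st' \<longleftrightarrow> (\<exists>t\<le>B. big g p st t st')"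

lemma runs_mono: "runs g p st B st' \<Longrightarrow> B \<le> C \<Longrightarrow> runs g p st C st'"
  by (auto simp: runs_def intro: order_trans)

lemma runs_Act: "do_act n f st = st' \<Longrightarrow> 1 \<le> C \<Longrightarrow> runs g (PAct n f) st C st'"
  using big.Act unfolding runs_def by blast

lemma runs_Seq:
  "runs g a st A st' \<Longrightarrow> runs g b st' B st'' \<Longrightarrow> Suc (A + B) \<le> C \<Longrightarrow> runs g (PSeq a b) st C st''"
  unfolding runs_def by (meson add_mono big.Seq Suc_le_mono order_trans)

lemma runs_If:
  "(c (syms st) \<Longrightarrow> runs g a st A st') \<Longrightarrow> (\<not> c (syms st) \<Longrightarrow> runs g b st B st') \<Longrightarrow>
   Suc (max A B) \<le> C \<Longrightarrow> runs g (PIf c a b) st C st'"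
proof (cases "c (syms st)")
  assume *: "c (syms st)" "c (syms st) \<Longrightarrow> runs g a st A st'" "Suc (max A B) \<le> C"
  then obtain t where t: "t \<le> A" "big g a st t st'"
    by (auto simp: runs_def)
  have "big g (PIf c a b) st (Suc t) st'"
    using * t by (intro big.IfT)
  with t *(3) show "runs g (PIf c a b) st C st'"
    unfolding runs_def by (intro exI[of _ "Suc t"]) auto
next
  assume *: "\<not> c (syms st)" "\<not> c (syms st) \<Longrightarrow> runs g b st B st'" "Suc (max A B) \<le> C"
  then obtain t where t: "t \<le> B" "big g b st t st'"
    by (auto simp: runs_def)
  have "big g (PIf c a b) st (Suc t) st'"
    using * t by (intro big.IfF)
  with t *(3) show "runs g (PIf c a b) st C st'"
    unfolding runs_def by (intro exI[of _ "Suc t"]) auto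
qed

text \<open>The states are indexed by the number of rounds left, which for most loops is the content
  of the register being emptied.\<close>

lemma runs_While:
  assumes "\<And>j. j < n \<Longrightarrow> c (syms (S (Suc j))) \<and> runs g a (S (Suc j)) B (S j)"
    and "\<not> c (syms (S 0))" and "n * Suc B + 1 \<le> C"
  shows "runs g (PWhile c a) (S n) C (S 0)"
proof -
  have "runs g (PWhile c a) (S n) (n * Suc B + 1) (S 0)"
    using assms(1)
  proof (induction n)
    case 0
    then show ?case
      using big.WhileF[of c "S 0" g a] assms(2) by (auto simp: runs_def)
  next
    case (Suc n)
    obtain t where t: "t \<le> B" "big g a (S (Suc n)) t (S n)"
      using Suc.prems[of n] by (auto simp: runs_def)
    obtain s where s: "s \<le> n * Suc B + 1" "big g (PWhile c a) (S n) s (S 0)"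
      using Suc.IH Suc.prems by (auto simp: runs_def)
    have "big g (PWhile c a) (S (Suc n)) (Suc (t + s)) (S 0)"
      using Suc.prems[of n] t s by (intro big.WhileT) auto
    moreover have "Suc (t + s) \<le> Suc n * Suc B + 1"
      using t s by simp
    ultimately show ?case
      unfolding runs_def by blast
  qed
  then show ?thesis
    using assms(3) by (rule runs_mono)
qed

section \<open>Elementary actions and unary registers\<close>

definition op :: "nat \<Rightarrow> (nat \<Rightarrow> nat \<times> move) \<Rightarrow> prog" where
  "op i h = PAct (Suc i) (\<lambda>s j. if j = i then h (s i) else (s j, Stay))"

lemma runs_op: "st(i := act (h (syms st i)) (st i)) = st' \<Longrightarrow> 1 \<le> C \<Longrightarrow> runs g (op i h) st C st'"
  unfolding op_def by (rule runs_Act) (auto simp: do_act_def)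

lemma op_simps [simp]:
  "query_free (op i h)" "n_used (op i h) = Suc i"
  "writes_below G (op i h) \<longleftrightarrow> (\<forall>a<G. fst (h a) < G)"
proof -
  have "\<exists>s. (\<forall>j. s j < G) \<and> s i = a" if "a < G" for a
    using that by (intro exI[of _ "\<lambda>_. a"]) simp
  then show "writes_below G (op i h) \<longleftrightarrow> (\<forall>a<G. fst (h a) < G)"
    by (auto simp: op_def)
qed (simp_all add: op_def)

text \<open>A register tape holding \<open>v\<close> has ones in cells 1 to \<open>v\<close> and its head on cell \<open>v\<close>;
  so the blank tape holds 0, and the register is zero iff the scanned cell is blank.\<close>

definition reg_tape :: "nat \<Rightarrow> tape" where
  "reg_tape v = (\<lambda>i. if 1 \<le> i \<and> i \<le> int v then 1 else 0, int v)"

lemma reg_tape_0: "reg_tape 0 = blank_tape"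
  by (auto simp: reg_tape_def blank_tape_def fun_eq_iff)

text \<open>Words are printed on tape 2, the query tape, with the head just behind the last bit.
  Tape 1 stays blank for the final answer, and register r lives on tape 3 + r.\<close>

definition conf :: "word \<Rightarrow> nat \<Rightarrow> word \<Rightarrow> (nat \<Rightarrow> nat) \<Rightarrow> tapes" where
  "conf x h w \<sigma> = (\<lambda>i. if i = 0 then (fst (word_tape x), int h) else if i = 1 then blank_tape
     else if i = 2 then (fst (word_tape w), int (length w)) else reg_tape (\<sigma> (i - 3)))"

definition inc :: "nat \<Rightarrow> prog" where
  "inc r = PSeq (op (3 + r) (\<lambda>a. (a, Move_right))) (op (3 + r) (\<lambda>a. (1, Stay)))"

definition dec :: "nat \<Rightarrow> prog" where
  "dec r = op (3 + r) (\<lambda>a. if a = 0 then (a, Stay) else (0, Move_left))"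

definition nz :: "nat \<Rightarrow> (nat \<Rightarrow> nat) \<Rightarrow> bool" where
  "nz r s \<longleftrightarrow> s (3 + r) \<noteq> 0"

definition emit :: "bool \<Rightarrow> prog" where
  "emit b = op 2 (\<lambda>a. (if b then 2 else 1, Move_right))"

definition skip :: prog where
  "skip = op 0 (\<lambda>a. (a, Stay))"

lemma nz_conf [simp]: "nz r (syms (conf x h w \<sigma>)) \<longleftrightarrow> \<sigma> r \<noteq> 0"
  by (auto simp: nz_def syms_def conf_def reg_tape_def)

lemma syms_conf_0: "syms (conf x h w \<sigma>) 0 = (if h < length x then if x ! h then 2 else 1 else 0)"
  by (auto simp: syms_def conf_def word_tape_def)

lemma runs_inc: "3 \<le> C \<Longrightarrow> runs g (inc r) (conf x h w \<sigma>) C (conf x h w (\<sigma>(r := Suc (\<sigma> r))))"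
  unfolding inc_def
  by (rule runs_Seq[OF runs_op[OF refl order_refl] runs_op[OF _ order_refl]])
     (auto simp: fun_eq_iff conf_def syms_def reg_tape_def)

lemma runs_dec: "1 \<le> C \<Longrightarrow> runs g (dec r) (conf x h w \<sigma>) C (conf x h w (\<sigma>(r := \<sigma> r - 1)))"
  unfolding dec_def
  by (rule runs_op) (auto simp: fun_eq_iff conf_def syms_def reg_tape_def)

lemma runs_emit: "1 \<le> C \<Longrightarrow> runs g (emit b) (conf x h w \<sigma>) C (conf x h (w @ [b]) \<sigma>)"
  unfolding emit_def
  by (rule runs_op) (auto simp: fun_eq_iff conf_def syms_def word_tape_def nth_append)

lemma runs_skip: "1 \<le> C \<Longrightarrow> runs g skip st C st"
  unfolding skip_def by (rule runs_op) auto

lemma runs_right: "1 \<le> C \<Longrightarrow> runs g (op 0 (\<lambda>a. (a, Move_right))) (conf x h w \<sigma>) C (conf x (Suc h) w \<sigma>)"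
  by (rule runs_op) (auto simp: fun_eq_iff conf_def syms_def)

lemma runs_left: "1 \<le> C \<Longrightarrow> runs g (op 0 (\<lambda>a. (a, Move_left))) (conf x (Suc h) w \<sigma>) C (conf x h w \<sigma>)"
  by (rule runs_op) (auto simp: fun_eq_iff conf_def syms_def)

section \<open>Arithmetic expressions and their compilation\<close>

definition upd :: "nat option \<Rightarrow> (nat \<Rightarrow> 'a) \<Rightarrow> 'a \<Rightarrow> nat \<Rightarrow> 'a" where
  "upd x f v = (case x of None \<Rightarrow> f | Some i \<Rightarrow> f(i := v))"

text \<open>The language stays within polynomial growth: a value is bounded by a polynomial in the
  input length and the variables. Unary registers are therefore affordable, while bounded sums still
  express bounded quantifiers and comparisons.\<close>

datatype aexp = Var nat | Cst nat | Add aexp aexp | Sub aexp aexp | Sum "nat option" aexp aexp | Bit aexp | Len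

text \<open>The environment has named variables; \<open>Sum None a b\<close> is the product.\<close>

fun aval :: "word \<Rightarrow> (nat \<Rightarrow> nat) \<Rightarrow> aexp \<Rightarrow> nat" where
  "aval x \<rho> (Var i) = \<rho> i"
| "aval x \<rho> (Cst c) = c"
| "aval x \<rho> (Add a b) = aval x \<rho> a + aval x \<rho> b"
| "aval x \<rho> (Sub a b) = aval x \<rho> a - aval x \<rho> b"
| "aval x \<rho> (Sum i a b) = (\<Sum>j<aval x \<rho> a. aval x (upd i \<rho> j) b)"
| "aval x \<rho> (Bit a) = (if aval x \<rho> a < length x \<and> x ! aval x \<rho> a then 1 else 0)"
| "aval x \<rho> Len = length x"

text \<open>The value is added to register \<open>r\<close>. The registers of the variables are
  given by \<open>ren\<close>, and those from \<open>t\<close> on are scratch, zero before and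
  after. Reading a variable empties its register, so a copy made in \<open>t\<close> is moved
  back.\<close>

fun comp :: "aexp \<Rightarrow> (nat \<Rightarrow> nat) \<Rightarrow> nat \<Rightarrow> nat \<Rightarrow> prog" where
  "comp (Var i) ren r t = PSeq (PWhile (nz (ren i)) (PSeq (dec (ren i)) (PSeq (inc t) (inc r))))
     (PWhile (nz t) (PSeq (dec t) (inc (ren i))))"
| "comp (Cst c) ren r t = ((PSeq (inc r)) ^^ c) skip"
| "comp (Add a b) ren r t = PSeq (comp a ren r t) (comp b ren r t)"
| "comp (Sub a b) ren r t = PSeq (comp a ren t (Suc t)) (PSeq (comp b ren (Suc t) (t + 2))
     (PSeq (PWhile (nz (Suc t)) (PSeq (dec (Suc t)) (dec t))) (PWhile (nz t) (PSeq (dec t) (inc r)))))"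
| "comp (Sum i a b) ren r t = PSeq (comp a ren t (Suc t))
     (PWhile (nz t) (PSeq (dec t) (comp b (upd i ren t) r (Suc t))))"
| "comp (Bit a) ren r t = PSeq (comp a ren t (Suc t))
     (PSeq (PWhile (nz t) (PSeq (dec t) (PSeq (inc (Suc t)) (op 0 (\<lambda>a. (a, Move_right))))))
     (PSeq (PIf (\<lambda>s. s 0 = 2) (inc r) skip)
       (PWhile (nz (Suc t)) (PSeq (dec (Suc t)) (op 0 (\<lambda>a. (a, Move_left)))))))"
| "comp Len ren r t = PSeq (PWhile (\<lambda>s. s 0 \<noteq> 0) (PSeq (op 0 (\<lambda>a. (a, Move_right))) (PSeq (inc t) (inc r))))
     (PWhile (nz t) (PSeq (dec t) (op 0 (\<lambda>a. (a, Move_left)))))"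

lemma comp_wf: "3 \<le> G \<Longrightarrow> writes_below G (comp e ren r t) \<and> query_free (comp e ren r t)"
proof (induction e arbitrary: ren r t)
  case (Cst c)
  then show ?case by (induction c) (auto simp: inc_def skip_def)
qed (auto simp: inc_def dec_def skip_def)

lemma poly_nat_mono: "a \<le> b \<Longrightarrow> poly p a \<le> poly p (b :: nat)"
  by (induction p) (auto intro: add_mono mult_mono)

lemma aval_bound:
  "\<exists>q. \<forall>x \<rho> N. (\<forall>i. \<rho> i \<le> N) \<longrightarrow> length x \<le> N \<longrightarrow> aval x \<rho> e \<le> poly q N"
proof (induction e)
  case (Var i)
  show ?case by (intro exI[of _ "[:0, 1:]"]) simp
next
  case (Cst c)
  show ?case by (intro exI[of _ "[:c:]"]) simp
next
  case (Add a b)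
  then obtain p q where "\<And>x \<rho> N. (\<forall>i. \<rho> i \<le> N) \<Longrightarrow> length x \<le> N \<Longrightarrow> aval x \<rho> a \<le> poly p N"
    "\<And>x \<rho> N. (\<forall>i. \<rho> i \<le> N) \<Longrightarrow> length x \<le> N \<Longrightarrow> aval x \<rho> b \<le> poly q N"
    by metis
  then show ?case by (intro exI[of _ "p + q"]) (simp add: add_mono)
next
  case (Sub a b)
  then obtain p where "\<And>x \<rho> N. (\<forall>i. \<rho> i \<le> N) \<Longrightarrow> length x \<le> N \<Longrightarrow> aval x \<rho> a \<le> poly p N"
    by metis
  then show ?case by (intro exI[of _ p]) (simp add: le_diff_conv trans_le_add1)
next
  case (Sum v a b)
  then obtain p q where p: "\<And>x \<rho> N. (\<forall>i. \<rho> i \<le> N) \<Longrightarrow> length x \<le> N \<Longrightarrow> aval x \<rho> a \<le> poly p N"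
    and q: "\<And>x \<rho> N. (\<forall>i. \<rho> i \<le> N) \<Longrightarrow> length x \<le> N \<Longrightarrow> aval x \<rho> b \<le> poly q N"
    by metis
  show ?case
  \<comment> \<open>The bound variable may exceed N but stays below the value of \<open>a\<close>;
    hence the bound for the body is taken at N + p(N).\<close>
  proof (intro exI[of _ "p * (q \<circ>\<^sub>p ([:0, 1:] + p))"] allI impI)
    fix x :: word and \<rho> :: "nat \<Rightarrow> nat" and N
    assume N: "\<forall>i. \<rho> i \<le> N" "length x \<le> N"
    have "aval x (upd v \<rho> j) b \<le> poly q (N + poly p N)" if "j < aval x \<rho> a" for j
      using that N p[OF N]
      by (intro q) (auto simp: upd_def trans_le_add1 split: option.splits)
    then have "(\<Sum>j<aval x \<rho> a. aval x (upd v \<rho> j) b) \<le> aval x \<rho> a * poly q (N + poly p N)"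
      using sum_bounded_above[of "{..<aval x \<rho> a}" "\<lambda>j. aval x (upd v \<rho> j) b"] by simp
    also have "\<dots> \<le> poly p N * poly q (N + poly p N)"
      using p[OF N] by (rule mult_right_mono) simp
    finally show "aval x \<rho> (Sum v a b) \<le> poly (p * (q \<circ>\<^sub>p ([:0, 1:] + p))) N"
      by (simp add: poly_pcompose)
  qed
next
  case (Bit a)
  show ?case by (intro exI[of _ "[:1:]"]) simp
next
  case Len
  show ?case by (intro exI[of _ "[:0, 1:]"]) simp
qed

text \<open>The common form of the loops that empty a register \<open>a\<close>: head position,
  printed word and the other registers are given as functions \<open>H\<close>, \<open>W\<close>,
  \<open>R\<close> of what is left in \<open>a\<close>.\<close>

lemma runs_drain:
  assumes "\<And>j. j < n \<Longrightarrow> runs g body (conf x (H (Suc j)) (W (Suc j)) ((R (Suc j))(a := j))) B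
      (conf x (H j) (W j) ((R j)(a := j)))"
    and "\<sigma> = (R n)(a := n)" "\<sigma>' = (R 0)(a := 0)" "h = H n" "h' = H 0" "w = W n" "w' = W 0"
    and "n * (B + 3) + 1 \<le> C"
  shows "runs g (PWhile (nz a) (PSeq (dec a) body)) (conf x h w \<sigma>) C (conf x h' w' \<sigma>')"
proof -
  let ?S = "\<lambda>j. conf x (H j) (W j) ((R j)(a := j))"
  have "runs g (PWhile (nz a) (PSeq (dec a) body)) (?S n) C (?S 0)"
  proof (rule runs_While)
    fix j assume j: "j < n"
    have "runs g (dec a) (?S (Suc j)) 1 (conf x (H (Suc j)) (W (Suc j)) ((R (Suc j))(a := j)))"
      using runs_dec[of 1 g a x "H (Suc j)" "W (Suc j)" "(R (Suc j))(a := Suc j)"] by simp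
    then have "runs g (PSeq (dec a) body) (?S (Suc j)) (B + 2) (?S j)"
      using assms(1)[OF j] by (rule runs_Seq) simp
    then show "nz a (syms (?S (Suc j))) \<and> runs g (PSeq (dec a) body) (?S (Suc j)) (B + 2) (?S j)"
      by simp
  qed (use assms(8) in \<open>auto simp: algebra_simps\<close>)
  then show ?thesis
    using assms by simp
qed

lemma runs_move:
  assumes "r \<noteq> t" "\<sigma>' = \<sigma>(t := 0, r := \<sigma> r + \<sigma> t)" "\<sigma> t * 6 + 1 \<le> C"
  shows "runs g (PWhile (nz t) (PSeq (dec t) (inc r))) (conf x h w \<sigma>) C (conf x h w \<sigma>')"
proof (rule runs_drain[where n = "\<sigma> t" and B = 3 and R = "\<lambda>j. \<sigma>(r := \<sigma> r + (\<sigma> t - j))" and H = "\<lambda>_. h" and W = "\<lambda>_. w"])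
  fix j assume "j < \<sigma> t"
  then have *: "\<sigma>(r := \<sigma> r + (\<sigma> t - j), t := j) =
      (\<sigma>(r := \<sigma> r + (\<sigma> t - Suc j), t := j))(r := Suc ((\<sigma>(r := \<sigma> r + (\<sigma> t - Suc j), t := j)) r))"
    using assms(1) by (auto simp: fun_eq_iff)
  show "runs g (inc r) (conf x h w (\<sigma>(r := \<sigma> r + (\<sigma> t - Suc j), t := j))) 3
      (conf x h w (\<sigma>(r := \<sigma> r + (\<sigma> t - j), t := j)))"
    unfolding * by (rule runs_inc) simp
qed (use assms in \<open>auto simp: fun_eq_iff\<close>)

lemma runs_copy:
  assumes "r \<noteq> t" "a \<noteq> t" "a \<noteq> r" "\<sigma>' = \<sigma>(a := 0, t := \<sigma> t + \<sigma> a, r := \<sigma> r + \<sigma> a)" "\<sigma> a * 10 + 1 \<le> C"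
  shows "runs g (PWhile (nz a) (PSeq (dec a) (PSeq (inc t) (inc r)))) (conf x h w \<sigma>) C (conf x h w \<sigma>')"
proof (rule runs_drain[where n = "\<sigma> a" and B = 7 and H = "\<lambda>_. h" and W = "\<lambda>_. w" and
      R = "\<lambda>j. \<sigma>(t := \<sigma> t + (\<sigma> a - j), r := \<sigma> r + (\<sigma> a - j))"])
  fix j assume "j < \<sigma> a"
  let ?\<tau> = "\<sigma>(t := \<sigma> t + (\<sigma> a - Suc j), r := \<sigma> r + (\<sigma> a - Suc j), a := j)"
  have *: "\<sigma>(t := \<sigma> t + (\<sigma> a - j), r := \<sigma> r + (\<sigma> a - j), a := j) =
      (?\<tau>(t := Suc (?\<tau> t)))(r := Suc ((?\<tau>(t := Suc (?\<tau> t))) r))"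
    using assms(1-3) \<open>j < \<sigma> a\<close> by (auto simp: fun_eq_iff)
  show "runs g (PSeq (inc t) (inc r)) (conf x h w ?\<tau>) 7
      (conf x h w (\<sigma>(t := \<sigma> t + (\<sigma> a - j), r := \<sigma> r + (\<sigma> a - j), a := j)))"
    unfolding * by (rule runs_Seq[OF runs_inc[OF order_refl] runs_inc[OF order_refl]]) simp
qed (use assms in \<open>auto simp: fun_eq_iff\<close>)

lemma runs_minus:
  assumes "a \<noteq> b" "\<sigma>' = \<sigma>(b := 0, a := \<sigma> a - \<sigma> b)" "\<sigma> b * 4 + 1 \<le> C"
  shows "runs g (PWhile (nz b) (PSeq (dec b) (dec a))) (conf x h w \<sigma>) C (conf x h w \<sigma>')"
proof (rule runs_drain[where n = "\<sigma> b" and B = 1 and R = "\<lambda>j. \<sigma>(a := \<sigma> a - (\<sigma> b - j))" and H = "\<lambda>_. h" and W = "\<lambda>_. w"])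
  fix j assume "j < \<sigma> b"
  let ?\<tau> = "\<sigma>(a := \<sigma> a - (\<sigma> b - Suc j), b := j)"
  have *: "\<sigma>(a := \<sigma> a - (\<sigma> b - j), b := j) = ?\<tau>(a := ?\<tau> a - 1)"
    using assms(1) \<open>j < \<sigma> b\<close> by (auto simp: fun_eq_iff)
  show "runs g (dec a) (conf x h w ?\<tau>) 1 (conf x h w (\<sigma>(a := \<sigma> a - (\<sigma> b - j), b := j)))"
    unfolding * by (rule runs_dec) simp
qed (use assms in \<open>auto simp: fun_eq_iff\<close>)

lemma runs_seek:
  assumes "t \<noteq> u" "\<sigma>' = \<sigma>(t := 0, u := \<sigma> u + \<sigma> t)" "h' = h + \<sigma> t" "\<sigma> t * 8 + 1 \<le> C"
  shows "runs g (PWhile (nz t) (PSeq (dec t) (PSeq (inc u) (op 0 (\<lambda>a. (a, Move_right))))))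
    (conf x h w \<sigma>) C (conf x h' w \<sigma>')"
proof (rule runs_drain[where n = "\<sigma> t" and B = 5 and H = "\<lambda>j. h + (\<sigma> t - j)" and W = "\<lambda>_. w" and
      R = "\<lambda>j. \<sigma>(u := \<sigma> u + (\<sigma> t - j))"])
  fix j assume j: "j < \<sigma> t"
  let ?\<tau> = "\<sigma>(u := \<sigma> u + (\<sigma> t - Suc j), t := j)"
  have *: "\<sigma>(u := \<sigma> u + (\<sigma> t - j), t := j) = ?\<tau>(u := Suc (?\<tau> u))"
    "h + (\<sigma> t - j) = Suc (h + (\<sigma> t - Suc j))"
    using assms(1) j by (auto simp: fun_eq_iff)
  show "runs g (PSeq (inc u) (op 0 (\<lambda>a. (a, Move_right)))) (conf x (h + (\<sigma> t - Suc j)) w ?\<tau>) 5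
      (conf x (h + (\<sigma> t - j)) w (\<sigma>(u := \<sigma> u + (\<sigma> t - j), t := j)))"
    unfolding * by (rule runs_Seq[OF runs_inc[OF order_refl] runs_right[OF order_refl]]) simp
qed (use assms in \<open>auto simp: fun_eq_iff\<close>)

lemma runs_return:
  assumes "\<sigma>' = \<sigma>(t := 0)" "h' + \<sigma> t = h" "\<sigma> t * 4 + 1 \<le> C"
  shows "runs g (PWhile (nz t) (PSeq (dec t) (op 0 (\<lambda>a. (a, Move_left))))) (conf x h w \<sigma>) C (conf x h' w \<sigma>')"
proof (rule runs_drain[where n = "\<sigma> t" and B = 1 and H = "\<lambda>j. h' + j" and W = "\<lambda>_. w" and R = "\<lambda>_. \<sigma>"])
  fix j assume "j < \<sigma> t"
  show "runs g (op 0 (\<lambda>a. (a, Move_left))) (conf x (h' + Suc j) w (\<sigma>(t := j))) 1 (conf x (h' + j) w (\<sigma>(t := j)))"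
    using runs_left[OF order_refl] by simp
qed (use assms in \<open>auto simp: fun_eq_iff\<close>)

lemma runs_len:
  assumes "r \<noteq> t" "\<sigma>' = \<sigma>(t := \<sigma> t + length x, r := \<sigma> r + length x)" "length x * 10 + 1 \<le> C"
  shows "runs g (PWhile (\<lambda>s. s 0 \<noteq> 0) (PSeq (op 0 (\<lambda>a. (a, Move_right))) (PSeq (inc t) (inc r))))
    (conf x 0 w \<sigma>) C (conf x (length x) w \<sigma>')"
proof -
  let ?n = "length x"
  let ?S = "\<lambda>j. conf x (?n - j) w (\<sigma>(t := \<sigma> t + (?n - j), r := \<sigma> r + (?n - j)))"
  have "runs g (PWhile (\<lambda>s. s 0 \<noteq> 0) (PSeq (op 0 (\<lambda>a. (a, Move_right))) (PSeq (inc t) (inc r)))) (?S ?n) C (?S 0)"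
  proof (rule runs_While)
    fix j assume j: "j < length x"
    let ?\<tau> = "\<sigma>(t := \<sigma> t + (?n - Suc j), r := \<sigma> r + (?n - Suc j))"
    have *: "\<sigma>(t := \<sigma> t + (?n - j), r := \<sigma> r + (?n - j)) = (?\<tau>(t := Suc (?\<tau> t)))(r := Suc ((?\<tau>(t := Suc (?\<tau> t))) r))"
      "?n - j = Suc (?n - Suc j)"
      using assms(1) j by (auto simp: fun_eq_iff)
    have "runs g (PSeq (op 0 (\<lambda>a. (a, Move_right))) (PSeq (inc t) (inc r))) (conf x (?n - Suc j) w ?\<tau>) 9
      (conf x (?n - j) w (\<sigma>(t := \<sigma> t + (?n - j), r := \<sigma> r + (?n - j))))"
      unfolding *(1) unfolding *(2)
      by (rule runs_Seq[OF runs_right[OF order_refl] runs_Seq[OF runs_inc[OF order_refl] runs_inc[OF order_refl] order_refl]]) simp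
    then show "syms (?S (Suc j)) 0 \<noteq> 0 \<and>
       runs g (PSeq (op 0 (\<lambda>a. (a, Move_right))) (PSeq (inc t) (inc r))) (?S (Suc j)) 9 (?S j)"
      using j by (simp add: syms_conf_0)
  qed (use assms in \<open>auto simp: syms_conf_0\<close>)
  then show ?thesis
    using assms(2) by (simp add: fun_upd_idem)
qed

definition adds :: "aexp \<Rightarrow> (nat \<Rightarrow> nat) \<Rightarrow> nat \<Rightarrow> nat \<Rightarrow> nat poly \<Rightarrow> bool" where
  "adds e ren r t q \<longleftrightarrow> (\<forall>g x w \<sigma> \<rho> N. (\<forall>i. \<rho> i \<le> N) \<longrightarrow> length x \<le> N \<longrightarrow>
     (\<forall>i. \<sigma> (ren i) = \<rho> i) \<longrightarrow> (\<forall>j\<ge>t. \<sigma> j = 0) \<longrightarrow>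
     runs g (comp e ren r t) (conf x 0 w \<sigma>) (poly q N) (conf x 0 w (\<sigma>(r := \<sigma> r + aval x \<rho> e))))"

lemma addsD:
  "adds e ren r t q \<Longrightarrow> \<forall>i. \<rho> i \<le> N \<Longrightarrow> length x \<le> N \<Longrightarrow> \<forall>i. \<sigma> (ren i) = \<rho> i \<Longrightarrow> \<forall>j\<ge>t. \<sigma> j = 0 \<Longrightarrow>
   runs g (comp e ren r t) (conf x 0 w \<sigma>) (poly q N) (conf x 0 w (\<sigma>(r := \<sigma> r + aval x \<rho> e)))"
  unfolding adds_def by blast

lemma ex_adds: "\<forall>i. ren i < t \<and> ren i \<noteq> r \<Longrightarrow> r < t \<Longrightarrow> \<exists>q. adds e ren r t q"
proof (induction e arbitrary: ren r t)
  case (Var i)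
  show ?case
    unfolding adds_def
  proof (intro exI[of _ "[:3, 16:]"] allI impI)
    fix g and x w :: word and \<sigma> \<rho> :: "nat \<Rightarrow> nat" and N
    assume N: "\<forall>i. \<rho> i \<le> N" and \<sigma>: "\<forall>i. \<sigma> (ren i) = \<rho> i" "\<forall>j\<ge>t. \<sigma> j = 0"
    have ne: "r \<noteq> t" "ren i \<noteq> t" "ren i \<noteq> r" "ren i < t" "r < t"
      using Var.prems by (auto simp: neq_iff)
    show "runs g (comp (Var i) ren r t) (conf x 0 w \<sigma>) (poly [:3, 16:] N) (conf x 0 w (\<sigma>(r := \<sigma> r + aval x \<rho> (Var i))))"
      unfolding comp.simps
      by (rule runs_Seq[OF runs_copy[OF ne(1-3) refl order_refl] runs_move[OF ne(2) _ order_refl]])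
        (use ne \<sigma> N[rule_format, of i] in \<open>auto simp: fun_eq_iff\<close>)
  qed
next
  case (Cst c)
  have "runs g (comp (Cst c) ren r t) (conf x 0 w \<sigma>) (4 * c + 1) (conf x 0 w (\<sigma>(r := \<sigma> r + c)))" for g x w \<sigma>
  proof (induction c arbitrary: \<sigma>)
    case 0
    show ?case by (simp add: runs_skip)
  next
    case (Suc c)
    have *: "\<sigma>(r := \<sigma> r + Suc c) = (\<sigma>(r := Suc (\<sigma> r)))(r := (\<sigma>(r := Suc (\<sigma> r))) r + c)"
      by (simp add: fun_eq_iff)
    show ?case
      unfolding * comp.simps funpow.simps o_apply
      by (rule runs_Seq[OF runs_inc[OF order_refl] Suc.IH[unfolded comp.simps]]) simp
  qed
  then show ?case by (intro exI[of _ "[:4 * c + 1:]"]) (simp add: adds_def)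
next
  case (Add a b)
  obtain p q where "adds a ren r t p" "adds b ren r t q"
    using Add.IH[OF Add.prems] by blast
  note p = addsD[OF this(1)] and q = addsD[OF this(2)]
  show ?case
    unfolding adds_def
  proof (intro exI[of _ "p + q + 1"] allI impI)
    fix g and x w :: word and \<sigma> \<rho> :: "nat \<Rightarrow> nat" and N
    assume N: "\<forall>i. \<rho> i \<le> N" "length x \<le> N" and \<sigma>: "\<forall>i. \<sigma> (ren i) = \<rho> i" "\<forall>j\<ge>t. \<sigma> j = 0"
    let ?\<tau> = "\<sigma>(r := \<sigma> r + aval x \<rho> a)"
    have \<tau>: "\<forall>i. ?\<tau> (ren i) = \<rho> i" "\<forall>j\<ge>t. ?\<tau> j = 0"
      using \<sigma> Add.prems by auto
    have *: "\<sigma>(r := \<sigma> r + aval x \<rho> (Add a b)) = ?\<tau>(r := ?\<tau> r + aval x \<rho> b)"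
      by (simp add: add.assoc)
    show "runs g (comp (Add a b) ren r t) (conf x 0 w \<sigma>) (poly (p + q + 1) N) (conf x 0 w (\<sigma>(r := \<sigma> r + aval x \<rho> (Add a b))))"
      unfolding * comp.simps by (rule runs_Seq[OF p[OF N \<sigma>] q[OF N \<tau>]]) simp
  qed
next
  case (Sub a b)
  have pre: "\<forall>i. ren i < Suc t \<and> ren i \<noteq> t" "t < Suc t" "\<forall>i. ren i < t + 2 \<and> ren i \<noteq> Suc t" "Suc t < t + 2"
    using Sub.prems by (auto simp: neq_iff less_Suc_eq)
  obtain p q where "adds a ren t (Suc t) p" "adds b ren (Suc t) (t + 2) q"
    using Sub.IH(1)[OF pre(1,2)] Sub.IH(2)[OF pre(3,4)] by blast
  note p = addsD[OF this(1)] and q = addsD[OF this(2)]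
  obtain ba where ba: "\<And>x \<rho> N. (\<forall>i. \<rho> i \<le> N) \<Longrightarrow> length x \<le> N \<Longrightarrow> aval x \<rho> a \<le> poly ba N"
    using aval_bound by metis
  obtain bb where bb: "\<And>x \<rho> N. (\<forall>i. \<rho> i \<le> N) \<Longrightarrow> length x \<le> N \<Longrightarrow> aval x \<rho> b \<le> poly bb N"
    using aval_bound by metis
  show ?case
    unfolding adds_def
  proof (intro exI[of _ "p + q + (smult 4 bb + 1) + (smult 6 ba + 1) + 3"] allI impI)
    fix g and x w :: word and \<sigma> \<rho> :: "nat \<Rightarrow> nat" and N
    assume N: "\<forall>i. \<rho> i \<le> N" "length x \<le> N" and \<sigma>: "\<forall>i. \<sigma> (ren i) = \<rho> i" "\<forall>j\<ge>t. \<sigma> j = 0"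
    let ?\<tau> = "\<sigma>(t := \<sigma> t + aval x \<rho> a)"
    let ?u = "?\<tau>(Suc t := ?\<tau> (Suc t) + aval x \<rho> b)"
    have ne: "\<And>i. ren i \<noteq> t" "\<And>i. ren i \<noteq> Suc t" "r \<noteq> t" "r \<noteq> Suc t"
      using Sub.prems by (auto simp: neq_iff less_Suc_eq)
    have \<tau>: "\<forall>j\<ge>Suc t. \<sigma> j = 0" "\<forall>i. ?\<tau> (ren i) = \<rho> i" "\<forall>j\<ge>t + 2. ?\<tau> j = 0"
      using \<sigma> ne by auto
    show "runs g (comp (Sub a b) ren r t) (conf x 0 w \<sigma>) (poly (p + q + (smult 4 bb + 1) + (smult 6 ba + 1) + 3) N)
        (conf x 0 w (\<sigma>(r := \<sigma> r + aval x \<rho> (Sub a b))))"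
      unfolding comp.simps
      by (rule runs_Seq[OF p[OF N \<sigma>(1) \<tau>(1)] runs_Seq[OF q[OF N \<tau>(2,3)]
          runs_Seq[OF runs_minus[where C = "poly (smult 4 bb + 1) N"] runs_move[where C = "poly (smult 6 ba + 1) N"] order_refl] order_refl]],
          rule n_not_Suc_n, rule refl)
        (use ne \<sigma>(2) ba[OF N] bb[OF N] in \<open>auto simp: fun_eq_iff\<close>)
  qed
next
  case (Sum v a b)
  have pre: "\<forall>i. ren i < Suc t \<and> ren i \<noteq> t" "t < Suc t"
    "\<forall>i. upd v ren t i < Suc t \<and> upd v ren t i \<noteq> r" "r < Suc t"
    using Sum.prems by (auto simp: neq_iff less_Suc_eq upd_def split: option.splits)
  obtain p q where "adds a ren t (Suc t) p" "adds b (upd v ren t) r (Suc t) q"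
    using Sum.IH(1)[OF pre(1,2)] Sum.IH(2)[OF pre(3,4)] by blast
  note p = addsD[OF this(1)] and q = addsD[OF this(2)]
  obtain ba where ba: "\<And>x \<rho> N. (\<forall>i. \<rho> i \<le> N) \<Longrightarrow> length x \<le> N \<Longrightarrow> aval x \<rho> a \<le> poly ba N"
    using aval_bound by metis
  let ?q = "q \<circ>\<^sub>p ([:0, 1:] + ba)"
  show ?case
    unfolding adds_def
  proof (intro exI[of _ "p + (ba * (?q + 3) + 1) + 1"] allI impI)
    fix g and x w :: word and \<sigma> \<rho> :: "nat \<Rightarrow> nat" and N
    assume N: "\<forall>i. \<rho> i \<le> N" "length x \<le> N" and \<sigma>: "\<forall>i. \<sigma> (ren i) = \<rho> i" "\<forall>j\<ge>t. \<sigma> j = 0"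
    have ne: "\<And>i. ren i \<noteq> t" "\<And>i. ren i \<noteq> r" "r \<noteq> t" "\<And>i. ren i < t"
      using Sum.prems by (auto simp: neq_iff)
    let ?n = "aval x \<rho> a"
    \<comment> \<open>The counter is emptied from n to 0 and doubles as the bound variable, so the
      summands arrive in the order n - 1, ..., 0; \<open>F j\<close> collects those from j
      on.\<close>
    define F where "F j = (\<Sum>i\<in>{j..<?n}. aval x (upd v \<rho> i) b)" for j
    have \<tau>: "\<forall>j\<ge>Suc t. \<sigma> j = 0"
      using \<sigma> by auto
    show "runs g (comp (Sum v a b) ren r t) (conf x 0 w \<sigma>) (poly (p + (ba * (?q + 3) + 1) + 1) N)
        (conf x 0 w (\<sigma>(r := \<sigma> r + aval x \<rho> (Sum v a b))))"
      unfolding comp.simps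
    proof (rule runs_Seq[OF p[OF N \<sigma>(1) \<tau>]])
      show "runs g (PWhile (nz t) (PSeq (dec t) (comp b (upd v ren t) r (Suc t)))) (conf x 0 w (\<sigma>(t := \<sigma> t + ?n)))
          (poly (ba * (?q + 3) + 1) N) (conf x 0 w (\<sigma>(r := \<sigma> r + aval x \<rho> (Sum v a b))))"
      proof (rule runs_drain[where n = ?n and B = "poly ?q N" and H = "\<lambda>_. 0" and W = "\<lambda>_. w" and R = "\<lambda>j. \<sigma>(r := \<sigma> r + F j)"])
        fix j assume j: "j < ?n"
        let ?\<sigma> = "\<sigma>(r := \<sigma> r + F (Suc j), t := j)"
        have F: "F j = F (Suc j) + aval x (upd v \<rho> j) b"
          using j by (simp add: F_def sum.atLeast_Suc_lessThan add.commute)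
        have *: "\<sigma>(r := \<sigma> r + F j, t := j) = ?\<sigma>(r := ?\<sigma> r + aval x (upd v \<rho> j) b)"
          using ne by (auto simp: fun_eq_iff F)
        have "runs g (comp b (upd v ren t) r (Suc t)) (conf x 0 w ?\<sigma>) (poly q (N + poly ba N))
            (conf x 0 w (?\<sigma>(r := ?\<sigma> r + aval x (upd v \<rho> j) b)))"
          by (rule q) (use N \<sigma> ne j ba[OF N] Sum.prems in \<open>auto simp: upd_def trans_le_add1 split: option.splits\<close>)
        then show "runs g (comp b (upd v ren t) r (Suc t)) (conf x 0 w ?\<sigma>) (poly ?q N)
            (conf x 0 w (\<sigma>(r := \<sigma> r + F j, t := j)))"
          unfolding * by (simp add: poly_pcompose)
      next
        show "?n * (poly ?q N + 3) + 1 \<le> poly (ba * (?q + 3) + 1) N"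
          using mult_right_mono[OF ba[OF N], of "poly ?q N + 3"] by simp
      qed (use \<sigma> ne in \<open>auto simp: fun_eq_iff F_def atLeast0LessThan\<close>)
    qed simp
  qed
next
  case (Bit a)
  have pre: "\<forall>i. ren i < Suc t \<and> ren i \<noteq> t" "t < Suc t"
    using Bit.prems by (auto simp: neq_iff less_Suc_eq)
  obtain p where "adds a ren t (Suc t) p"
    using Bit.IH[OF pre] by blast
  note p = addsD[OF this]
  obtain ba where ba: "\<And>x \<rho> N. (\<forall>i. \<rho> i \<le> N) \<Longrightarrow> length x \<le> N \<Longrightarrow> aval x \<rho> a \<le> poly ba N"
    using aval_bound by metis
  show ?case
    unfolding adds_def
  proof (intro exI[of _ "p + (smult 8 ba + 1) + 4 + (smult 4 ba + 1) + 3"] allI impI)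
    fix g and x w :: word and \<sigma> \<rho> :: "nat \<Rightarrow> nat" and N
    assume N: "\<forall>i. \<rho> i \<le> N" "length x \<le> N" and \<sigma>: "\<forall>i. \<sigma> (ren i) = \<rho> i" "\<forall>j\<ge>t. \<sigma> j = 0"
    have ne: "\<And>i. ren i \<noteq> t" "\<And>i. ren i \<noteq> Suc t" "r \<noteq> t" "r \<noteq> Suc t"
      using Bit.prems by (auto simp: neq_iff less_Suc_eq)
    let ?n = "aval x \<rho> a"
    let ?\<tau> = "\<sigma>(Suc t := ?n)"
    have \<tau>: "\<forall>j\<ge>Suc t. \<sigma> j = 0"
      using \<sigma> by auto
    have B: "runs g (PIf (\<lambda>s. s 0 = 2) (inc r) skip) (conf x ?n w ?\<tau>) 4 (conf x ?n w (?\<tau>(r := ?\<tau> r + aval x \<rho> (Bit a))))"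
    proof (rule runs_If)
      assume "syms (conf x ?n w ?\<tau>) 0 = 2"
      then have "?\<tau>(r := ?\<tau> r + aval x \<rho> (Bit a)) = ?\<tau>(r := Suc (?\<tau> r))"
        by (auto simp: syms_conf_0 split: if_splits)
      then show "runs g (inc r) (conf x ?n w ?\<tau>) 3 (conf x ?n w (?\<tau>(r := ?\<tau> r + aval x \<rho> (Bit a))))"
        using runs_inc[OF order_refl, of g r x ?n w ?\<tau>] by presburger
    next
      assume "syms (conf x ?n w ?\<tau>) 0 \<noteq> 2"
      then have "?\<tau>(r := ?\<tau> r + aval x \<rho> (Bit a)) = ?\<tau>"
        by (auto simp: syms_conf_0 fun_eq_iff split: if_splits)
      then show "runs g skip (conf x ?n w ?\<tau>) 1 (conf x ?n w (?\<tau>(r := ?\<tau> r + aval x \<rho> (Bit a))))"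
        using runs_skip[OF order_refl, of g "conf x ?n w ?\<tau>"] by presburger
    qed simp
    show "runs g (comp (Bit a) ren r t) (conf x 0 w \<sigma>) (poly (p + (smult 8 ba + 1) + 4 + (smult 4 ba + 1) + 3) N)
        (conf x 0 w (\<sigma>(r := \<sigma> r + aval x \<rho> (Bit a))))"
      unfolding comp.simps(6)
      by (rule runs_Seq[OF p[OF N \<sigma>(1) \<tau>] runs_Seq[OF runs_seek[where C = "poly (smult 8 ba + 1) N"]
          runs_Seq[OF B runs_return[where C = "poly (smult 4 ba + 1) N"] order_refl] order_refl]], rule n_not_Suc_n)
        (use ne \<sigma>(2) ba[OF N] in \<open>auto simp: fun_eq_iff\<close>)
  qed
next
  case Len
  show ?case
    unfolding adds_def
  proof (intro exI[of _ "[:3, 14:]"] allI impI)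
    fix g and x w :: word and \<sigma> \<rho> :: "nat \<Rightarrow> nat" and N
    assume N: "length x \<le> N" and \<sigma>: "\<forall>j\<ge>t. \<sigma> j = 0"
    have ne: "r \<noteq> t" "r < t"
      using Len.prems by auto
    show "runs g (comp Len ren r t) (conf x 0 w \<sigma>) (poly [:3, 14:] N) (conf x 0 w (\<sigma>(r := \<sigma> r + aval x \<rho> Len)))"
      unfolding comp.simps
      by (rule runs_Seq[OF runs_len[OF ne(1) refl order_refl] runs_return[OF _ _ order_refl]])
        (use ne \<sigma> N in \<open>auto simp: fun_eq_iff\<close>)
  qed
qed

section \<open>Loop programs that print a word\<close>

datatype stm = Emit bool | Skip | Then stm stm | Cond aexp stm stm | For nat aexp stm

fun sem :: "word \<Rightarrow> (nat \<Rightarrow> nat) \<Rightarrow> stm \<Rightarrow> word" where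
  "sem x \<rho> (Emit b) = [b]"
| "sem x \<rho> Skip = []"
| "sem x \<rho> (Then a b) = sem x \<rho> a @ sem x \<rho> b"
| "sem x \<rho> (Cond e a b) = (if aval x \<rho> e \<noteq> 0 then sem x \<rho> a else sem x \<rho> b)"
| "sem x \<rho> (For i e a) = concat (map (\<lambda>j. sem x (\<rho>(i := j)) a) [0..<aval x \<rho> e])"

text \<open>Unlike summation, printing depends on the order. A loop thus keeps two registers:
  \<open>t\<close> counts the remaining rounds down, \<open>Suc t\<close> counts up and holds the
  loop variable.\<close>

fun scomp :: "stm \<Rightarrow> (nat \<Rightarrow> nat) \<Rightarrow> nat \<Rightarrow> prog" where
  "scomp (Emit b) ren t = emit b"
| "scomp Skip ren t = skip"
| "scomp (Then a b) ren t = PSeq (scomp a ren t) (scomp b ren t)"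
| "scomp (Cond e a b) ren t = PSeq (comp e ren t (Suc t))
     (PIf (nz t) (PSeq (PWhile (nz t) (PSeq (dec t) skip)) (scomp a ren t)) (scomp b ren t))"
| "scomp (For i e a) ren t = PSeq (comp e ren t (Suc t))
     (PSeq (PWhile (nz t) (PSeq (dec t) (PSeq (scomp a (ren(i := Suc t)) (t + 2)) (inc (Suc t)))))
       (PWhile (nz (Suc t)) (PSeq (dec (Suc t)) skip)))"

lemma scomp_wf: "3 \<le> G \<Longrightarrow> writes_below G (scomp s ren t) \<and> query_free (scomp s ren t)"
  by (induction s arbitrary: ren t) (auto simp: comp_wf inc_def dec_def skip_def emit_def)

lemma runs_clear:
  assumes "\<sigma>' = \<sigma>(t := 0)" "\<sigma> t * 4 + 1 \<le> C"
  shows "runs g (PWhile (nz t) (PSeq (dec t) skip)) (conf x h w \<sigma>) C (conf x h w \<sigma>')"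
  by (rule runs_drain[where n = "\<sigma> t" and B = 1 and H = "\<lambda>_. h" and W = "\<lambda>_. w" and R = "\<lambda>_. \<sigma>"])
    (use assms in \<open>auto simp: runs_skip\<close>)

definition prints :: "stm \<Rightarrow> (nat \<Rightarrow> nat) \<Rightarrow> nat \<Rightarrow> nat poly \<Rightarrow> bool" where
  "prints s ren t q \<longleftrightarrow> (\<forall>g x w \<sigma> \<rho> N. (\<forall>i. \<rho> i \<le> N) \<longrightarrow> length x \<le> N \<longrightarrow>
     (\<forall>i. \<sigma> (ren i) = \<rho> i) \<longrightarrow> (\<forall>j\<ge>t. \<sigma> j = 0) \<longrightarrow>
     runs g (scomp s ren t) (conf x 0 w \<sigma>) (poly q N) (conf x 0 (w @ sem x \<rho> s) \<sigma>))"

lemma printsD: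
  "prints s ren t q \<Longrightarrow> \<forall>i. \<rho> i \<le> N \<Longrightarrow> length x \<le> N \<Longrightarrow> \<forall>i. \<sigma> (ren i) = \<rho> i \<Longrightarrow> \<forall>j\<ge>t. \<sigma> j = 0 \<Longrightarrow>
   runs g (scomp s ren t) (conf x 0 w \<sigma>) (poly q N) (conf x 0 (w @ sem x \<rho> s) \<sigma>)"
  unfolding prints_def by blast

lemma ex_prints: "\<forall>i. ren i < t \<Longrightarrow> \<exists>q. prints s ren t q"
proof (induction s arbitrary: ren t)
  case (Emit b)
  show ?case by (intro exI[of _ 1]) (simp add: prints_def runs_emit)
next
  case Skip
  show ?case by (intro exI[of _ 1]) (simp add: prints_def runs_skip)
next
  case (Then a b)
  obtain p q where pq: "prints a ren t p" "prints b ren t q"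
    using Then by blast
  show ?case
    unfolding prints_def
  proof (intro exI[of _ "p + q + 1"] allI impI)
    fix g and x w :: word and \<sigma> \<rho> :: "nat \<Rightarrow> nat" and N
    assume *: "\<forall>i. \<rho> i \<le> N" "length x \<le> N" "\<forall>i. \<sigma> (ren i) = \<rho> i" "\<forall>j\<ge>t. \<sigma> j = 0"
    show "runs g (scomp (Then a b) ren t) (conf x 0 w \<sigma>) (poly (p + q + 1) N) (conf x 0 (w @ sem x \<rho> (Then a b)) \<sigma>)"
      unfolding scomp.simps sem.simps append_assoc[symmetric]
      by (rule runs_Seq[OF printsD[OF pq(1) *] printsD[OF pq(2) *]]) simp
  qed
next
  case (Cond e a b)
  obtain p q where pq: "prints a ren t p" "prints b ren t q"
    using Cond by blast
  have "\<forall>i. ren i < Suc t \<and> ren i \<noteq> t" "t < Suc t"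
    using Cond.prems by (auto simp: neq_iff less_Suc_eq)
  from ex_adds[OF this] obtain r where r: "adds e ren t (Suc t) r"
    by blast
  obtain be where be: "\<And>x \<rho> N. (\<forall>i. \<rho> i \<le> N) \<Longrightarrow> length x \<le> N \<Longrightarrow> aval x \<rho> e \<le> poly be N"
    using aval_bound by metis
  show ?case
    unfolding prints_def
  proof (intro exI[of _ "r + (smult 4 be + 1 + p + 1 + q + 1) + 1"] allI impI)
    fix g and x w :: word and \<sigma> \<rho> :: "nat \<Rightarrow> nat" and N
    assume N: "\<forall>i. \<rho> i \<le> N" "length x \<le> N" and \<sigma>: "\<forall>i. \<sigma> (ren i) = \<rho> i" "\<forall>j\<ge>t. \<sigma> j = 0"
    let ?n = "aval x \<rho> e"
    have \<tau>: "\<forall>j\<ge>Suc t. \<sigma> j = 0" "\<sigma> t = 0"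
      using \<sigma> by auto
    have A: "runs g (PSeq (PWhile (nz t) (PSeq (dec t) skip)) (scomp a ren t)) (conf x 0 w (\<sigma>(t := ?n)))
        (poly (smult 4 be + 1 + p + 1) N) (conf x 0 (w @ sem x \<rho> a) \<sigma>)"
      by (rule runs_Seq[OF runs_clear[where C = "poly (smult 4 be + 1) N"] printsD[OF pq(1) N \<sigma>]])
        (use \<tau> be[OF N] in auto)
    show "runs g (scomp (Cond e a b) ren t) (conf x 0 w \<sigma>) (poly (r + (smult 4 be + 1 + p + 1 + q + 1) + 1) N)
        (conf x 0 (w @ sem x \<rho> (Cond e a b)) \<sigma>)"
      unfolding scomp.simps
    proof (rule runs_Seq[OF addsD[OF r N \<sigma>(1) \<tau>(1)]])
      show "runs g (PIf (nz t) (PSeq (PWhile (nz t) (PSeq (dec t) skip)) (scomp a ren t)) (scomp b ren t))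
         (conf x 0 w (\<sigma>(t := \<sigma> t + ?n))) (poly (smult 4 be + 1 + p + 1 + q + 1) N)
         (conf x 0 (w @ sem x \<rho> (Cond e a b)) \<sigma>)"
      proof (rule runs_If)
        assume "nz t (syms (conf x 0 w (\<sigma>(t := \<sigma> t + ?n))))"
        then show "runs g (PSeq (PWhile (nz t) (PSeq (dec t) skip)) (scomp a ren t)) (conf x 0 w (\<sigma>(t := \<sigma> t + ?n)))
           (poly (smult 4 be + 1 + p + 1) N) (conf x 0 (w @ sem x \<rho> (Cond e a b)) \<sigma>)"
          using A \<tau> by simp
      next
        assume "\<not> nz t (syms (conf x 0 w (\<sigma>(t := \<sigma> t + ?n))))"
        then show "runs g (scomp b ren t) (conf x 0 w (\<sigma>(t := \<sigma> t + ?n)))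
           (poly q N) (conf x 0 (w @ sem x \<rho> (Cond e a b)) \<sigma>)"
          using printsD[OF pq(2) N \<sigma>, of g w] \<tau> by (simp add: fun_upd_idem)
      qed simp
    qed simp
  qed
next
  case (For i e a)
  have pre: "\<forall>k. (ren(i := Suc t)) k < t + 2" "\<forall>i. ren i < Suc t \<and> ren i \<noteq> t" "t < Suc t"
    using For.prems by (auto simp: neq_iff less_Suc_eq)
  obtain p where p: "prints a (ren(i := Suc t)) (t + 2) p"
    using For.IH[OF pre(1)] by blast
  obtain r where r: "adds e ren t (Suc t) r"
    using ex_adds[OF pre(2,3)] by blast
  obtain be where be: "\<And>x \<rho> N. (\<forall>i. \<rho> i \<le> N) \<Longrightarrow> length x \<le> N \<Longrightarrow> aval x \<rho> e \<le> poly be N"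
    using aval_bound by metis
  let ?p = "p \<circ>\<^sub>p ([:0, 1:] + be)"
  show ?case
    unfolding prints_def
  proof (intro exI[of _ "r + (be * (?p + 4 + 3) + 1) + (smult 4 be + 1) + 2"] allI impI)
    fix g and x w :: word and \<sigma> \<rho> :: "nat \<Rightarrow> nat" and N
    assume N: "\<forall>i. \<rho> i \<le> N" "length x \<le> N" and \<sigma>: "\<forall>i. \<sigma> (ren i) = \<rho> i" "\<forall>j\<ge>t. \<sigma> j = 0"
    let ?n = "aval x \<rho> e"
    have \<tau>: "\<forall>j\<ge>Suc t. \<sigma> j = 0" "\<sigma> t = 0" "\<sigma> (Suc t) = 0"
      using \<sigma> by auto
    define W where "W j = w @ concat (map (\<lambda>j. sem x (\<rho>(i := j)) a) [0..<?n - j])" for j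
    have loop: "runs g (PWhile (nz t) (PSeq (dec t) (PSeq (scomp a (ren(i := Suc t)) (t + 2)) (inc (Suc t)))))
        (conf x 0 w (\<sigma>(t := ?n))) (poly (be * (?p + 4 + 3) + 1) N) (conf x 0 (w @ sem x \<rho> (For i e a)) (\<sigma>(Suc t := ?n)))"
    proof (rule runs_drain[where n = ?n and B = "poly (?p + 4) N" and H = "\<lambda>_. 0" and W = W and R = "\<lambda>j. \<sigma>(Suc t := ?n - j)"])
      fix j assume j: "j < ?n"
      let ?\<sigma> = "\<sigma>(Suc t := ?n - Suc j, t := j)"
      have W: "W j = W (Suc j) @ sem x (\<rho>(i := ?n - Suc j)) a"
        using j by (simp add: W_def Suc_diff_Suc[symmetric])
      have *: "\<sigma>(Suc t := ?n - j, t := j) = ?\<sigma>(Suc t := Suc (?\<sigma> (Suc t)))"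
        using j by (auto simp: fun_eq_iff)
      have ren: "ren k \<noteq> t" "ren k \<noteq> Suc t" for k
        using For.prems by (auto simp: neq_iff less_Suc_eq)
      have "runs g (scomp a (ren(i := Suc t)) (t + 2)) (conf x 0 (W (Suc j)) ?\<sigma>) (poly p (N + poly be N)) (conf x 0 (W j) ?\<sigma>)"
        unfolding W
        by (rule printsD[OF p]) (use N \<sigma> be[OF N] ren in \<open>auto simp: trans_le_add1 trans_le_add2\<close>)
      then show "runs g (PSeq (scomp a (ren(i := Suc t)) (t + 2)) (inc (Suc t))) (conf x 0 (W (Suc j)) ?\<sigma>) (poly (?p + 4) N)
          (conf x 0 (W j) (\<sigma>(Suc t := ?n - j, t := j)))"
        unfolding * by (rule runs_Seq[OF _ runs_inc[OF order_refl]]) (simp add: poly_pcompose)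
    next
      show "?n * (poly (?p + 4) N + 3) + 1 \<le> poly (be * (?p + 4 + 3) + 1) N"
        using mult_right_mono[OF be[OF N], of "poly ?p N + 7"] by (simp add: algebra_simps)
    qed (use \<tau> in \<open>auto simp: W_def fun_eq_iff\<close>)
    show "runs g (scomp (For i e a) ren t) (conf x 0 w \<sigma>) (poly (r + (be * (?p + 4 + 3) + 1) + (smult 4 be + 1) + 2) N)
        (conf x 0 (w @ sem x \<rho> (For i e a)) \<sigma>)"
      unfolding scomp.simps
    proof (rule runs_Seq[OF addsD[OF r N \<sigma>(1) \<tau>(1)] runs_Seq[OF _ runs_clear[where C = "poly (smult 4 be + 1) N"] order_refl]])
      show "runs g (PWhile (nz t) (PSeq (dec t) (PSeq (scomp a (ren(i := Suc t)) (t + 2)) (inc (Suc t)))))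
        (conf x 0 w (\<sigma>(t := \<sigma> t + ?n))) (poly (be * (?p + 4 + 3) + 1) N) (conf x 0 (w @ sem x \<rho> (For i e a)) (\<sigma>(Suc t := ?n)))"
        using loop \<tau> by simp
    qed (use \<tau> be[OF N] in \<open>auto simp: fun_eq_iff\<close>)
  qed
qed

section \<open>Handing over the printed word\<close>

lemma act_move [simp]:
  "act (syms st i, Move_left) (st i) = (fst (st i), snd (st i) - 1)"
  "act (syms st i, Move_right) (st i) = (fst (st i), snd (st i) + 1)"
  by (cases "st i"; simp add: syms_def)+

definition inp :: "word \<Rightarrow> tapes" where
  "inp x = (\<lambda>i. if i = 0 then word_tape x else blank_tape)"

text \<open>A tape is read from its head to the right, so the head has to return from behind the
  word to its first cell. The first blank to the left is cell -1.\<close>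

definition rewind :: prog where
  "rewind = PSeq (op 2 (\<lambda>a. (a, Move_left))) (PSeq
     (PWhile (\<lambda>s. s 2 \<noteq> 0) (op 2 (\<lambda>a. (a, Move_left)))) (op 2 (\<lambda>a. (a, Move_right))))"

lemma runs_rewind:
  assumes "st 2 = (fst (word_tape w), int (length w))" "2 * length w + 5 \<le> C"
  shows "runs g rewind st C (st(2 := word_tape w))"
proof -
  let ?S = "\<lambda>j. st(2 := (fst (word_tape w), int j - 1))"
  have loop: "runs g (PWhile (\<lambda>s. s 2 \<noteq> 0) (op 2 (\<lambda>a. (a, Move_left)))) (?S (length w)) (length w * 2 + 1) (?S 0)"
  proof (rule runs_While[where B = 1])
    fix j assume "j < length w"
    then have "syms (?S (Suc j)) 2 \<noteq> 0"
      by (simp add: syms_def word_tape_def)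
    moreover have "runs g (op 2 (\<lambda>a. (a, Move_left))) (?S (Suc j)) 1 (?S j)"
      by (rule runs_op, subst act_move) simp_all
    ultimately show "syms (?S (Suc j)) 2 \<noteq> 0 \<and> runs g (op 2 (\<lambda>a. (a, Move_left))) (?S (Suc j)) 1 (?S j)"
      by simp
  qed (auto simp: syms_def word_tape_def)
  show ?thesis
    unfolding rewind_def
    by (rule runs_Seq[OF runs_op[OF _ order_refl] runs_Seq[OF loop runs_op[OF _ order_refl] order_refl]], unfold act_move)
      (use assms in \<open>simp_all add: word_tape_def\<close>)
qed

lemma sem_bound: "\<exists>q. \<forall>x \<rho> N. (\<forall>i. \<rho> i \<le> N) \<longrightarrow> length x \<le> N \<longrightarrow> length (sem x \<rho> s) \<le> poly q N"
proof (induction s)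
  case (Emit b)
  show ?case by (intro exI[of _ 1]) simp
next
  case Skip
  show ?case by (intro exI[of _ 1]) simp
next
  case (Then a b)
  then obtain p q where "\<And>x \<rho> N. (\<forall>i. \<rho> i \<le> N) \<Longrightarrow> length x \<le> N \<Longrightarrow> length (sem x \<rho> a) \<le> poly p N"
    "\<And>x \<rho> N. (\<forall>i. \<rho> i \<le> N) \<Longrightarrow> length x \<le> N \<Longrightarrow> length (sem x \<rho> b) \<le> poly q N"
    by metis
  then show ?case by (intro exI[of _ "p + q"]) (simp add: add_mono)
next
  case (Cond e a b)
  then obtain p q where "\<And>x \<rho> N. (\<forall>i. \<rho> i \<le> N) \<Longrightarrow> length x \<le> N \<Longrightarrow> length (sem x \<rho> a) \<le> poly p N"
    "\<And>x \<rho> N. (\<forall>i. \<rho> i \<le> N) \<Longrightarrow> length x \<le> N \<Longrightarrow> length (sem x \<rho> b) \<le> poly q N"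
    by metis
  then show ?case by (intro exI[of _ "p + q"]) (simp add: trans_le_add1 trans_le_add2)
next
  case (For i e a)
  then obtain p where p: "\<And>x \<rho> N. (\<forall>i. \<rho> i \<le> N) \<Longrightarrow> length x \<le> N \<Longrightarrow> length (sem x \<rho> a) \<le> poly p N"
    by metis
  obtain q where q: "\<And>x \<rho> N. (\<forall>i. \<rho> i \<le> N) \<Longrightarrow> length x \<le> N \<Longrightarrow> aval x \<rho> e \<le> poly q N"
    using aval_bound by metis
  show ?case
  proof (intro exI[of _ "q * (p \<circ>\<^sub>p ([:0, 1:] + q))"] allI impI)
    fix x :: word and \<rho> :: "nat \<Rightarrow> nat" and N
    assume N: "\<forall>i. \<rho> i \<le> N" "length x \<le> N"
    have "length (sem x (\<rho>(i := j)) a) \<le> poly p (N + poly q N)" if "j < aval x \<rho> e" for j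
      using that N q[OF N] by (intro p) (auto simp: trans_le_add1)
    then have "length (sem x \<rho> (For i e a)) \<le> (\<Sum>j\<leftarrow>[0..<aval x \<rho> e]. poly p (N + poly q N))"
      unfolding sem.simps length_concat map_map o_def by (intro sum_list_mono) auto
    also have "\<dots> = aval x \<rho> e * poly p (N + poly q N)"
      by (simp add: sum_list_triv)
    also have "\<dots> \<le> poly q N * poly p (N + poly q N)"
      using q[OF N] by (rule mult_right_mono) simp
    finally show "length (sem x \<rho> (For i e a)) \<le> poly (q * (p \<circ>\<^sub>p ([:0, 1:] + q))) N"
      by (simp add: poly_pcompose)
  qed
qed

text \<open>Register 0 stays zero; it serves all variables that are not bound by a loop.\<close>

theorem stm_to_prog:
  obtains p q where "\<And>G. 3 \<le> G \<Longrightarrow> writes_below G p" "query_free p"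
    "\<And>g x. runs g p (inp x) (poly q (length x)) ((inp x)(2 := word_tape (sem x (\<lambda>_. 0) s)))"
proof -
  obtain q where q: "prints s (\<lambda>_. 0) 1 q"
    using ex_prints[of "\<lambda>_. 0" 1 s] by auto
  obtain b where b: "\<And>x \<rho> N. (\<forall>i. \<rho> i \<le> N) \<Longrightarrow> length x \<le> N \<Longrightarrow> length (sem x \<rho> s) \<le> poly b N"
    using sem_bound by metis
  show thesis
  proof
    let ?p = "PSeq (scomp s (\<lambda>_. 0) 1) rewind"
    show "3 \<le> G \<Longrightarrow> writes_below G ?p" "query_free ?p" for G
      using scomp_wf[of G s] scomp_wf[of 3 s] by (auto simp: rewind_def)
    fix g x
    let ?w = "sem x (\<lambda>_. 0) s"
    have start: "conf x 0 [] (\<lambda>_. 0) = inp x"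
      by (auto simp: conf_def inp_def reg_tape_0 fun_eq_iff word_tape_def blank_tape_def)
    have stop: "(conf x 0 ?w (\<lambda>_. 0))(2 := word_tape ?w) = (inp x)(2 := word_tape ?w)"
      by (auto simp: conf_def inp_def reg_tape_0 fun_eq_iff word_tape_def)
    have "runs g (scomp s (\<lambda>_. 0) 1) (conf x 0 [] (\<lambda>_. 0)) (poly q (length x)) (conf x 0 ([] @ ?w) (\<lambda>_. 0))"
      by (rule printsD[OF q]) auto
    then have 1: "runs g (scomp s (\<lambda>_. 0) 1) (inp x) (poly q (length x)) (conf x 0 ?w (\<lambda>_. 0))"
      by (simp add: start)
    have "2 * length ?w + 5 \<le> poly (smult 2 b + 5) (length x)"
      using b[of "\<lambda>_. 0" "length x" x] by simp
    then have 2: "runs g rewind (conf x 0 ?w (\<lambda>_. 0)) (poly (smult 2 b + 5) (length x)) ((inp x)(2 := word_tape ?w))"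
      unfolding stop[symmetric] by (intro runs_rewind) (auto simp: conf_def)
    show "runs g ?p (inp x) (poly (q + (smult 2 b + 5) + 1) (length x)) ((inp x)(2 := word_tape ?w))"
      using runs_Seq[OF 1 2] by simp
  qed
qed

section \<open>Running one machine inside another\<close>

lemma runs_WhileF: "\<not> c (syms st) \<Longrightarrow> 1 \<le> C \<Longrightarrow> runs g (PWhile c a) st C st"
  unfolding runs_def using big.WhileF by blast

lemma runs_WhileT:
  assumes "c (syms st)" "runs g a st A st'" "runs g (PWhile c a) st' B st''" "Suc (A + B) \<le> C"
  shows "runs g (PWhile c a) st C st''"
proof -
  obtain s t where st: "s \<le> A" "big g a st s st'" "t \<le> B" "big g (PWhile c a) st' t st''"
    using assms by (auto simp: runs_def)
  have "big g (PWhile c a) st (Suc (s + t)) st''"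
    using assms(1) st by (intro big.WhileT)
  then show ?thesis
    using st assms(4) unfolding runs_def by (intro exI[of _ "Suc (s + t)"]) auto
qed

lemma step_halted: "(step M g ^^ n) (1, ts) = (1, ts)"
  by (induction n) (auto simp: funpow_Suc_right simp del: funpow.simps(2))

lemma outputs_within_mono:
  assumes "outputs_within M g x t y" "t \<le> T"
  shows "outputs_within M g x T y"
proof -
  obtain ts where ts: "(step M g ^^ t) (initial M x) = (1, ts)" "tape_word (ts ! 1) = y"
    using assms(1) by (auto simp: outputs_within_def split: prod.splits)
  have "(step M g ^^ (T - t + t)) (initial M x) = (1, ts)"
    by (simp only: funpow_add o_apply ts step_halted)
  then show ?thesis
    using assms(2) ts(2) by (simp add: outputs_within_def)
qed

lemma initial_inp: "n_tapes M = k \<Longrightarrow> 3 \<le> k \<Longrightarrow> initial M x = (0, map (inp x) [0..<k])"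
  unfolding initial_def inp_def by (auto intro!: nth_equalityI simp: nth_Cons')

lemma prog_outputs:
  assumes "writes_below G p" "3 \<le> G" "\<forall>K. PQuery # K \<in> ctrls p [] \<longrightarrow> K = K0"
  shows "\<exists>M. turing_machine M \<and> (query_free p \<longrightarrow> query M = None) \<and>
    (\<forall>g x B st T. runs g p (inp x) B st \<longrightarrow> B \<le> T \<longrightarrow> outputs_within M g x T (tape_word (st 1)))"
proof -
  define k where "k = max 3 (n_used p)"
  obtain M where M: "turing_machine M" "n_tapes M = k" "query_free p \<Longrightarrow> query M = None"
    "\<And>g st t st'. blank_above k st \<Longrightarrow> big g p st t st' \<Longrightarrow>
       (step M g ^^ t) (0, map st [0..<k]) = (1, map st' [0..<k])"
    using prog_to_tm[of G p k K0] assms by (auto simp: k_def)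
  show ?thesis
  proof (intro exI[of _ M] conjI allI impI M(1,3))
    fix g x B st T
    assume "runs g p (inp x) B st" "B \<le> T"
    then obtain t where t: "t \<le> T" "big g p (inp x) t st"
      by (auto simp: runs_def intro: order_trans)
    have "blank_above k (inp x)"
      by (auto simp: blank_above_def inp_def k_def)
    then have "(step M g ^^ t) (initial M x) = (1, map st [0..<k])"
      using M(4) t initial_inp[OF M(2)] by (auto simp: k_def)
    then have "outputs_within M g x t (tape_word (st 1))"
      by (simp add: outputs_within_def k_def)
    then show "outputs_within M g x T (tape_word (st 1))"
      using t(1) by (rule outputs_within_mono)
  qed
qed

section \<open>Simulation of an ordinary machine\<close>

definition valid_config :: "tm \<Rightarrow> config \<Rightarrow> bool" where
  "valid_config M = (\<lambda>(q, ts). q < n_states M \<and> length ts = n_tapes M \<and>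
     (\<forall>t\<in>set ts. \<forall>i. fst t i < n_symbols M))"

lemma valid_scanned:
  "valid_config M (q, ts) \<Longrightarrow>
     length (map (\<lambda>(c, p). c p) ts) = n_tapes M \<and> set (map (\<lambda>(c, p). c p) ts) \<subseteq> {..<n_symbols M}"
  by (auto simp: valid_config_def)

lemma delta_valid:
  assumes "turing_machine M" "q < n_states M" "length ss = n_tapes M" "set ss \<subseteq> {..<n_symbols M}"
  shows "fst (delta M q ss) < n_states M" "length (snd (delta M q ss)) = n_tapes M"
    "j < n_tapes M \<Longrightarrow> fst (snd (delta M q ss) ! j) < n_symbols M"
  using assms unfolding turing_machine_def by (auto simp: image_subset_iff)

lemma valid_step:
  assumes M: "turing_machine M" "query M = None" and v: "valid_config M c"
  shows "valid_config M (step M g c)"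
proof -
  obtain q ts where c: "c = (q, ts)" by fastforce
  define ss where "ss = map (\<lambda>(c, p). c p) ts"
  obtain r as where d: "delta M q ss = (r, as)" by fastforce
  have "q < n_states M" "length ts = n_tapes M" and cells: "\<And>t i. t \<in> set ts \<Longrightarrow> fst t i < n_symbols M"
    using v by (auto simp: c valid_config_def)
  moreover have "length ss = n_tapes M" "set ss \<subseteq> {..<n_symbols M}"
    using valid_scanned[of M q ts] v by (auto simp: c ss_def)
  ultimately have *: "r < n_states M" "length as = n_tapes M" "\<And>j. j < n_tapes M \<Longrightarrow> fst (as ! j) < n_symbols M"
    using delta_valid[OF M(1), of q ss] d by auto
  have act: "fst (act a t) i < n_symbols M" if "fst a < n_symbols M" "t \<in> set ts" for a t i
    using that(1) cells[OF that(2), of i] by (cases a; cases t) auto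
  have "\<forall>t\<in>set (map2 act as ts). \<forall>i. fst t i < n_symbols M"
  proof (intro ballI allI)
    fix t i assume "t \<in> set (map2 act as ts)"
    then obtain j where "j < n_tapes M" "t = act (as ! j) (ts ! j)"
      using * \<open>length ts = n_tapes M\<close> by (auto simp: in_set_conv_nth)
    then show "fst t i < n_symbols M"
      using act[OF *(3)] \<open>length ts = n_tapes M\<close> by simp
  qed
  then show ?thesis
    using v * \<open>length ts = n_tapes M\<close> M(2)
    by (auto simp: c valid_config_def d[unfolded ss_def])
qed

lemma valid_initial: "turing_machine M \<Longrightarrow> valid_config M (initial M x)"
  by (auto simp: valid_config_def initial_def turing_machine_def word_tape_def blank_tape_def)

text \<open>The state of the simulated machine \<open>M\<close> is kept in a cell of an additional tape.\<close>

definition sim :: "tm \<Rightarrow> prog" where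
  "sim M = (let n = n_tapes M in PWhile (\<lambda>s. s (2 + n) \<noteq> 1) (PAct (3 + n) (\<lambda>s i.
     let q = s (2 + n); ss = map (\<lambda>j. s (2 + j)) [0..<n] in
     if 2 \<le> i \<and> q < n_states M \<and> set ss \<subseteq> {..<n_symbols M} then
       if i < 2 + n then snd (delta M q ss) ! (i - 2) else (fst (delta M q ss), Stay)
     else (s i, Stay))))"

text \<open>Simulated tape i lies on tape 2 + i. Its input is thus expected where printed words are
  left, and its output appears on tape 3. As the initial state is 0, blank tapes already lay out the
  remainder of an initial configuration.\<close>

definition lay :: "tapes \<Rightarrow> config \<Rightarrow> tapes" where
  "lay st = (\<lambda>(q, ts) i. if i < 2 then st i else if i < 2 + length ts then ts ! (i - 2)
     else if i = 2 + length ts then ((\<lambda>_. 0)(0 := q), 0) else st i)"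

lemma lay_simps:
  "i < 2 \<Longrightarrow> lay st (q, ts) i = st i"
  "2 \<le> i \<Longrightarrow> i < 2 + length ts \<Longrightarrow> lay st (q, ts) i = ts ! (i - 2)"
  "i = 2 + length ts \<Longrightarrow> lay st (q, ts) i = ((\<lambda>_. 0)(0 := q), 0)"
  "2 + length ts < i \<Longrightarrow> lay st (q, ts) i = st i"
  by (auto simp: lay_def)

text \<open>The simulated state is stored as a symbol, so the alphabet must be at least as large as
  the set of states.\<close>

lemma sim_wf: "turing_machine M \<Longrightarrow> writes_below (max (n_symbols M) (n_states M)) (sim M) \<and> query_free (sim M)"
  using delta_valid[of M] by (auto simp: sim_def Let_def less_max_iff_disj)

lemma runs_sim:
  assumes M: "turing_machine M" "query M = None" and "valid_config M c" "(step M g ^^ T) c = (1, ts')"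
  shows "runs g' (sim M) (lay st c) (2 * T + 1) (lay st (1, ts'))"
  using assms(3,4)
proof (induction T arbitrary: c)
  case 0
  then show ?case
    by (auto simp: sim_def Let_def lay_def syms_def valid_config_def intro!: runs_WhileF)
next
  case (Suc T)
  obtain q ts where c: "c = (q, ts)" by fastforce
  let ?n = "n_tapes M"
  have q: "q < n_states M" "length ts = ?n"
    using Suc.prems by (auto simp: c valid_config_def)
  have sq: "syms (lay st c) (2 + ?n) = q"
    using q by (simp add: syms_def lay_def c)
  show ?case
  proof (cases "q = 1")
    case True
    then have "c = (1, ts')"
      using Suc.prems(2) step_halted[where M = M and g = g and n = "Suc T" and ts = ts] by (simp add: c)
    then show ?thesis
      using True sq by (auto simp: sim_def Let_def intro!: runs_WhileF)
  next
    case False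
    define ss where "ss = map (\<lambda>(c, p). c p) ts"
    obtain r as where d: "delta M q ss = (r, as)" by fastforce
    have ss: "map (\<lambda>j. syms (lay st c) (2 + j)) [0..<?n] = ss"
      using q by (auto simp: syms_def lay_def c ss_def intro!: nth_equalityI split: prod.splits)
    have ssv: "length ss = ?n" "set ss \<subseteq> {..<n_symbols M}"
      using valid_scanned[of M q ts] Suc.prems by (auto simp: c ss_def)
    have as: "length as = ?n"
      using delta_valid(2)[OF M(1) q(1) ssv] d by simp
    have step: "step M g c = (r, map2 act as ts)"
      using False M(2) by (simp add: c d[unfolded ss_def])
    define body where "body = (\<lambda>s i.
        let q = s (2 + ?n); ss = map (\<lambda>j. s (2 + j)) [0..<?n] in
        if 2 \<le> i \<and> q < n_states M \<and> set ss \<subseteq> {..<n_symbols M} then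
          if i < 2 + ?n then snd (delta M q ss) ! (i - 2) else (fst (delta M q ss), Stay)
        else (s i, Stay))"
    have sim: "sim M = PWhile (\<lambda>s. s (2 + ?n) \<noteq> 1) (PAct (3 + ?n) body)"
      by (simp add: sim_def body_def Let_def)
    have one: "runs g' (PAct (3 + ?n) body) (lay st c) 1 (lay st (step M g c))"
    proof (rule runs_Act)
      show "do_act (3 + ?n) body (lay st c) = lay st (step M g c)"
        unfolding do_act_def body_def Let_def sq ss step
      proof (rule ext)
        fix i
        show "(if i < 3 + ?n then act (if 2 \<le> i \<and> q < n_states M \<and> set ss \<subseteq> {..<n_symbols M} then
            if i < 2 + ?n then snd (delta M q ss) ! (i - 2) else (fst (delta M q ss), Stay)
          else (syms (lay st c) i, Stay)) (lay st c i) else lay st c i) = lay st (r, map2 act as ts) i"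
        proof -
          consider "i < 2" | "2 \<le> i" "i < 2 + ?n" | "i = 2 + ?n" | "2 + ?n < i"
            by linarith
          then show ?thesis
          proof cases
            case 1
            then show ?thesis
              by (simp only: act_Stay if_cancel not_le[symmetric] simp_thms if_False) (simp add: c lay_simps)
          next
            case 2
            then show ?thesis
              using q ssv as by (simp add: c d lay_simps)
          next
            case 3
            then show ?thesis
              using q ssv as by (simp add: c d lay_simps)
          next
            case 4
            then show ?thesis
              using q ssv as by (simp add: c d lay_simps)
          qed
        qed
      qed
    qed simp
    have rest: "runs g' (sim M) (lay st (step M g c)) (2 * T + 1) (lay st (1, ts'))"
      using Suc.prems valid_step[OF M] by (intro Suc.IH) (auto simp: funpow_Suc_right simp del: funpow.simps(2))
    show ?thesis
      unfolding sim by (rule runs_WhileT[OF _ one rest[unfolded sim]]) (use False sq in simp_all)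
  qed
qed

text \<open>Tape 0 is left unspecified, as a preparing program need not return its input head. The
  bound on the length of \<open>r x\<close> serves to bound the run of a machine that is started on
  \<open>r x\<close>.\<close>

definition prepares :: "prog \<Rightarrow> (word \<Rightarrow> word) \<Rightarrow> nat poly \<Rightarrow> bool" where
  "prepares p r q \<longleftrightarrow> (\<forall>G\<ge>3. writes_below G p) \<and> query_free p \<and> (\<forall>x. length (r x) \<le> poly q (length x)) \<and>
     (\<forall>g x. \<exists>st. runs g p (inp x) (poly q (length x)) st \<and>
        (\<forall>i>0. st i = (if i = 2 then word_tape (r x) else blank_tape)))"

text \<open>The time is measured in the original input \<open>x\<close>, not in the word on tape
  \<open>k\<close>; so \<open>Y\<close> has to limit how much of that word must be read.\<close>

definition concludes :: "nat \<Rightarrow> prog \<Rightarrow> (word \<Rightarrow> word \<Rightarrow> bool) \<Rightarrow> (word \<Rightarrow> word) \<Rightarrow> nat poly \<Rightarrow> bool" where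
  "concludes k p Y h q \<longleftrightarrow> (\<forall>G\<ge>3. writes_below G p) \<and> query_free p \<and>
     (\<forall>g x st. Y x (tape_word (st k)) \<longrightarrow> st 1 = blank_tape \<longrightarrow>
        (\<exists>st'. runs g p st (poly q (length x)) st' \<and> tape_word (st' 1) = h x))"

lemma prepares_stm: "\<exists>p q. prepares p (\<lambda>x. sem x (\<lambda>_. 0) s) q"
proof -
  obtain p q where p: "\<And>G. 3 \<le> G \<Longrightarrow> writes_below G p" "query_free p"
    "\<And>g x. runs g p (inp x) (poly q (length x)) ((inp x)(2 := word_tape (sem x (\<lambda>_. 0) s)))"
    using stm_to_prog by metis
  obtain b where b: "\<And>x \<rho> N. (\<forall>i. \<rho> i \<le> N) \<Longrightarrow> length x \<le> N \<Longrightarrow> length (sem x \<rho> s) \<le> poly b N"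
    using sem_bound by metis
  have "prepares p (\<lambda>x. sem x (\<lambda>_. 0) s) (q + b)"
    unfolding prepares_def
  proof (intro conjI allI impI)
    show "length (sem x (\<lambda>_. 0) s) \<le> poly (q + b) (length x)" for x
      using b[of "\<lambda>_. 0" "length x" x] by simp
    show "\<exists>st. runs g p (inp x) (poly (q + b) (length x)) st \<and>
        (\<forall>i>0. st i = (if i = 2 then word_tape (sem x (\<lambda>_. 0) s) else blank_tape))" for g x
      by (intro exI[of _ "(inp x)(2 := word_tape (sem x (\<lambda>_. 0) s))"] conjI runs_mono[OF p(3)])
        (simp_all add: inp_def)
  qed (use p in simp_all)
  then show ?thesis
    by blast
qed

lemma tape_word_word_tape [simp]: "tape_word (word_tape w) = w"
proof -
  have "(LEAST j. fst (word_tape w) (int j) \<notin> {1, 2}) = length w"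
    by (rule Least_equality) (auto simp: word_tape_def split: if_splits)
  then show ?thesis
    by (auto simp: word_tape_def cong: if_cong intro!: nth_equalityI)
qed

text \<open>Prepare, ask once, conclude. The oracle is constrained only at the one word that is
  asked, and a single query fits the single query state.\<close>

theorem oracle_machine:
  assumes pre: "prepares pre r q" and post: "concludes 2 post Y h q'"
  shows "\<exists>M (p :: nat poly). turing_machine M \<and>
    (\<forall>g. (\<forall>x. Y x (g (r x))) \<longrightarrow> (\<forall>x. outputs_within M g x (poly p (length x)) (h x)))"
proof -
  note q = pre[unfolded prepares_def, THEN conjunct2, THEN conjunct2, THEN conjunct2, rule_format]
  note q' = post[unfolded concludes_def, THEN conjunct2, THEN conjunct2, rule_format]
  let ?p = "PSeq pre (PSeq PQuery post)"
  have wb: "writes_below 3 ?p"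
    using pre post by (simp add: prepares_def concludes_def)
  have uq: "\<forall>K. PQuery # K \<in> ctrls ?p [] \<longrightarrow> K = [post]"
    using pre post by (simp add: prepares_def concludes_def query_free_ctrls)
  from prog_outputs[OF wb order_refl uq] obtain M where M: "turing_machine M" "query_free ?p \<longrightarrow> query M = None"
    "\<forall>g x B st T. runs g ?p (inp x) B st \<longrightarrow> B \<le> T \<longrightarrow> outputs_within M g x T (tape_word (st 1))"
    by (elim exE conjE) (rule that; assumption)
  have "outputs_within M g x (poly (q + 1 + q' + 2) (length x)) (h x)" if g: "\<forall>x. Y x (g (r x))" for g x
  proof -
    obtain st where st: "runs g pre (inp x) (poly q (length x)) st" "st 2 = word_tape (r x)" "st 1 = blank_tape"
      using q[of g x] by auto
    have "runs g PQuery st 1 (ask g st)"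
      using big.Query unfolding runs_def by blast
    moreover obtain st' where st': "runs g post (ask g st) (poly q' (length x)) st'" "tape_word (st' 1) = h x"
      using q'[of x "ask g st" g] g st by (auto simp: ask_def)
    ultimately have "runs g ?p (inp x) (poly (q + 1 + q' + 2) (length x)) st'"
      by (intro runs_Seq[OF st(1) runs_Seq[OF _ st'(1) order_refl]]) auto
    from M(3)[rule_format, OF this order_refl] st'(2) show ?thesis by simp
  qed
  then show ?thesis
    using M(1) by (intro exI[of _ M] exI[of _ "q + 1 + q' + 2"]) simp
qed

text \<open>The same pipeline with a simulated machine for \<open>f\<close> in place of the oracle.
  Its time is polynomial in \<open>x\<close> because the length of \<open>r x\<close> is.\<close>

theorem composed_machine:
  assumes pre: "prepares pre r q" and f: "poly_time_computable f" and post: "concludes 3 post Y h q'"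
    and Y: "\<And>x. Y x (f (r x))"
  shows "poly_time_computable h"
proof -
  note len = pre[unfolded prepares_def, THEN conjunct2, THEN conjunct2, THEN conjunct1, rule_format]
  note q = pre[unfolded prepares_def, THEN conjunct2, THEN conjunct2, THEN conjunct2, rule_format]
  note q' = post[unfolded concludes_def, THEN conjunct2, THEN conjunct2, rule_format]
  obtain N t where N: "turing_machine N" "query N = None"
    "\<And>x. outputs_within N (\<lambda>_. []) x (poly t (length x)) (f x)"
    using f by (auto simp: poly_time_computable_def)
  let ?p = "PSeq pre (PSeq (sim N) post)"
  let ?G = "max (n_symbols N) (n_states N)"
  have G: "3 \<le> ?G" and n: "3 \<le> n_tapes N"
    using N(1) by (auto simp: turing_machine_def)
  have wb: "writes_below ?G ?p" and qf: "query_free ?p"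
    using pre post G sim_wf[OF N(1)] by (simp_all add: prepares_def concludes_def)
  have uq: "\<forall>K. PQuery # K \<in> ctrls ?p [] \<longrightarrow> K = []"
    using query_free_ctrls[OF qf] by simp
  from prog_outputs[OF wb G uq] obtain M where M: "turing_machine M" "query_free ?p \<longrightarrow> query M = None"
    "\<forall>g x B st T. runs g ?p (inp x) B st \<longrightarrow> B \<le> T \<longrightarrow> outputs_within M g x T (tape_word (st 1))"
    by (elim exE conjE) (rule that; assumption)
  let ?q = "q + (smult 2 (t \<circ>\<^sub>p q) + 1) + q' + 2"
  have "outputs_within M (\<lambda>_. []) x (poly ?q (length x)) (h x)" for x
  proof -
    let ?g = "\<lambda>_ :: word. [] :: word"
    obtain st where st: "runs ?g pre (inp x) (poly q (length x)) st"
      "\<And>i. i > 0 \<Longrightarrow> st i = (if i = 2 then word_tape (r x) else blank_tape)"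
      using q[of ?g x] by blast
    obtain ts where ts: "(step N ?g ^^ poly t (length (r x))) (initial N (r x)) = (1, ts)" "tape_word (ts ! 1) = f (r x)"
      using N(3)[of "r x"] by (auto simp: outputs_within_def split: prod.splits)
    have "st = lay st (initial N (r x))"
      using st(2) n by (auto simp: lay_def initial_def fun_eq_iff nth_Cons' blank_tape_def)
    moreover have "valid_config N (initial N (r x))"
      by (rule valid_initial[OF N(1)])
    ultimately have s: "runs ?g (sim N) st (2 * poly t (length (r x)) + 1) (lay st (1, ts))"
      using runs_sim[OF N(1,2) _ ts(1), where g' = ?g and st = st] by simp
    have "valid_config N ((step N ?g ^^ i) (initial N (r x)))" for i
      by (induction i) (simp_all add: valid_initial[OF N(1)] valid_step[OF N(1,2)])
    from this[of "poly t (length (r x))"] have "length ts = n_tapes N"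
      unfolding ts by (simp add: valid_config_def)
    then have "tape_word (lay st (1, ts) 3) = f (r x)" "lay st (1, ts) 1 = blank_tape"
      using n ts(2) st(2) by (auto simp: lay_def)
    then obtain st' where st': "runs ?g post (lay st (1, ts)) (poly q' (length x)) st'" "tape_word (st' 1) = h x"
      using q'[of x "lay st (1, ts)" ?g] Y by auto
    have "poly t (length (r x)) \<le> poly (t \<circ>\<^sub>p q) (length x)"
      by (simp add: poly_pcompose poly_nat_mono len)
    then have "runs ?g ?p (inp x) (poly ?q (length x)) st'"
      by (intro runs_Seq[OF st(1) runs_Seq[OF s st'(1) order_refl]]) auto
    from M(3)[rule_format, OF this order_refl] st'(2) show ?thesis by simp
  qed
  then show ?thesis
    using M(1) M(2)[rule_format, OF qf] unfolding poly_time_computable_def by blast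
qed

section \<open>P is contained in NP\<close>

text \<open>Totality spares the machine of \<open>P_subset_NP\<close> a branch for malformed words.\<close>

fun decode :: "word \<Rightarrow> word" where
  "decode (True # b # y) = b # decode y"
| "decode _ = []"

lemma decode_self_delimiting [simp]: "decode (self_delimiting x @ w) = x"
  by (induction x) (auto simp: self_delimiting_def)

lemma length_decode: "length (decode y) \<le> length y"
  by (induction y rule: decode.induct) auto

definition decoder :: prog where
  "decoder = PSeq (PWhile (\<lambda>s. s 0 = 2) (PSeq (op 0 (\<lambda>a. (a, Move_right))) (PAct 3 (\<lambda>s i.
     if i = 0 then (s 0, Move_right) else if i = 2 \<and> s 0 \<noteq> 0 then (s 0, Move_right) else (s i, Stay))))) rewind"

lemma prepares_decode: "prepares decoder decode [:7, 6:]"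
proof -
  define S :: "word \<Rightarrow> nat \<Rightarrow> word \<Rightarrow> tapes" where "S x h w = (\<lambda>i. if i = 0 then (fst (word_tape x), int h)
    else if i = 2 then (fst (word_tape w), int (length w)) else blank_tape)" for x h w
  let ?copy = "PAct 3 (\<lambda>s i. if i = 0 then (s 0, Move_right) else if i = 2 \<and> s 0 \<noteq> 0 then (s 0, Move_right) else (s i, Stay))"
  let ?loop = "PWhile (\<lambda>s. s 0 = 2) (PSeq (op 0 (\<lambda>a. (a, Move_right))) ?copy)"
  have sym: "syms (S x h w) 0 = (if h < length x then if x ! h then 2 else 1 else 0)" for x h w
    by (simp add: S_def syms_def word_tape_def)
  have right: "runs g (op 0 (\<lambda>a. (a, Move_right))) (S x h w) 1 (S x (Suc h) w)" for g x h w
    by (rule runs_op) (auto simp: S_def fun_eq_iff syms_def)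
  have loop: "\<exists>h'. runs g ?loop (S (u @ y) (length u) w) (4 * length y + 1) (S (u @ y) h' (w @ decode y))" for g u y w
  proof (induction y arbitrary: u w rule: decode.induct)
    case (1 b y)
    have "runs g ?copy (S (u @ True # b # y) (Suc (length u)) w) 1 (S (u @ True # b # y) (Suc (Suc (length u))) (w @ [b]))"
      by (rule runs_Act) (auto simp: S_def do_act_def fun_eq_iff syms_def word_tape_def nth_append blank_tape_def)
    then have body: "runs g (PSeq (op 0 (\<lambda>a. (a, Move_right))) ?copy) (S (u @ True # b # y) (length u) w) 3
        (S (u @ True # b # y) (Suc (Suc (length u))) (w @ [b]))"
      by (rule runs_Seq[OF right]) simp
    obtain h' where "runs g ?loop (S ((u @ [True, b]) @ y) (length (u @ [True, b])) (w @ [b])) (4 * length y + 1)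
        (S ((u @ [True, b]) @ y) h' ((w @ [b]) @ decode y))"
      using 1 by blast
    then have "runs g ?loop (S (u @ True # b # y) (Suc (Suc (length u))) (w @ [b])) (4 * length y + 1)
        (S (u @ True # b # y) h' (w @ decode (True # b # y)))"
      by simp
    from runs_WhileT[OF _ body this, where C = "4 * length (True # b # y) + 1"]
    have "runs g ?loop (S (u @ True # b # y) (length u) w) (4 * length (True # b # y) + 1)
        (S (u @ True # b # y) h' (w @ decode (True # b # y)))"
      by (simp add: sym)
    then show ?case
      by blast
  next
    case "2_1"
    have "runs g ?loop (S (u @ []) (length u) w) 1 (S (u @ []) (length u) w)"
      by (rule runs_WhileF) (simp_all add: sym)
    then show ?case
      by (intro exI[of _ "length u"]) simp
  next
    case ("2_2" y)
    have "runs g ?loop (S (u @ False # y) (length u) w) (4 * length (False # y) + 1) (S (u @ False # y) (length u) w)"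
      by (rule runs_WhileF) (simp_all add: sym)
    then show ?case
      by (intro exI[of _ "length u"]) simp
  next
    case ("2_3" v)
    show ?case
    proof (cases v)
      case False
      have "runs g ?loop (S (u @ [v]) (length u) w) 5 (S (u @ [v]) (length u) w)"
        by (rule runs_WhileF) (simp_all add: sym False)
      then show ?thesis
        by (intro exI[of _ "length u"]) simp
    next
      case True
      \<comment> \<open>The pair is cut off by the end of the word: the copying action scans a blank
        and appends nothing.\<close>
      let ?x = "u @ [True]"
      have "runs g ?copy (S ?x (Suc (length u)) w) 1 (S ?x (Suc (Suc (length u))) w)"
        by (rule runs_Act) (auto simp: S_def do_act_def fun_eq_iff syms_def word_tape_def nth_append blank_tape_def)
      then have body: "runs g (PSeq (op 0 (\<lambda>a. (a, Move_right))) ?copy) (S ?x (length u) w) 3 (S ?x (Suc (Suc (length u))) w)"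
        by (rule runs_Seq[OF right]) simp
      have "runs g ?loop (S ?x (Suc (Suc (length u))) w) 1 (S ?x (Suc (Suc (length u))) w)"
        by (rule runs_WhileF) (simp_all add: sym)
      from runs_WhileT[OF _ body this, where C = 5]
      have "runs g ?loop (S ?x (length u) w) 5 (S ?x (Suc (Suc (length u))) w)"
        by (simp add: sym)
      then show ?thesis
        using True by (intro exI[of _ "Suc (Suc (length u))"]) simp
    qed
  qed
  have run: "\<exists>st. runs g decoder (inp x) (poly [:7, 6:] (length x)) st \<and>
      (\<forall>i>0. st i = (if i = 2 then word_tape (decode x) else blank_tape))" for g x
  proof -
    obtain h where h: "runs g ?loop (S x 0 []) (4 * length x + 1) (S x h (decode x))"
      using loop[of g "[]" x "[]"] by auto
    have start: "S x 0 [] = inp x"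
      by (auto simp: S_def inp_def fun_eq_iff word_tape_def blank_tape_def)
    have "runs g rewind (S x h (decode x)) (2 * length (decode x) + 5) ((S x h (decode x))(2 := word_tape (decode x)))"
      by (rule runs_rewind) (auto simp: S_def)
    then have "runs g decoder (inp x) (poly [:7, 6:] (length x)) ((S x h (decode x))(2 := word_tape (decode x)))"
      unfolding decoder_def using length_decode[of x]
      by (intro runs_Seq[OF h[unfolded start]]) auto
    then show ?thesis
      by (intro exI conjI) (assumption, simp add: S_def)
  qed
  have "length (decode x) \<le> poly [:7, 6:] (length x)" for x
    using length_decode[of x] by simp
  then show ?thesis
    unfolding prepares_def by (intro conjI allI run) (auto simp: decoder_def rewind_def)
qed

lemma tape_word_blank_act: "tape_word (act (if b then 2 else 1, Stay) blank_tape) = [b]"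
proof -
  have "act (if b then 2 else 1, Stay) blank_tape = word_tape [b]"
    by (auto simp: blank_tape_def word_tape_def fun_eq_iff)
  then show ?thesis
    by simp
qed

lemma tape_word_nth:
  assumes "tape_word t = y" "j < length y"
  shows "fst t (snd t + int j) = (if y ! j then 2 else 1)"
proof -
  obtain c p where t: "t = (c, p)" by fastforce
  have *: "j < (LEAST j. c (p + int j) \<notin> {1, 2})"
    using assms by (auto simp: t)
  from not_less_Least[OF this] have "c (p + int j) \<in> {1, 2}"
    by simp
  with * show ?thesis
    using assms by (auto simp: t)
qed

definition copy_bit :: prog where
  "copy_bit = PIf (\<lambda>s. s 3 = 2) (op 1 (\<lambda>_. (2, Stay))) (op 1 (\<lambda>_. (1, Stay)))"

lemma concludes_copy_bit: "concludes 3 copy_bit (\<lambda>x y. y = [P x]) (\<lambda>x. [P x]) 2"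
proof -
  have "\<exists>st'. runs g copy_bit st (poly 2 (length x)) st' \<and> tape_word (st' 1) = [P x]"
    if "tape_word (st 3) = [P x]" "st 1 = blank_tape" for g x st
  proof -
    have "syms st 3 = (if P x then 2 else 1)"
      using tape_word_nth[OF that(1), of 0] by (simp add: syms_def)
    then have "runs g copy_bit st 2 (st(1 := act (if P x then 2 else 1, Stay) (st 1)))"
      unfolding copy_bit_def by (intro runs_If[where A = 1 and B = 1] runs_op) auto
    then show ?thesis
      using that(2) tape_word_blank_act[of "P x"] by (intro exI[of _ "st(1 := act (if P x then 2 else 1, Stay) (st 1))"]) simp
  qed
  then show ?thesis
    unfolding concludes_def by (intro conjI allI impI) (simp_all add: copy_bit_def)
qed

theorem P_subset_NP: "class_P \<subseteq> class_NP"
proof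
  fix L assume "L \<in> class_P"
  then have "poly_time_computable (\<lambda>x. [x \<in> L])"
    by (simp add: class_P_def)
  then have "poly_time_computable (\<lambda>y. [decode y \<in> L])"
    by (rule composed_machine[OF prepares_decode _ concludes_copy_bit[of "\<lambda>y. decode y \<in> L"]]) simp
  then have C: "{y. decode y \<in> L} \<in> class_P"
    by (simp add: class_P_def)
  show "L \<in> class_NP"
    unfolding class_NP_def
  proof (intro CollectI bexI[OF _ C] exI[of _ "0 :: nat poly"] allI)
    show "x \<in> L \<longleftrightarrow> (\<exists>w. length w \<le> poly 0 (length x) \<and> self_delimiting x @ w \<in> {y. decode y \<in> L})" for x
      by (auto intro: exI[of _ "[]"])
  qed
qed

section \<open>Encodings\<close>

lemma self_delimiting_simps [simp]:
  "self_delimiting [] = [False]" "self_delimiting (b # x) = True # b # self_delimiting x"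
  by (simp_all add: self_delimiting_def)

text \<open>Encodings are concatenated without separators, so plain injectivity would not carry over
  to whole instances; cancelling a common prefix does.\<close>

lemma self_delimiting_prefix:
  "self_delimiting x @ s = self_delimiting y @ s' \<Longrightarrow> x = y \<and> s = s'"
proof (induction x arbitrary: y)
  case Nil
  then show ?case by (cases y) auto
next
  case (Cons b x)
  then show ?case by (cases y) auto
qed

lemma binary_eq_Nil [simp]: "binary m = [] \<longleftrightarrow> m = 0"
  by (subst binary.simps) simp

lemma binary_inject: "binary m = binary n \<Longrightarrow> m = n"
proof (induction m arbitrary: n rule: binary.induct)
  case (1 m)
  show ?case
  proof (cases "m = 0 \<or> n = 0")
    case True
    then show ?thesis
      using "1.prems" binary_eq_Nil[of m] binary_eq_Nil[of n] by auto
  next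
    case False
    then have *: "odd m = odd n" "binary (m div 2) = binary (n div 2)"
      using "1.prems" binary.simps[of m] binary.simps[of n] by auto
    then have "m div 2 = n div 2"
      using "1.IH" False by auto
    with *(1) show ?thesis
      by (metis odd_two_times_div_two_succ even_two_times_div_two)
  qed
qed

lemma enc_nat_prefix: "enc_nat a @ s = enc_nat b @ s' \<Longrightarrow> a = b \<and> s = s'"
  unfolding enc_nat_def using self_delimiting_prefix binary_inject by blast

text \<open>The conversion \<open>nat\<close> sends every negative numerator to 0; hence the sign
  hypotheses.\<close>

lemma enc_rat_prefix:
  assumes "0 \<le> p" "0 \<le> q" "enc_rat p @ s = enc_rat q @ s'"
  shows "p = q \<and> s = s'"
proof -
  obtain a b where ab: "quotient_of p = (a, b)" by fastforce
  obtain c d where cd: "quotient_of q = (c, d)" by fastforce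
  have "enc_nat (nat a) @ enc_nat (nat b) @ s = enc_nat (nat c) @ enc_nat (nat d) @ s'"
    using assms(3) by (simp add: enc_rat_def ab cd)
  then have *: "nat a = nat c" "nat b = nat d" "s = s'"
    using enc_nat_prefix by blast+
  have "0 < b" "0 < d"
    using quotient_of_denom_pos ab cd by blast+
  moreover have "p = of_int a / of_int b" "q = of_int c / of_int d"
    using ab cd quotient_of_div by blast+
  ultimately have "0 \<le> a" "0 \<le> c"
    using assms(1,2) by (auto simp: zero_le_divide_iff)
  then have "quotient_of p = quotient_of q"
    using * \<open>0 < b\<close> \<open>0 < d\<close> by (simp add: ab cd eq_nat_nat_iff)
  then show ?thesis
    using *(3) by (simp add: quotient_of_inject)
qed

lemma enc_list_prefix:
  assumes "\<And>x y s s'. x \<in> set xs \<Longrightarrow> y \<in> set ys \<Longrightarrow> e x @ s = e y @ s' \<Longrightarrow> x = y \<and> s = s'"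
    and "enc_list e xs @ s = enc_list e ys @ s'"
  shows "xs = ys \<and> s = s'"
  using assms
proof (induction xs arbitrary: ys)
  case Nil
  then show ?case by (cases ys) (auto simp: enc_list_def)
next
  case (Cons x xs)
  show ?case
  proof (cases ys)
    case Nil
    then show ?thesis using Cons.prems(2) by (simp add: enc_list_def)
  next
    case ys: (Cons y zs)
    have "e x @ (enc_list e xs @ s) = e y @ (enc_list e zs @ s')"
      using Cons.prems(2) by (simp add: ys enc_list_def)
    then have "x = y" "enc_list e xs @ s = enc_list e zs @ s'"
      using Cons.prems(1)[of x y] by (auto simp: ys)
    moreover have "xs = zs \<and> s = s'"
      by (rule Cons.IH[OF Cons.prems(1) calculation(2)]) (simp_all add: ys)
    ultimately show ?thesis
      by (simp add: ys)
  qed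
qed

text \<open>An answer refers to some valid instance with the given code; injectivity identifies it
  with the instance that was printed.\<close>

lemma enc_instance_inject:
  assumes v: "valid_instance I" "valid_instance J" and eq: "enc_instance I = enc_instance J"
  shows "I = J"
proof -
  have nonneg: "\<And>r q. r \<in> set (scores H) \<Longrightarrow> q \<in> set r \<Longrightarrow> 0 \<le> q"
    "\<And>q. q \<in> set (rank_probs H) \<Longrightarrow> 0 \<le> q" "0 \<le> threshold H" if "valid_instance H" for H
    using that by (fastforce simp: valid_instance_def)+
  have 1: "harmful I = harmful J \<and> enc_list (enc_list enc_rat) (scores I) @
       enc_list enc_rat (rank_probs I) @ enc_nat (budget I) @ enc_rat (threshold I) =
     enc_list (enc_list enc_rat) (scores J) @
       enc_list enc_rat (rank_probs J) @ enc_nat (budget J) @ enc_rat (threshold J)"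
    by (rule enc_list_prefix[where e = "\<lambda>b. [b]"]) (use eq in \<open>simp_all add: enc_instance_def\<close>)
  have 2: "scores I = scores J \<and> enc_list enc_rat (rank_probs I) @ enc_nat (budget I) @ enc_rat (threshold I) =
     enc_list enc_rat (rank_probs J) @ enc_nat (budget J) @ enc_rat (threshold J)"
  proof (rule enc_list_prefix[OF _ 1[THEN conjunct2]])
    fix x y s s' assume "x \<in> set (scores I)" "y \<in> set (scores J)" "enc_list enc_rat x @ s = enc_list enc_rat y @ s'"
    then show "x = y \<and> s = s'"
      using nonneg(1)[OF v(1)] nonneg(1)[OF v(2)] by (intro enc_list_prefix[of x y enc_rat] enc_rat_prefix) auto
  qed
  have 3: "rank_probs I = rank_probs J \<and> enc_nat (budget I) @ enc_rat (threshold I) = enc_nat (budget J) @ enc_rat (threshold J)"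
    by (rule enc_list_prefix[OF _ 2[THEN conjunct2]]) (use nonneg(2) v in \<open>intro enc_rat_prefix, auto\<close>)
  have 4: "budget I = budget J \<and> enc_rat (threshold I) = enc_rat (threshold J)"
    by (rule enc_nat_prefix[OF 3[THEN conjunct2]])
  then have "threshold I = threshold J"
    using enc_rat_prefix[of "threshold I" "threshold J" "[]" "[]"] nonneg(3) v by simp
  with 1 2 3 4 show ?thesis
    by simp
qed

lemma length_binary: "length (binary m) \<le> m"
proof (induction m rule: binary.induct)
  case (1 m)
  show ?case
  proof (cases "m = 0")
    case False
    then have "length (binary m) \<le> Suc (m div 2)"
      using 1 by (subst binary.simps) simp
    also have "\<dots> \<le> m"
      using False by simp
    finally show ?thesis .
  qed simp
qed

lemma length_self_delimiting: "length (self_delimiting x) = 2 * length x + 1"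
  by (induction x) auto

text \<open>Estimating the number of digits of an item by the number of items is good enough, as
  there are polynomially many items.\<close>

lemma length_enc_operations:
  assumes "\<And>u v w. (u, v, w) \<in> set xs \<Longrightarrow> u < n \<and> v < n \<and> w < n"
  shows "length (enc_operations xs) \<le> length xs * (6 * n + 4) + 1"
  using assms
proof (induction xs)
  case Nil
  show ?case by (simp add: enc_operations_def enc_list_def)
next
  case (Cons op xs)
  obtain u v w where op: "op = (u, v, w)" by (cases op)
  have enc: "length (enc_nat m) \<le> 2 * n + 1" if "m < n" for m
    using length_binary[of m] that by (simp add: enc_nat_def length_self_delimiting)
  have "u < n \<and> v < n \<and> w < n"
    by (rule Cons.prems) (simp add: op)
  then have "length (enc_nat u @ enc_nat v @ enc_nat w) \<le> 6 * n + 3"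
    using enc[of u] enc[of v] enc[of w] by simp
  moreover have "length (enc_operations xs) \<le> length xs * (6 * n + 4) + 1"
    by (rule Cons.IH, rule Cons.prems) simp
  ultimately show ?case
    by (simp add: enc_operations_def enc_list_def op)
qed

section \<open>Reading the answer\<close>

definition reads :: "tapes \<Rightarrow> nat \<Rightarrow> word \<Rightarrow> bool" where
  "reads st k y \<longleftrightarrow> (\<forall>i<length y. fst (st k) (snd (st k) + int i) = (if y ! i then 2 else 1))"

definition adv :: "tapes \<Rightarrow> nat \<Rightarrow> nat \<Rightarrow> tapes" where
  "adv st k n = st(k := (fst (st k), snd (st k) + int n))"

definition forward :: "nat \<Rightarrow> prog" where
  "forward k = op k (\<lambda>a. (a, Move_right))"

lemma adv_simps [simp]: "adv (adv st k m) k n = adv st k (m + n)" "adv st k 0 = st"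
  by (auto simp: adv_def)

lemma reads_append: "reads st k (a @ y) \<Longrightarrow> reads (adv st k (length a)) k y"
  unfolding reads_def adv_def
proof (intro allI impI)
  fix i assume r: "\<forall>i<length (a @ y). fst (st k) (snd (st k) + int i) = (if (a @ y) ! i then 2 else 1)" and "i < length y"
  then show "fst ((st(k := (fst (st k), snd (st k) + int (length a)))) k)
      (snd ((st(k := (fst (st k), snd (st k) + int (length a)))) k) + int i) = (if y ! i then 2 else 1)"
    using r[rule_format, of "length a + i"] by (simp add: add.assoc)
qed

lemma reads_Cons: "reads st k (b # y) \<Longrightarrow> syms st k = (if b then 2 else 1)"
  unfolding reads_def syms_def by (drule spec[of _ 0]) simp

lemma reads_tl: "reads st k (b # y) \<Longrightarrow> reads (adv st k 1) k y"
  using reads_append[of st k "[b]" y] by simp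

lemma runs_forward: "1 \<le> B \<Longrightarrow> runs g (forward k) st B (adv st k 1)"
  unfolding forward_def by (rule runs_op) (simp_all add: adv_def)

definition skip_nat :: "nat \<Rightarrow> prog" where
  "skip_nat k = PSeq (PWhile (\<lambda>s. s k = 2) (PSeq (forward k) (forward k))) (forward k)"

lemma runs_skip_nat:
  assumes "reads st k (enc_nat m @ y)" "3 * length (enc_nat m) \<le> B"
  shows "runs g (skip_nat k) st B (adv st k (length (enc_nat m)))"
proof -
  have loop: "runs g (PWhile (\<lambda>s. s k = 2) (PSeq (forward k) (forward k))) st (4 * length w + 1) (adv st k (2 * length w))"
    if "reads st k (self_delimiting w @ y)" for w st
    using that
  proof (induction w arbitrary: st)
    case Nil
    then show ?case
      using reads_Cons[of st k False y] by (simp add: runs_WhileF)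
  next
    case (Cons b w)
    have r: "reads st k (True # b # self_delimiting w @ y)"
      using Cons.prems by simp
    have two: "runs g (PSeq (forward k) (forward k)) st 3 (adv st k 2)"
      using runs_Seq[OF runs_forward[OF order_refl, of g k st] runs_forward[OF order_refl, of g k "adv st k 1"] order_refl]
      by (simp add: numeral_3_eq_3 numeral_2_eq_2)
    have "reads (adv st k 2) k (self_delimiting w @ y)"
      using reads_append[of st k "[True, b]" "self_delimiting w @ y"] r by (simp add: numeral_2_eq_2)
    note rest = Cons.IH[OF this]
    have "runs g (PWhile (\<lambda>s. s k = 2) (PSeq (forward k) (forward k))) st (4 * length (b # w) + 1)
        (adv (adv st k 2) k (2 * length w))"
      by (rule runs_WhileT[OF _ two rest]) (use reads_Cons[OF r] in simp_all)
    then show ?case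
      by simp
  qed
  have "runs g (PWhile (\<lambda>s. s k = 2) (PSeq (forward k) (forward k))) st (4 * length (binary m) + 1)
      (adv st k (2 * length (binary m)))"
    by (rule loop) (use assms(1) in \<open>simp add: enc_nat_def\<close>)
  from runs_Seq[OF this runs_forward[OF order_refl, of g k] order_refl]
  have "runs g (skip_nat k) st (4 * length (binary m) + 3) (adv st k (length (enc_nat m)))"
    by (simp add: skip_nat_def enc_nat_def length_self_delimiting numeral_3_eq_3)
  then show ?thesis
    by (rule runs_mono) (use assms(2) in \<open>simp add: enc_nat_def length_self_delimiting\<close>)
qed

text \<open>Tape 1 initially carries the bit True; an operation on item 0 overwrites it with False,
  for good.\<close>

definition mark :: "bool \<Rightarrow> tapes \<Rightarrow> tapes" where
  "mark b st = (if b then st(1 := act (1, Stay) (st 1)) else st)"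

lemma mark_other: "k \<noteq> 1 \<Longrightarrow> mark b st k = st k"
  by (simp add: mark_def)

lemma reads_mark: "k \<noteq> 1 \<Longrightarrow> reads (mark b st) k y \<longleftrightarrow> reads st k y"
  by (simp add: reads_def mark_other)

lemma adv_mark: "k \<noteq> 1 \<Longrightarrow> adv (mark b st) k n = mark b (adv st k n)"
  by (auto simp: adv_def mark_def fun_eq_iff)

lemma mark_mark: "mark a (mark b st) = mark (a \<or> b) st"
  by (cases "st 1") (auto simp: mark_def)

text \<open>Zero is the only number whose encoding starts with False, so one scanned bit tells
  whether the operation is on the hub. The three numbers are then skipped without being
  decoded.\<close>

definition read_operation :: "nat \<Rightarrow> prog" where
  "read_operation k = PSeq (forward k) (PSeq (PIf (\<lambda>s. s k \<noteq> 2) (op 1 (\<lambda>_. (1, Stay))) skip)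
     (PSeq (skip_nat k) (PSeq (skip_nat k) (skip_nat k))))"

lemma enc_nat_0: "enc_nat 0 = [False]"
  by (simp add: enc_nat_def binary.simps)

lemma enc_nat_pos: "m \<noteq> 0 \<Longrightarrow> \<exists>b w. enc_nat m = True # b # w"
  by (subst enc_nat_def, subst binary.simps) simp

lemma runs_read_operation:
  assumes r: "reads st k (True # enc_nat u @ enc_nat v @ enc_nat w @ y)" and k: "k \<noteq> 1"
    and B: "4 * length (True # enc_nat u @ enc_nat v @ enc_nat w) + 4 \<le> B"
  shows "runs g (read_operation k) st B
    (mark (u = 0) (adv st k (length (True # enc_nat u @ enc_nat v @ enc_nat w))))"
proof -
  let ?st = "mark (u = 0) (adv st k 1)"
  have r1: "reads (adv st k 1) k (enc_nat u @ enc_nat v @ enc_nat w @ y)"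
    by (rule reads_tl[OF r])
  have "syms (adv st k 1) k = 2 \<longleftrightarrow> u \<noteq> 0"
  proof (cases "u = 0")
    case True
    then show ?thesis using reads_Cons[of "adv st k 1" k False] r1 by (simp add: enc_nat_0)
  next
    case False
    then obtain b z where "enc_nat u = True # b # z"
      using enc_nat_pos by blast
    then show ?thesis using reads_Cons[of "adv st k 1" k True] r1 False by simp
  qed
  then have test: "runs g (PIf (\<lambda>s. s k \<noteq> 2) (op 1 (\<lambda>_. (1, Stay))) skip) (adv st k 1) 2 ?st"
    by (intro runs_If[where A = 1 and B = 1]) (auto simp: mark_def intro!: runs_op runs_skip)
  have r2: "reads ?st k (enc_nat u @ enc_nat v @ enc_nat w @ y)"
    using r1 k by (simp add: reads_mark)
  note s1 = runs_skip_nat[OF r2 order_refl]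
  note r3 = reads_append[OF r2]
  note s2 = runs_skip_nat[OF r3 order_refl]
  note r4 = reads_append[OF r3]
  note s3 = runs_skip_nat[OF r4 order_refl]
  have fin: "adv (adv (adv ?st k (length (enc_nat u))) k (length (enc_nat v))) k (length (enc_nat w)) =
      mark (u = 0) (adv st k (length (True # enc_nat u @ enc_nat v @ enc_nat w)))"
    using k by (simp add: adv_mark add.assoc)
  have pos: "1 \<le> length (enc_nat m)" for m
    by (simp add: enc_nat_def length_self_delimiting)
  show ?thesis
    unfolding read_operation_def fin[symmetric]
    by (rule runs_Seq[OF runs_forward[OF order_refl] runs_Seq[OF test runs_Seq[OF s1 runs_Seq[OF s2 s3 order_refl] order_refl] order_refl]])
      (use B pos[of u] pos[of v] pos[of w] in simp)
qed

definition reader :: "nat \<Rightarrow> prog" where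
  "reader k = PSeq (op 1 (\<lambda>_. (2, Stay))) (PWhile (\<lambda>s. s k = 2) (read_operation k))"

lemma runs_read_loop:
  assumes "reads st k (enc_operations xs)" "k \<noteq> 1"
  shows "\<exists>n. runs g (PWhile (\<lambda>s. s k = 2) (read_operation k)) st (6 * length (enc_operations xs))
    (mark (\<exists>(u, v, w)\<in>set xs. u = 0) (adv st k n))"
  using assms
proof (induction xs arbitrary: st)
  case Nil
  then have "syms st k = 1"
    using reads_Cons[of st k False "[]"] by (simp add: enc_operations_def enc_list_def)
  then have "runs g (PWhile (\<lambda>s. s k = 2) (read_operation k)) st (6 * length (enc_operations [])) (mark (\<exists>(u, v, w)\<in>set []. u = 0) (adv st k 0))"
    by (simp add: mark_def enc_operations_def enc_list_def runs_WhileF)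
  then show ?case
    by blast
next
  case (Cons op xs)
  obtain u v w where op: "op = (u, v, w)" by (cases op)
  define ol where "ol = True # enc_nat u @ enc_nat v @ enc_nat w"
  have enc: "enc_operations (op # xs) = ol @ enc_operations xs"
    by (simp add: enc_operations_def enc_list_def op ol_def)
  have r: "reads st k (True # enc_nat u @ enc_nat v @ enc_nat w @ enc_operations xs)"
    using Cons.prems(1) unfolding enc by (simp add: ol_def)
  let ?st = "mark (u = 0) (adv st k (length ol))"
  have one: "runs g (read_operation k) st (4 * length ol + 4) ?st"
    unfolding ol_def by (rule runs_read_operation[OF r Cons.prems(2)]) simp
  have "reads ?st k (enc_operations xs)"
    using reads_append[of st k ol "enc_operations xs"] Cons.prems by (simp add: reads_mark enc)
  from Cons.IH[OF this Cons.prems(2)] obtain n where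
    n: "runs g (PWhile (\<lambda>s. s k = 2) (read_operation k)) ?st (6 * length (enc_operations xs))
      (mark (\<exists>(u, v, w)\<in>set xs. u = 0) (adv ?st k n))"
    by blast
  have "runs g (PWhile (\<lambda>s. s k = 2) (read_operation k)) st (6 * length (enc_operations (op # xs)))
      (mark (\<exists>(u, v, w)\<in>set xs. u = 0) (adv ?st k n))"
  proof (rule runs_WhileT[OF _ one n])
    show "syms st k = 2"
      using reads_Cons[OF r] by simp
    have "4 \<le> length ol"
      by (simp add: ol_def enc_nat_def length_self_delimiting)
    then show "Suc (4 * length ol + 4 + 6 * length (enc_operations xs)) \<le> 6 * length (enc_operations (op # xs))"
      by (simp add: enc)
  qed
  moreover have "mark (\<exists>(u, v, w)\<in>set xs. u = 0) (adv ?st k n) =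
      mark (\<exists>(u, v, w)\<in>set (op # xs). u = 0) (adv st k (length ol + n))"
    using Cons.prems(2) by (simp add: adv_mark mark_mark op disj_commute)
  ultimately show ?case
    by metis
qed

text \<open>Used with k = 2, where the oracle leaves its answer, and with k = 3, where a simulated
  machine leaves its output. The length bound within the relation turns linear time in the answer
  into polynomial time in \<open>x\<close>.\<close>

lemma concludes_reader:
  assumes k: "k \<noteq> 1"
  shows "concludes k (reader k) (\<lambda>x y. \<exists>xs. y = enc_operations xs \<and> length y \<le> poly b (length x) \<and>
     h x = [\<forall>(u, v, w)\<in>set xs. u \<noteq> 0]) h (smult 6 b + 2)"
  unfolding concludes_def
proof (intro conjI allI impI)
  fix g x st
  assume "\<exists>xs. tape_word (st k) = enc_operations xs \<and> length (tape_word (st k)) \<le> poly b (length x) \<and>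
     h x = [\<forall>(u, v, w)\<in>set xs. u \<noteq> 0]" and blank: "st 1 = blank_tape"
  then obtain xs where xs: "tape_word (st k) = enc_operations xs" "length (tape_word (st k)) \<le> poly b (length x)"
    "h x = [\<forall>(u, v, w)\<in>set xs. u \<noteq> 0]"
    by blast
  let ?st = "st(1 := act (2, Stay) (st 1))"
  have "reads ?st k (enc_operations xs)"
    using tape_word_nth[OF xs(1)] k by (simp add: reads_def)
  from runs_read_loop[OF this k, of g] obtain n where
    n: "runs g (PWhile (\<lambda>s. s k = 2) (read_operation k)) ?st (6 * length (enc_operations xs))
      (mark (\<exists>(u, v, w)\<in>set xs. u = 0) (adv ?st k n))" (is "runs _ _ _ _ ?st'")
    by blast
  have "?st' 1 = act (if \<forall>(u, v, w)\<in>set xs. u \<noteq> 0 then 2 else 1, Stay) blank_tape"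
    using blank k by (auto simp: mark_def adv_def blank_tape_def)
  then have "tape_word (?st' 1) = h x"
    using tape_word_blank_act[of "\<forall>(u, v, w)\<in>set xs. u \<noteq> 0"] xs(3) by simp
  moreover have "runs g (reader k) st (poly (smult 6 b + 2) (length x)) ?st'"
    unfolding reader_def
    by (rule runs_Seq[OF runs_op[OF refl order_refl] n]) (use xs(1,2) in simp)
  ultimately show "\<exists>st'. runs g (reader k) st (poly (smult 6 b + 2) (length x)) st' \<and> tape_word (st' 1) = h x"
    by blast
qed (simp_all add: reader_def read_operation_def skip_nat_def forward_def skip_def)

section \<open>Computations as families of clauses\<close>

text \<open>A literal carries its sign, the kind of its atom, and the two coordinates of the atom as
  expressions in the variables 0 and 1. A schema is a guard with a clause; it stands for the
  instances of the clause at all values of the two variables for which the guard is nonzero.\<close>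

type_synonym lit = "bool \<times> nat \<times> aexp \<times> aexp"
type_synonym schema = "aexp \<times> lit list"

definition env :: "nat \<Rightarrow> nat \<Rightarrow> nat \<Rightarrow> nat" where
  "env t j = (\<lambda>_. 0)(0 := t, 1 := j)"

fun atom :: "word \<Rightarrow> nat \<Rightarrow> nat \<Rightarrow> lit \<Rightarrow> nat \<times> nat \<times> nat" where
  "atom x t j (b, \<kappa>, te, je) = (\<kappa>, aval x (env t j) te, aval x (env t j) je)"

definition satisfies :: "word \<Rightarrow> nat \<Rightarrow> schema list \<Rightarrow> (nat \<times> nat \<times> nat \<Rightarrow> bool) \<Rightarrow> bool" where
  "satisfies x Z cs a \<longleftrightarrow> (\<forall>(g, ls)\<in>set cs. \<forall>t<Z. \<forall>j<Z. aval x (env t j) g \<noteq> 0 \<longrightarrow>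
     (\<exists>l\<in>set ls. a (atom x t j l) = fst l))"

text \<open>The range condition ensures that every literal is an item, and distinctness that the
  recommendation list of a clause has no repetitions.\<close>

definition well_formed :: "word \<Rightarrow> nat \<Rightarrow> nat \<Rightarrow> schema \<Rightarrow> bool" where
  "well_formed x Z A = (\<lambda>(g, ls). \<forall>t<Z. \<forall>j<Z. aval x (env t j) g \<noteq> 0 \<longrightarrow>
     (\<forall>l\<in>set ls. atom x t j l \<in> {..<A} \<times> {..<Z} \<times> {..<Z}) \<and>
     distinct (map (\<lambda>l. (fst l, atom x t j l)) ls) \<and> ls \<noteq> [])"

definition Mul :: "aexp \<Rightarrow> aexp \<Rightarrow> aexp" where "Mul a b = Sum None a b"
definition Leq :: "aexp \<Rightarrow> aexp \<Rightarrow> aexp" where "Leq a b = Sub (Cst 1) (Sub a b)"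
definition Neg :: "aexp \<Rightarrow> aexp" where "Neg a = Sub (Cst 1) a"
definition Equ :: "aexp \<Rightarrow> aexp \<Rightarrow> aexp" where "Equ a b = Mul (Leq a b) (Leq b a)"
definition Less :: "aexp \<Rightarrow> aexp \<Rightarrow> aexp" where "Less a b = Leq (Add a (Cst 1)) b"

lemma aval_Mul [simp]: "aval x \<rho> (Mul a b) = aval x \<rho> a * aval x \<rho> b"
  by (simp add: Mul_def upd_def)

lemma aval_compare [simp]:
  "aval x \<rho> (Leq a b) = (if aval x \<rho> a \<le> aval x \<rho> b then 1 else 0)"
  "aval x \<rho> (Neg a) = (if aval x \<rho> a = 0 then 1 else 0)"
  "aval x \<rho> (Equ a b) = (if aval x \<rho> a = aval x \<rho> b then 1 else 0)"
  "aval x \<rho> (Less a b) = (if aval x \<rho> a < aval x \<rho> b then 1 else 0)"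
  by (auto simp: Leq_def Neg_def Equ_def Less_def)

lemma env_simps [simp]: "env t j 0 = t" "env t j (Suc 0) = j" "env t j 1 = j"
  by (auto simp: env_def)

lemma ex_poly_aexp: "\<exists>e. \<forall>x \<rho>. aval x \<rho> e = poly q (aval x \<rho> e0)"
proof (induction q)
  case 0
  show ?case by (intro exI[of _ "Cst 0"]) simp
next
  case (pCons c q)
  then obtain e where "\<forall>x \<rho>. aval x \<rho> e = poly q (aval x \<rho> e0)"
    by blast
  then show ?case
    by (intro exI[of _ "Add (Cst c) (Mul e0 e)"]) simp
qed

lemma nth_self_delimiting:
  "i < length x \<Longrightarrow> self_delimiting x ! (2 * i)"
  "i < length x \<Longrightarrow> self_delimiting x ! (2 * i + 1) = x ! i"
  "\<not> self_delimiting x ! (2 * length x)"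
proof -
  show "i < length x \<Longrightarrow> self_delimiting x ! (2 * i)"
    by (induction x arbitrary: i) (auto simp: nth_Cons' less_Suc_eq_0_disj)
  show "i < length x \<Longrightarrow> self_delimiting x ! (2 * i + 1) = x ! i"
    by (induction x arbitrary: i) (auto simp: nth_Cons' less_Suc_eq_0_disj)
  show "\<not> self_delimiting x ! (2 * length x)"
    by (induction x) auto
qed

lemma div_mod_add: "s < g \<Longrightarrow> (k * g + s) div g = k" "s < g \<Longrightarrow> (k * g + s) mod g = (s :: nat)"
  by auto

section \<open>The tableau of a verifier\<close>

fun offset :: "move \<Rightarrow> int" where
  "offset Move_left = - 1" | "offset Stay = 0" | "offset Move_right = 1"

lemma act_offset: "act (s, m) (c, p) = (c(p := s), p + offset m)"
  by (cases m) auto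

text \<open>\<open>P\<close> bounds the witness and \<open>T\<close> the running time. Both are also
  available as expressions \<open>Pe\<close> and \<open>Te\<close>, since guards and coordinates of
  the clauses must be printable.\<close>

locale tableau =
  fixes M :: tm and C :: "word set" and Pe Te :: aexp and P T :: "word \<Rightarrow> nat"
  assumes M: "turing_machine M" "query M = None"
    and Pe: "\<And>x \<rho>. aval x \<rho> Pe = P x" and Te: "\<And>x \<rho>. aval x \<rho> Te = T x"
    and decides: "\<And>x w. length w \<le> P x \<Longrightarrow>
      outputs_within M (\<lambda>_. []) (self_delimiting x @ w) (T x) [self_delimiting x @ w \<in> C]"
begin

abbreviation "K \<equiv> n_tapes M"
abbreviation "G \<equiv> max (n_symbols M) (n_states M)"

definition cfg :: "word \<Rightarrow> nat \<Rightarrow> config" where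
  "cfg y n = (step M (\<lambda>_. []) ^^ n) (initial M y)"

text \<open>Cells are addressed relative to the head; the state is treated as the scanned symbol of
  an additional tape.\<close>

fun rel :: "config \<Rightarrow> nat \<Rightarrow> int \<Rightarrow> nat" where
  "rel (q, ts) k i = (if k < K then fst (ts ! k) (snd (ts ! k) + i) else if i = 0 then q else 0)"

definition scanned :: "config \<Rightarrow> nat list" where
  "scanned c = map (\<lambda>k. rel c k 0) [0..<Suc K]"

text \<open>The absorbing halting state is built into the local rule, so a run that halts early is
  continued up to time \<open>T x\<close>.\<close>

definition local_act :: "nat list \<Rightarrow> nat \<Rightarrow> nat \<times> move" where
  "local_act c k = (if c ! K = 1 then (c ! k, Stay)
     else if k < K then snd (delta M (c ! K) (take K c)) ! k
     else (fst (delta M (c ! K) (take K c)), Stay))"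

text \<open>All possible tuples of scanned symbols, the state included. Their number does not depend
  on the input, so the transition function is unrolled into finitely many schemas.\<close>

definition combos :: "nat list list" where
  "combos = filter (\<lambda>c. c ! K < n_states M \<and> (\<forall>k<K. c ! k < n_symbols M)) (List.n_lists (Suc K) [0..<G])"

lemma three_tapes: "3 \<le> K" "3 \<le> n_symbols M" "2 \<le> n_states M"
  using M(1) by (auto simp: turing_machine_def)

lemma valid_cfg: "valid_config M (cfg y n)"
  unfolding cfg_def by (induction n) (simp_all add: valid_initial[OF M(1)] valid_step[OF M])

lemma cfg_Suc: "cfg y (Suc n) = step M (\<lambda>_. []) (cfg y n)"
  by (simp add: cfg_def)

lemma rel_less: "valid_config M c \<Longrightarrow> rel c k i < G"
  using three_tapes by (cases c) (auto simp: valid_config_def less_max_iff_disj)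

lemma length_scanned [simp]: "length (scanned c) = Suc K"
  by (simp add: scanned_def)

lemma nth_scanned [simp]: "k \<le> K \<Longrightarrow> scanned c ! k = rel c k 0"
  by (simp add: scanned_def del: upt_Suc)

lemma in_combos:
  "c \<in> set combos \<longleftrightarrow> length c = Suc K \<and> set c \<subseteq> {..<G} \<and> c ! K < n_states M \<and> (\<forall>k<K. c ! k < n_symbols M)"
  by (auto simp: combos_def set_n_lists simp del: List.n_lists.simps)

lemma scanned_in_combos:
  assumes "valid_config M c"
  shows "scanned c \<in> set combos"
proof -
  have "set (scanned c) \<subseteq> {..<G}"
    using rel_less[OF assms] by (auto simp: scanned_def)
  moreover have "scanned c ! K < n_states M" "\<forall>k<K. scanned c ! k < n_symbols M"
    using assms by (cases c; auto simp: valid_config_def)+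
  ultimately show ?thesis
    by (simp add: in_combos)
qed

lemma local_act_less:
  assumes "c \<in> set combos" "k \<le> K"
  shows "fst (local_act c k) < G"
proof -
  have c: "length c = Suc K" "c ! K < n_states M" "\<forall>k<K. c ! k < n_symbols M"
    using assms by (auto simp: in_combos)
  then have "length (take K c) = K" "set (take K c) \<subseteq> {..<n_symbols M}"
    by (auto simp: in_set_conv_nth)
  note d = delta_valid[OF M(1) c(2) this]
  show ?thesis
    using d(1) d(3)[of k] c assms(2) by (cases "k = K") (auto simp: local_act_def less_max_iff_disj)
qed

text \<open>Relative to the head, a move shifts the whole tape: the cell now at offset i was at
  offset i + \<open>offset m\<close>, and it is the rewritten cell iff that was 0.\<close>

lemma rel_step:
  assumes v: "valid_config M c" and k: "k \<le> K"
  shows "rel (step M g c) k i = (case local_act (scanned c) k of (w, m) \<Rightarrow>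
    if i + offset m = 0 then w else rel c k (i + offset m))"
proof -
  obtain q ts where c: "c = (q, ts)" by fastforce
  have ts: "length ts = K" and q: "q < n_states M"
    using v by (auto simp: c valid_config_def)
  define ss where "ss = map (\<lambda>(c, p). c p) ts"
  have take: "take K (scanned c) = ss"
    using ts by (auto simp: ss_def c intro!: nth_equalityI split: prod.splits)
  have sK: "scanned c ! K = q"
    by (simp add: c)
  show ?thesis
  proof (cases "q = 1")
    case True
    then show ?thesis
      using k by (auto simp: c local_act_def sK[unfolded c])
  next
    case False
    obtain r as where d: "delta M q ss = (r, as)" by fastforce
    have as: "length as = K"
      using delta_valid(2)[OF M(1) q, of ss] valid_scanned[of M q ts] v d by (simp add: c ss_def)
    have step: "step M g (q, ts) = (r, map2 act as ts)"
      using False M(2) by (simp add: d[unfolded ss_def])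
    show ?thesis
    proof (cases "k = K")
      case True
      then show ?thesis
        using False by (simp add: c step local_act_def sK[unfolded c] take[unfolded c] d del: step.simps)
    next
      case k': False
      obtain w m where wm: "as ! k = (w, m)" by fastforce
      obtain f h where fh: "ts ! k = (f, h)" by fastforce
      have "local_act (scanned c) k = (w, m)"
        using False k k' by (simp add: local_act_def sK take d wm)
      moreover have "(map2 act as ts) ! k = (f(h := w), h + offset m)"
        using k k' ts as by (simp add: wm fh act_offset del: act.simps)
      ultimately show ?thesis
        using k k' by (simp add: c step fh algebra_simps del: step.simps)
    qed
  qed
qed

text \<open>The head sits at position \<open>bound x\<close>, in the middle of
  \<open>width x\<close> positions. The right half contains the longest admissible input, and since
  \<open>bound x\<close> exceeds \<open>T x\<close>, the middle is still reliable at time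
  \<open>T x\<close>.\<close>

definition "bound x = T x + 2 * length x + P x + 2"
definition "width x = 2 * bound x + 1"
definition "Ne = Add Te (Add (Add Len Len) (Add Pe (Cst 2)))"
definition "Ze = Add (Add Ne Ne) (Cst 1)"

lemma aval_exps [simp]:
  "aval x \<rho> Pe = P x" "aval x \<rho> Te = T x" "aval x \<rho> Ne = bound x" "aval x \<rho> Ze = width x"
  by (auto simp: Pe Te Ne_def Ze_def bound_def width_def)

text \<open>The atom with kind \<open>kind k s\<close> and coordinates t, j says that at time t tape
  k has symbol s at position j; tape \<open>K\<close> is the one of the state.\<close>

definition kind :: "nat \<Rightarrow> nat \<Rightarrow> nat" where
  "kind k s = k * G + s"

lemma kind_inj [simp]: "s < G \<Longrightarrow> s' < G \<Longrightarrow> kind k s = kind k' s' \<longleftrightarrow> k = k' \<and> s = s'"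
  unfolding kind_def by (metis div_mult_self3 mod_mult_self3 add.commute div_less mod_less add_0_right gr_implies_not0)

lemma kind_less: "s < G \<Longrightarrow> k \<le> K \<Longrightarrow> kind k s < Suc K * G"
  unfolding kind_def by (metis add.commute add_less_le_mono mult_Suc mult_le_mono1)

fun shifted :: "move \<Rightarrow> aexp" where
  "shifted Move_left = Sub (Var 1) (Cst 1)"
| "shifted Stay = Var 1"
| "shifted Move_right = Add (Var 1) (Cst 1)"

text \<open>The premise of an implication, as negative literals: at time \<open>Var 0\<close> the
  head position \<open>Ne\<close> shows the tuple \<open>c\<close>.\<close>

abbreviation "cells_at c \<equiv> map (\<lambda>k'. (False, kind k' (c ! k'), Var 0, Ne)) [0..<Suc K]"

text \<open>No clause speaks about a cell at the border of the range. At time \<open>n\<close> a satisfying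
  assignment is therefore only forced to be correct at distance at least \<open>n\<close> from the border, which
  suffices, as only the scanned cells matter at time \<open>T x\<close>.\<close>

definition inner :: aexp where
  "inner = Mul (Less (Var 0) Te) (Mul (Less (Cst 0) (Var 1)) (Less (Var 1) (Add Ne Ne)))"

definition copy_schema :: "nat list \<Rightarrow> nat \<Rightarrow> nat \<Rightarrow> schema" where
  "copy_schema c k s = (let m = snd (local_act c k) in
     (Mul inner (Neg (Equ (shifted m) Ne)),
      cells_at c @ [(False, kind k s, Var 0, shifted m), (True, kind k s, Add (Var 0) (Cst 1), Var 1)]))"

definition write_schema :: "nat list \<Rightarrow> nat \<Rightarrow> schema" where
  "write_schema c k = (let (w, m) = local_act c k in
     (Mul inner (Equ (shifted m) Ne), cells_at c @ [(True, kind k w, Add (Var 0) (Cst 1), Var 1)]))"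

definition start :: aexp where
  "start = Add Ne (Add (Add Len Len) (Cst 1))"

definition first_cell :: aexp where
  "first_cell = Mul (Equ (Var 0) (Cst 0)) (Equ (Var 1) (Cst 0))"

text \<open>In order: blanks outside the input; the separators True of
  \<open>self_delimiting x\<close>; its data bits, in two schemas; its closing False; some symbol in
  each witness cell; a blank witness cell is followed by a blank, which admits short witnesses; the
  output is not False. In the second to fourth schema variable 0 is the index of an input bit and
  not a time.\<close>

definition input_schemas :: "schema list" where
  "input_schemas =
    [(Mul (Equ (Var 0) (Cst 0)) (Add (Less (Var 1) Ne) (Leq (Add start Pe) (Var 1))), [(True, kind 0 0, Cst 0, Var 1)]),
     (Mul (Less (Var 0) Len) (Equ (Var 1) (Cst 0)), [(True, kind 0 2, Cst 0, Add Ne (Add (Var 0) (Var 0)))]),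
     (Mul (Mul (Less (Var 0) Len) (Bit (Var 0))) (Equ (Var 1) (Cst 0)),
       [(True, kind 0 2, Cst 0, Add Ne (Add (Add (Var 0) (Var 0)) (Cst 1)))]),
     (Mul (Mul (Less (Var 0) Len) (Neg (Bit (Var 0)))) (Equ (Var 1) (Cst 0)),
       [(True, kind 0 1, Cst 0, Add Ne (Add (Add (Var 0) (Var 0)) (Cst 1)))]),
     (first_cell, [(True, kind 0 1, Cst 0, Add Ne (Add Len Len))]),
     (Mul (Equ (Var 0) (Cst 0)) (Mul (Leq start (Var 1)) (Less (Var 1) (Add start Pe))),
       [(True, kind 0 0, Cst 0, Var 1), (True, kind 0 1, Cst 0, Var 1), (True, kind 0 2, Cst 0, Var 1)]),
     (Mul (Equ (Var 0) (Cst 0)) (Mul (Leq start (Var 1)) (Less (Add (Var 1) (Cst 1)) (Add start Pe))),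
       [(False, kind 0 0, Cst 0, Var 1), (True, kind 0 0, Cst 0, Add (Var 1) (Cst 1))]),
     (first_cell, [(False, kind 1 1, Te, Ne)])]"

definition schemas :: "schema list" where
  "schemas = concat (map (\<lambda>c. map (write_schema c) [0..<Suc K]) combos)
     @ concat (map (\<lambda>c. concat (map (\<lambda>k. map (copy_schema c k) [0..<G]) [0..<Suc K])) combos)
     @ map (\<lambda>k. (Equ (Var 0) (Cst 0), [(True, kind k 0, Cst 0, Var 1)])) [1..<Suc K] @ input_schemas"

lemma schemas_cases:
  assumes "cl \<in> set schemas"
  obtains (writing) c k where "c \<in> set combos" "k \<le> K" "cl = write_schema c k"
  | (copy) c k s where "c \<in> set combos" "k \<le> K" "s < G" "cl = copy_schema c k s"
  | (blank) k where "1 \<le> k" "k \<le> K" "cl = (Equ (Var 0) (Cst 0), [(True, kind k 0, Cst 0, Var 1)])"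
  | (input) "cl \<in> set input_schemas"
proof -
  consider "cl \<in> (\<Union>c\<in>set combos. write_schema c ` {0..<Suc K})"
    | "cl \<in> (\<Union>c\<in>set combos. \<Union>k\<in>{0..<Suc K}. copy_schema c k ` {0..<G})"
    | "cl \<in> (\<lambda>k. (Equ (Var 0) (Cst 0), [(True, kind k 0, Cst 0, Var 1)])) ` {1..<Suc K}"
    | "cl \<in> set input_schemas"
    using assms unfolding schemas_def set_append set_concat set_map set_upt image_image Un_iff by blast
  then show thesis
  proof cases
    case 1
    then show thesis using writing by (auto simp: less_Suc_eq_le)
  next
    case 2
    then show thesis using copy by (auto simp: less_Suc_eq_le)
  next
    case 3
    then show thesis using blank by (auto simp: less_Suc_eq_le)
  qed (rule input)
qed

lemma schemas_mem:
  "c \<in> set combos \<Longrightarrow> k \<le> K \<Longrightarrow> write_schema c k \<in> set schemas"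
  "c \<in> set combos \<Longrightarrow> k \<le> K \<Longrightarrow> s < G \<Longrightarrow> copy_schema c k s \<in> set schemas"
  "1 \<le> k \<Longrightarrow> k \<le> K \<Longrightarrow> (Equ (Var 0) (Cst 0), [(True, kind k 0, Cst 0, Var 1)]) \<in> set schemas"
  "cl \<in> set input_schemas \<Longrightarrow> cl \<in> set schemas"
  unfolding schemas_def set_append set_concat set_map set_upt image_image by force+

lemma symbols_less: "0 < G" "1 < G" "2 < G"
  using three_tapes by (auto simp: less_max_iff_disj)

lemma combo_less: "c \<in> set combos \<Longrightarrow> k \<le> K \<Longrightarrow> c ! k < G"
  by (metis in_combos lessThan_iff less_Suc_eq_le nth_mem subsetD)

lemma kind_less_max: "c \<in> set combos \<Longrightarrow> k \<le> K \<Longrightarrow> kind k (c ! k) < Suc K * G"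
  by (intro kind_less combo_less)

lemma aval_shifted: "0 < j \<Longrightarrow> int (aval x (env t j) (shifted m)) = int j + offset m"
  by (cases m) auto

lemma aval_inner: "aval x (env t j) inner = (if t < T x \<and> 0 < j \<and> j < 2 * bound x then 1 else 0)"
  by (auto simp: inner_def)

lemma T_bound: "T x < bound x"
  by (simp add: bound_def)

lemma distinct_cells:
  assumes "c \<in> set combos"
  shows "distinct (map (\<lambda>l. (fst l, atom x t j l)) (cells_at c))"
  using assms by (auto simp: distinct_map inj_on_def combo_less less_Suc_eq_le simp del: upt_Suc)

lemma well_formed_schemas:
  assumes "cl \<in> set schemas"
  shows "well_formed x (width x) (Suc K * G) cl"
  using assms
proof (cases rule: schemas_cases)
  case (writing c k)
  obtain w m where wm: "local_act c k = (w, m)" by fastforce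
  have w: "kind k w < Suc K * G"
    using local_act_less[OF writing(1,2)] wm writing(2) by (intro kind_less) auto
  show ?thesis
    using writing w kind_less_max[OF writing(1)] distinct_cells[OF writing(1), of x] T_bound[of x]
    by (auto simp: write_schema_def wm well_formed_def aval_inner width_def less_Suc_eq_le simp del: upt_Suc)
next
  case (copy c k s)
  obtain w m where wm: "local_act c k = (w, m)" by fastforce
  have s: "kind k s < Suc K * G"
    using copy by (intro kind_less)
  have sh: "aval x (env t j) (shifted m) < Suc (2 * bound x)" if "0 < j" "j < 2 * bound x" for t j
    using that by (cases m) auto
  show ?thesis
    using copy s kind_less_max[OF copy(1)] distinct_cells[OF copy(1), of x] T_bound[of x] sh
    by (auto simp: copy_schema_def wm well_formed_def aval_inner width_def less_Suc_eq_le simp del: upt_Suc)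
next
  case (blank k)
  then show ?thesis
    using kind_less[of 0 k] symbols_less three_tapes by (auto simp: well_formed_def)
next
  case input
  have "kind 0 s < Suc K * G" if "s < G" for s
    using that by (intro kind_less) auto
  moreover have "kind 1 1 < Suc K * G"
    using symbols_less three_tapes by (intro kind_less) auto
  ultimately show ?thesis
    using input three_tapes symbols_less T_bound[of x]
    by (auto simp: input_schemas_def well_formed_def first_cell_def start_def width_def bound_def split: if_splits)
qed

lemma rel_initial:
  "rel (initial M y) 0 i = (if 0 \<le> i \<and> i < int (length y) then if y ! nat i then 2 else 1 else 0)"
  "1 \<le> k \<Longrightarrow> k \<le> K \<Longrightarrow> rel (initial M y) k i = 0"
  using three_tapes by (auto simp: initial_def word_tape_def blank_tape_def nth_Cons')

lemma rel_final:
  assumes "length w \<le> P x"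
  shows "rel (cfg (self_delimiting x @ w) (T x)) 1 0 = (if self_delimiting x @ w \<in> C then 2 else 1)"
proof -
  obtain q ts where c: "cfg (self_delimiting x @ w) (T x) = (q, ts)" by fastforce
  have "tape_word (ts ! 1) = [self_delimiting x @ w \<in> C]"
    using decides[OF assms] c by (simp add: outputs_within_def cfg_def)
  from tape_word_nth[OF this, of 0] show ?thesis
    using three_tapes by (simp add: c)
qed

lemma div_kind [simp]: "s < G \<Longrightarrow> kind k s div G = k" "s < G \<Longrightarrow> kind k s mod G = s"
  unfolding kind_def using div_mod_add[of s G k] by blast+

definition run_assignment :: "word \<Rightarrow> word \<Rightarrow> nat \<times> nat \<times> nat \<Rightarrow> bool" where
  "run_assignment x w = (\<lambda>(\<kappa>, t, j). rel (cfg (self_delimiting x @ w) t) (\<kappa> div G) (int j - int (bound x)) = \<kappa> mod G)"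

lemma run_assignment_kind:
  "s < G \<Longrightarrow> run_assignment x w (kind k s, t, j) \<longleftrightarrow> rel (cfg (self_delimiting x @ w) t) k (int j - int (bound x)) = s"
  by (simp add: run_assignment_def)

lemma cells_scanned:
  assumes "c \<in> set combos" "\<And>k. k \<le> K \<Longrightarrow> rel d k 0 = c ! k"
  shows "scanned d = c"
  using assms by (intro nth_equalityI) (auto simp: in_combos less_Suc_eq_le simp del: rel.simps)

lemma run_satisfies:
  assumes w: "length w \<le> P x" "self_delimiting x @ w \<in> C"
  shows "satisfies x (width x) schemas (run_assignment x w)"
  unfolding satisfies_def
proof (intro ballI, clarify)
  fix g ls t j
  assume cl: "(g, ls) \<in> set schemas" and tj: "t < width x" "j < width x" and g: "0 < aval x (env t j) g"
  let ?y = "self_delimiting x @ w"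
  let ?a = "run_assignment x w"
  from cl show "\<exists>l\<in>set ls. ?a (atom x t j l) = fst l"
  proof (cases rule: schemas_cases)
    case (writing c k)
    obtain v m where vm: "local_act c k = (v, m)" by fastforce
    have v: "v < G"
      using local_act_less[OF writing(1,2)] vm by simp
    have ls: "ls = cells_at c @ [(True, kind k v, Add (Var 0) (Cst 1), Var 1)]"
      and *: "0 < j" "aval x (env t j) (shifted m) = bound x"
      using writing g by (auto simp: write_schema_def vm aval_inner split: if_splits)
    have off: "int j - int (bound x) + offset m = 0"
      using aval_shifted[OF *(1), of x t m] * by simp
    show ?thesis
    proof (cases "\<forall>k\<le>K. rel (cfg ?y t) k 0 = c ! k")
      case True
      then have "scanned (cfg ?y t) = c"
        using writing by (intro cells_scanned) auto
      then have "?a (kind k v, Suc t, j)"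
        using v rel_step[where c = "cfg ?y t" and k = k and g = "\<lambda>_. []" and i = "int j - int (bound x)", OF valid_cfg writing(2)] off
        by (simp add: run_assignment_kind cfg_Suc vm del: rel.simps)
      then show ?thesis
        by (intro bexI[of _ "(True, kind k v, Add (Var 0) (Cst 1), Var 1)"]) (auto simp: ls)
    next
      case False
      then obtain k' where k': "k' \<le> K" "rel (cfg ?y t) k' 0 \<noteq> c ! k'"
        by blast
      then have "\<not> ?a (kind k' (c ! k'), t, bound x)"
        using combo_less[OF writing(1)] by (simp add: run_assignment_kind del: rel.simps)
      then show ?thesis
        using k'(1) by (intro bexI[of _ "(False, kind k' (c ! k'), Var 0, Ne)"]) (auto simp: ls less_Suc_eq_le simp del: upt_Suc)
    qed
  next
    case (copy c k s)
    obtain v m where vm: "local_act c k = (v, m)" by fastforce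
    have ls: "ls = cells_at c @ [(False, kind k s, Var 0, shifted m), (True, kind k s, Add (Var 0) (Cst 1), Var 1)]"
      and *: "0 < j" "aval x (env t j) (shifted m) \<noteq> bound x"
      using copy g by (auto simp: copy_schema_def vm aval_inner split: if_splits)
    have off: "int j - int (bound x) + offset m \<noteq> 0"
      "int (aval x (env t j) (shifted m)) - int (bound x) = int j - int (bound x) + offset m"
      using aval_shifted[OF *(1), of x t m] * by auto
    show ?thesis
    proof (cases "\<forall>k\<le>K. rel (cfg ?y t) k 0 = c ! k")
      case True
      then have "scanned (cfg ?y t) = c"
        using copy by (intro cells_scanned) auto
      then have "?a (kind k s, Suc t, j) \<longleftrightarrow> ?a (kind k s, t, aval x (env t j) (shifted m))"
        using copy(3) rel_step[where c = "cfg ?y t" and k = k and g = "\<lambda>_. []" and i = "int j - int (bound x)", OF valid_cfg copy(2)] off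
        by (simp add: run_assignment_kind cfg_Suc vm algebra_simps del: rel.simps)
      then show ?thesis
        by (auto simp: ls simp del: upt_Suc)
    next
      case False
      then obtain k' where k': "k' \<le> K" "rel (cfg ?y t) k' 0 \<noteq> c ! k'"
        by blast
      then have "\<not> ?a (kind k' (c ! k'), t, bound x)"
        using combo_less[OF copy(1)] by (simp add: run_assignment_kind del: rel.simps)
      then show ?thesis
        using k'(1) by (intro bexI[of _ "(False, kind k' (c ! k'), Var 0, Ne)"]) (auto simp: ls less_Suc_eq_le simp del: upt_Suc)
    qed
  next
    case (blank k)
    then show ?thesis
      using g symbols_less by (auto simp: run_assignment_kind cfg_def rel_initial simp del: rel.simps split: if_splits)
  next
    case input
    have y: "length ?y = 2 * length x + 1 + length w"
      by (simp add: length_self_delimiting)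
    have bits: "?y ! (2 * i)" "?y ! (2 * i + 1) = x ! i" if "i < length x" for i
      using that nth_self_delimiting(1,2)[of i x] by (auto simp: nth_append length_self_delimiting)
    have end_bit: "\<not> ?y ! (2 * length x)"
      using nth_self_delimiting(3)[of x] by (simp add: nth_append length_self_delimiting)
    have a0: "?a (kind 0 0, 0, j) \<longleftrightarrow> j < bound x \<or> bound x + length ?y \<le> j" for j
      using symbols_less by (auto simp: run_assignment_kind cfg_def rel_initial simp del: rel.simps split: if_splits)
    have a1: "?a (kind 0 1, 0, bound x + i) \<longleftrightarrow> i < length ?y \<and> \<not> ?y ! i"
      and a2: "?a (kind 0 2, 0, bound x + i) \<longleftrightarrow> i < length ?y \<and> ?y ! i" for i
      using symbols_less by (auto simp: run_assignment_kind cfg_def rel_initial simp del: rel.simps split: if_splits)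
    have final: "\<not> ?a (kind 1 1, T x, bound x)"
      using rel_final[OF w(1)] w(2) symbols_less by (simp add: run_assignment_kind del: rel.simps)
    note simps = first_cell_def start_def mult_2[symmetric] add.assoc[symmetric]
    from input show ?thesis
      unfolding input_schemas_def set_simps insert_iff empty_iff prod.inject
    proof (elim disjE conjE, goal_cases)
      case 1
      then show ?case using g a0[of j] y w(1) by (auto simp: start_def split: if_splits)
    next
      case 2
      then have "t < length x" using g by (auto split: if_splits)
      then show ?case using 2 a2[of "2 * t"] bits[of t] y by (simp add: mult_2)
    next
      case 3
      then have "t < length x" "x ! t" using g by (auto split: if_splits)
      then show ?case using 3 a2[of "2 * t + 1"] bits[of t] y by (simp add: mult_2)
    next
      case 4
      then have "t < length x" "\<not> x ! t" using g by (auto split: if_splits)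
      then show ?case using 4 a1[of "2 * t + 1"] bits[of t] y by (simp add: mult_2)
    next
      case 5
      then show ?case using a1[of "2 * length x"] end_bit y by (simp add: mult_2)
    next
      case 6
      then have j: "bound x \<le> j" using g by (auto simp: start_def split: if_splits)
      show ?case
        using 6 a0[of j] a1[of "j - bound x"] a2[of "j - bound x"] j by auto
    next
      case 7
      then have "bound x \<le> j" using g by (auto simp: start_def split: if_splits)
      then show ?case
        using 7 a0[of j] a0[of "Suc j"] by auto
    next
      case 8
      then show ?case using final by simp
    qed simp
  qed
qed

lemma satisfies_run:
  assumes a: "satisfies x (width x) schemas a"
  obtains w where "length w \<le> P x" "self_delimiting x @ w \<in> C"
proof -
  let ?b = "bound x"
  define base where "base = ?b + 2 * length x + 1"
  have sat: "\<exists>l\<in>set ls. a (atom x t j l) = fst l"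
    if "(g, ls) \<in> set schemas" "t < width x" "j < width x" "aval x (env t j) g \<noteq> 0" for g ls t j
    using a that unfolding satisfies_def by fast
  have wd: "0 < width x" "length x < width x" "T x < width x"
    by (auto simp: width_def bound_def)
  have inp: "\<exists>l\<in>set ls. a (atom x t j l) = fst l"
    if "(g, ls) \<in> set input_schemas" "t < width x" "j < width x" "aval x (env t j) g \<noteq> 0" for g ls t j
    by (rule sat[OF schemas_mem(4)[OF that(1)] that(2-4)])
  note s = inp[unfolded input_schemas_def set_simps insert_iff empty_iff prod.inject]
  have i1: "a (kind 0 0, 0, j)" if "j < width x" "j < ?b \<or> base + P x \<le> j" for j
    using inp[OF _ wd(1) that(1), of "fst (input_schemas ! 0)" "snd (input_schemas ! 0)"] that(2)
    by (auto simp: input_schemas_def start_def base_def)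
  have i2: "a (kind 0 2, 0, ?b + 2 * i)" if "i < length x" for i
    using inp[of "fst (input_schemas ! 1)" "snd (input_schemas ! 1)" i 0] that wd
    by (simp add: input_schemas_def mult_2)
  have i3: "a (kind 0 (if x ! i then 2 else 1), 0, ?b + (2 * i + 1))" if "i < length x" for i
    using inp[of "fst (input_schemas ! 2)" "snd (input_schemas ! 2)" i 0]
      inp[of "fst (input_schemas ! 3)" "snd (input_schemas ! 3)" i 0] that wd
    by (simp add: input_schemas_def mult_2)
  have i5: "a (kind 0 1, 0, ?b + 2 * length x)"
    using inp[of "fst (input_schemas ! 4)" "snd (input_schemas ! 4)" 0 0] wd
    by (simp add: input_schemas_def first_cell_def mult_2)
  have base: "base + P x < width x"
    by (simp add: base_def width_def bound_def)
  have i6: "a (kind 0 0, 0, base + i) \<or> a (kind 0 1, 0, base + i) \<or> a (kind 0 2, 0, base + i)" if "i < P x" for i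
    using inp[of "fst (input_schemas ! 5)" "snd (input_schemas ! 5)" 0 "base + i"] wd that base
    by (simp add: input_schemas_def start_def base_def)
  have i7: "a (kind 0 0, 0, base + i) \<Longrightarrow> a (kind 0 0, 0, base + Suc i)" if "Suc i < P x" for i
    using inp[of "fst (input_schemas ! 6)" "snd (input_schemas ! 6)" 0 "base + i"] wd that base
    by (simp add: input_schemas_def start_def base_def)
  have i8: "\<not> a (kind 1 1, T x, ?b)"
    using inp[of "fst (input_schemas ! 7)" "snd (input_schemas ! 7)" 0 0] wd
    by (simp add: input_schemas_def first_cell_def)
  \<comment> \<open>The length of the witness: up to the first cell marked blank. The schema that
    propagates blanks marks all later witness cells as well.\<close>
  define m where "m = (LEAST i. i = P x \<or> a (kind 0 0, 0, base + i))"
  have m: "m = P x \<or> a (kind 0 0, 0, base + m)"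
    unfolding m_def by (rule LeastI[of _ "P x"]) simp
  have m_le: "m \<le> P x"
    unfolding m_def by (rule Least_le) simp
  have m_less: "\<not> a (kind 0 0, 0, base + i)" if "i < m" for i
    using not_less_Least[OF that[unfolded m_def]] by simp
  have m_ge: "a (kind 0 0, 0, base + i)" if "m \<le> i" "i < P x" for i
    using that
  proof (induction i rule: dec_induct)
    case base
    then show ?case using m by auto
  next
    case (step i)
    then show ?case using i7[of i] by simp
  qed
  \<comment> \<open>A cell may be marked with both bits. True is then taken; it only matters that
    the bit chosen is marked.\<close>
  define w where "w = map (\<lambda>i. a (kind 0 2, 0, base + i)) [0..<m]"
  let ?y = "self_delimiting x @ w"
  have w: "length w \<le> P x" "length w = m"
    using m_le by (auto simp: w_def)
  have y: "length ?y = 2 * length x + 1 + m"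
    using w by (simp add: length_self_delimiting)
  have init: "a (kind k (rel (cfg ?y 0) k (int j - int ?b)), 0, j)" if k: "k \<le> K" and j: "j < width x" for k j
  proof (cases "k = 0")
    case False
    then have "rel (cfg ?y 0) k (int j - int ?b) = 0"
      using k by (simp add: cfg_def rel_initial del: rel.simps)
    then show ?thesis
      using sat[OF schemas_mem(3)[of k] wd(1) j] False k by simp
  next
    case True
    consider "j < ?b \<or> base + P x \<le> j" | i where "i < length x" "j = ?b + 2 * i"
      | i where "i < length x" "j = ?b + (2 * i + 1)" | "j = ?b + 2 * length x"
      | i where "i < P x" "j = base + i"
    proof -
      consider "j < ?b \<or> base + P x \<le> j" | "?b \<le> j" "j < ?b + 2 * length x" | "j = ?b + 2 * length x"
        | "base \<le> j" "j < base + P x"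
        by (force simp: base_def)
      then show thesis
      proof cases
        case 2
        define i where "i = (j - ?b) div 2"
        have "i < length x" "j = ?b + 2 * i \<or> j = ?b + (2 * i + 1)"
          using 2 by (auto simp: i_def)
        then show thesis using that(2,3) by blast
      next
        case 4
        then show thesis using that(5)[of "j - base"] by simp
      qed (use that in auto)
    qed
    then show ?thesis
    proof cases
      case 1
      then have "rel (cfg ?y 0) 0 (int j - int ?b) = 0"
        using y m_le by (auto simp: cfg_def rel_initial base_def simp del: rel.simps)
      then show ?thesis
        using True i1[OF j 1] by simp
    next
      case (2 i)
      then have "rel (cfg ?y 0) 0 (int j - int ?b) = 2"
        using y nth_self_delimiting(1)[OF 2(1)]
        by (simp add: cfg_def rel_initial nth_append length_self_delimiting nat_mult_distrib del: rel.simps)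
      then show ?thesis
        using True i2[OF 2(1)] 2 by simp
    next
      case (3 i)
      then have "rel (cfg ?y 0) 0 (int j - int ?b) = (if x ! i then 2 else 1)"
        using y nth_self_delimiting(2)[OF 3(1)]
        by (simp add: cfg_def rel_initial nth_append length_self_delimiting nat_add_distrib nat_mult_distrib del: rel.simps)
      then show ?thesis
        using True i3[OF 3(1)] 3 by simp
    next
      case 4
      then have "rel (cfg ?y 0) 0 (int j - int ?b) = 1"
        using y nth_self_delimiting(3)[of x]
        by (simp add: cfg_def rel_initial nth_append length_self_delimiting nat_mult_distrib del: rel.simps)
      then show ?thesis
        using True i5 4 by simp
    next
      case (5 i)
      have r: "rel (cfg ?y 0) 0 (int j - int ?b) = (if i < m then if a (kind 0 2, 0, base + i) then 2 else 1 else 0)"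
      proof -
        have "nat (int j - int ?b) = 2 * length x + 1 + i" "0 \<le> int j - int ?b"
          "int j - int ?b < int (length ?y) \<longleftrightarrow> i < m"
          using 5 y by (auto simp: base_def)
        moreover have "?y ! (2 * length x + 1 + i) = w ! i"
          by (simp add: nth_append length_self_delimiting)
        ultimately show ?thesis
          unfolding cfg_def funpow_0 rel_initial(1) by (auto simp: w_def)
      qed
      then show ?thesis
        using True 5 i6[of i] m_less[of i] m_ge[of i] by (cases "i < m") auto
    qed
  qed
  have run: "a (kind k (rel (cfg ?y n) k (int j - int ?b)), n, j)"
    if "n \<le> T x" "k \<le> K" "n \<le> j" "j + n \<le> 2 * ?b" for n k j
    using that
  proof (induction n arbitrary: k j)
    case 0
    then show ?case using init by (simp add: width_def del: rel.simps)
  next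
    case (Suc n)
    define c where "c = scanned (cfg ?y n)"
    have c: "c \<in> set combos"
      unfolding c_def by (rule scanned_in_combos[OF valid_cfg])
    obtain v m where vm: "local_act c k = (v, m)" by fastforce
    have j: "0 < j" "j < 2 * ?b" "n < width x" "j < width x" "n < T x"
      using Suc.prems T_bound[of x] by (auto simp: width_def)
    have heads: "a (kind k' (c ! k'), n, ?b)" if "k' \<le> K" for k'
      using Suc.IH[of k' ?b] that Suc.prems T_bound[of x] by (simp add: c_def del: rel.simps)
    let ?j = "aval x (env n j) (shifted m)"
    have sh: "int ?j = int j + offset m"
      by (rule aval_shifted[OF j(1)])
    have off: "- 1 \<le> offset m" "offset m \<le> 1"
      by (cases m; simp)+
    have step: "rel (cfg ?y (Suc n)) k (int j - int ?b) = (if ?j = ?b then v else rel (cfg ?y n) k (int ?j - int ?b))"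
      using rel_step[where c = "cfg ?y n" and k = k and g = "\<lambda>_. []" and i = "int j - int ?b", OF valid_cfg Suc.prems(2)] sh
      by (auto simp: cfg_Suc vm c_def[symmetric] simp del: rel.simps) (metis add_diff_eq diff_add_eq)+
    show ?case
    proof (cases "?j = ?b")
      case True
      have "\<exists>l\<in>set (snd (write_schema c k)). a (atom x n j l) = fst l"
        by (rule sat[OF _ j(3,4), of "fst (write_schema c k)"])
          (use schemas_mem(1)[OF c Suc.prems(2)] True j in \<open>auto simp: write_schema_def vm aval_inner\<close>)
      then show ?thesis
        using heads True step by (auto simp: write_schema_def vm less_Suc_eq_le simp del: upt_Suc rel.simps)
    next
      case False
      let ?s = "rel (cfg ?y n) k (int ?j - int ?b)"
      have s: "?s < G"
        by (rule rel_less[OF valid_cfg])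
      have "a (kind k ?s, n, ?j)"
        using Suc.IH[of k ?j] Suc.prems sh off by (simp del: rel.simps)
      moreover have "\<exists>l\<in>set (snd (copy_schema c k ?s)). a (atom x n j l) = fst l"
        by (rule sat[OF _ j(3,4), of "fst (copy_schema c k ?s)"])
          (use schemas_mem(2)[OF c Suc.prems(2) s] False j in \<open>auto simp: copy_schema_def vm aval_inner simp del: rel.simps\<close>)
      ultimately show ?thesis
        using heads False step by (auto simp: copy_schema_def vm less_Suc_eq_le simp del: upt_Suc rel.simps)
    qed
  qed
  have "a (kind 1 (rel (cfg ?y (T x)) 1 0), T x, ?b)"
    using run[of "T x" 1 ?b] three_tapes T_bound[of x] by (simp del: rel.simps)
  then have "?y \<in> C"
    using i8 rel_final[OF w(1)] by (auto simp del: rel.simps split: if_splits)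
  then show thesis
    using that w(1) by blast
qed

end

text \<open>The schemas \<open>cs\<close> and the number \<open>A\<close> of kinds are fixed for the
  language; the input enters through \<open>Z\<close> and the evaluation of the expressions. This
  uniformity lets one printing program serve all inputs.\<close>

theorem NP_schemas:
  assumes "L \<in> class_NP"
  obtains cs A Ze Z where "\<And>x \<rho>. aval x \<rho> Ze = Z x" "\<And>x. 1 \<le> Z x" "1 \<le> A"
    "\<And>x cl. cl \<in> set cs \<Longrightarrow> well_formed x (Z x) A cl"
    "\<And>x. x \<in> L \<longleftrightarrow> (\<exists>a. satisfies x (Z x) cs a)"
proof -
  obtain C p where C: "C \<in> class_P"
    and L: "\<And>x. x \<in> L \<longleftrightarrow> (\<exists>w. length w \<le> poly p (length x) \<and> self_delimiting x @ w \<in> C)"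
    using assms unfolding class_NP_def by auto
  obtain M q where M: "turing_machine M" "query M = None"
    "\<And>y. outputs_within M (\<lambda>_. []) y (poly q (length y)) [y \<in> C]"
    using C unfolding class_P_def poly_time_computable_def by auto
  define P where "P x = poly p (length x)" for x :: word
  define T where "T x = poly q (length x + length x + 1 + P x)" for x :: word
  obtain Pe where Pe: "\<forall>x \<rho>. aval x \<rho> Pe = poly p (aval x \<rho> Len)"
    using ex_poly_aexp by blast
  obtain Te where Te: "\<forall>x \<rho>. aval x \<rho> Te = poly q (aval x \<rho> (Add (Add (Add Len Len) (Cst 1)) Pe))"
    using ex_poly_aexp by blast
  interpret tableau M C Pe Te P T
  proof
    fix x w :: word
    assume w: "length w \<le> P x"
    let ?y = "self_delimiting x @ w"
    have "poly q (length ?y) \<le> T x"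
      unfolding T_def using w by (intro poly_nat_mono) (simp add: length_self_delimiting)
    then show "outputs_within M (\<lambda>_. []) ?y (T x) [?y \<in> C]"
      by (rule outputs_within_mono[OF M(3)])
  qed (use M Pe Te in \<open>simp_all add: P_def T_def\<close>)
  have "x \<in> L \<longleftrightarrow> (\<exists>a. satisfies x (width x) schemas a)" for x
    using run_satisfies[of _ x] satisfies_run[of x] L[of x] unfolding P_def by metis
  moreover have "1 \<le> width x" for x
    by (simp add: width_def)
  moreover have "1 \<le> Suc K * G"
    using symbols_less by (simp add: Suc_le_eq)
  ultimately show thesis
    using that[of Ze width "Suc K * G" schemas] well_formed_schemas by (meson aval_exps(4))
qed

section \<open>Expected hitting times\<close>

text \<open>The probability that a walk from \<open>v\<close> avoids \<open>A\<close> at times 1 to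
  t. Time 0 is left out, so the recursion has no case distinction on \<open>v\<close>.\<close>

primrec survive :: "(nat \<Rightarrow> nat pmf) \<Rightarrow> nat set \<Rightarrow> nat \<Rightarrow> nat \<Rightarrow> ennreal" where
  "survive K A 0 v = 1"
| "survive K A (Suc t) v = (\<integral>\<^sup>+w. indicator (- A) w * survive K A t w \<partial>measure_pmf (K v))"

text \<open>The pathwise form of the tail-sum formula for the mean of a time; on a trajectory that
  never hits \<open>A\<close> both sides are infinite.\<close>

lemma hitting_time_suminf:
  "hitting_time A \<omega> = (\<Sum>t. indicator {\<omega>. \<forall>i<Suc t. \<omega> i \<notin> A} \<omega>)"
proof (cases "\<exists>t. \<omega> t \<in> A")
  case False
  have "indicator {\<omega>. \<forall>i<Suc t. \<omega> i \<notin> A} \<omega> = (1 :: ennreal)" for t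
    using False by simp
  moreover have "(\<Sum>t. 1 :: ennreal) = \<top>"
    unfolding suminf_eq_SUP by (simp add: ennreal_SUP_of_nat_eq_top)
  ultimately show ?thesis
    using False by (simp add: hitting_time_def)
next
  case True
  define m where "m = (LEAST t. \<omega> t \<in> A)"
  have m: "\<omega> m \<in> A"
    unfolding m_def by (rule LeastI_ex[OF True])
  have less_m: "\<omega> t \<notin> A" if "t < m" for t
    using not_less_Least[OF that[unfolded m_def]] .
  have "(\<Sum>t. indicator {\<omega>. \<forall>i<Suc t. \<omega> i \<notin> A} \<omega> :: ennreal) = (\<Sum>t<m. indicator {\<omega>. \<forall>i<Suc t. \<omega> i \<notin> A} \<omega>)"
  proof (rule suminf_finite)
    fix n assume "n \<notin> {..<m}"
    then have "m < Suc n"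
      by simp
    with m have "\<not> (\<forall>i<Suc n. \<omega> i \<notin> A)"
      by blast
    then show "indicator {\<omega>. \<forall>i<Suc n. \<omega> i \<notin> A} \<omega> = (0 :: ennreal)"
      by simp
  qed simp
  also have "\<dots> = (\<Sum>t<m. 1)"
    using less_m by (intro sum.cong refl) (simp add: less_Suc_eq_le)
  also have "\<dots> = of_nat m"
    by simp
  finally have s: "(\<Sum>t. indicator {\<omega>. \<forall>i<Suc t. \<omega> i \<notin> A} \<omega> :: ennreal) = of_nat m" .
  have "hitting_time A \<omega> = of_nat m"
    unfolding hitting_time_def
  proof (rule antisym)
    show "(INF t\<in>{t. \<omega> t \<in> A}. of_nat t) \<le> (of_nat m :: ennreal)"
      using m by (intro INF_lower) simp
    show "(of_nat m :: ennreal) \<le> (INF t\<in>{t. \<omega> t \<in> A}. of_nat t)"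
    proof (rule INF_greatest)
      fix t assume "t \<in> {t. \<omega> t \<in> A}"
      then have "m \<le> t"
        unfolding m_def by (intro Least_le) simp
      then show "(of_nat m :: ennreal) \<le> of_nat t"
        by simp
    qed
  qed
  then show ?thesis
    using s by simp
qed

section \<open>From the law of trajectories to survival probabilities\<close>

context random_walk
begin

abbreviation "S \<equiv> \<lambda>_ :: nat. count_space (UNIV :: nat set)"

lemma undefined_space [simp]: "(\<lambda>x. undefined) \<in> space (PiM {0..<0} S)"
  by (simp add: space_PiM)

lemma avoid_measurable [measurable]:
  "(\<lambda>\<omega>. (\<Prod>i<n. indicator (- A) (\<omega> i)) * h (\<omega> t)) \<in> borel_measurable (PiM {0..<Suc m} S)"
  if "n \<le> Suc m" "t \<le> m" for h :: "nat \<Rightarrow> ennreal"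
proof -
  have c: "(\<lambda>\<omega>. \<omega> i) \<in> measurable (PiM {0..<Suc m} S) (count_space UNIV)" if "i \<le> m" for i
    by (rule measurable_component_singleton) (use that in simp)
  have f: "(\<lambda>\<omega>. f (\<omega> i)) \<in> borel_measurable (PiM {0..<Suc m} S)" if "i \<le> m" for i and f :: "nat \<Rightarrow> ennreal"
    using c[OF that] by (rule measurable_compose) simp
  show ?thesis
    using that by (intro borel_measurable_times_ennreal borel_measurable_prod_ennreal f) auto
qed

text \<open>Integrating out the last coordinate replaces \<open>h\<close> by its image under the
  backward operator of the walk killed in \<open>A\<close>; therefore the induction is over
  arbitrary \<open>h\<close>.\<close>

lemma avoid_C:
  fixes h :: "nat \<Rightarrow> ennreal"
  shows "(\<integral>\<^sup>+\<omega>. (\<Prod>i<Suc t. indicator (- A) (\<omega> i)) * h (\<omega> t) \<partial>IT.C 0 (Suc t) (\<lambda>x. undefined)) =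
    indicator (- A) u * (((\<lambda>h v. \<integral>\<^sup>+w. indicator (- A) w * h w \<partial>measure_pmf (K v)) ^^ t) h) u"
proof (induction t arbitrary: h)
  case 0
  have "(\<integral>\<^sup>+\<omega>. (\<Prod>i<Suc 0. indicator (- A) (\<omega> i)) * h (\<omega> 0) \<partial>IT.C 0 (Suc 0) (\<lambda>x. undefined)) =
     (\<integral>\<^sup>+\<omega>. (\<Prod>i<Suc 0. indicator (- A) (\<omega> i)) * h (\<omega> 0) \<partial>IT.eP 0 (\<lambda>x. undefined))"
    by (simp only: IT.C.simps add_0 bind_return[OF IT.measurable_eP undefined_space])
  also have "\<dots> = (\<integral>\<^sup>+x. indicator (- A) x * h x \<partial>kernel 0 (\<lambda>x. undefined))"
    by (subst IT.nn_integral_eP) (use avoid_measurable[of 1 0 0] in simp_all)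
  also have "\<dots> = indicator (- A) u * h u"
    by (simp add: kernel_def)
  finally show ?case
    by (simp only: funpow.simps id_apply)
next
  case (Suc t)
  let ?B = "\<lambda>h v. \<integral>\<^sup>+w. indicator (- A) w * h w \<partial>measure_pmf (K v)"
  let ?f = "\<lambda>\<omega>. (\<Prod>i<Suc (Suc t). indicator (- A) (\<omega> i)) * h (\<omega> (Suc t))"
  have f: "?f \<in> borel_measurable (PiM {0..<Suc (Suc t)} S)"
    by (rule avoid_measurable) auto
  have "(\<integral>\<^sup>+\<omega>. ?f \<omega> \<partial>IT.C 0 (Suc (Suc t)) (\<lambda>x. undefined)) =
    (\<integral>\<^sup>+\<omega>. (\<integral>\<^sup>+\<omega>. ?f \<omega> \<partial>IT.eP (Suc t) \<omega>) \<partial>IT.C 0 (Suc t) (\<lambda>x. undefined))"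
    unfolding IT.C.simps(2)[of 0 "Suc t"] add_0
    using f IT.measurable_eP[of "Suc t"]
    by (subst nn_integral_bind[where B = "PiM {0..<Suc (Suc t)} S"])
       (simp_all add: measurable_cong_sets[OF IT.sets_C[OF undefined_space] refl] del: IT.C.simps)
  also have "\<dots> = (\<integral>\<^sup>+\<omega>. (\<Prod>i<Suc t. indicator (- A) (\<omega> i)) * ?B h (\<omega> t) \<partial>IT.C 0 (Suc t) (\<lambda>x. undefined))"
  proof (rule nn_integral_cong)
    fix \<omega> assume "\<omega> \<in> space (IT.C 0 (Suc t) (\<lambda>x. undefined))"
    then have \<omega>: "\<omega> \<in> space (PiM {0..<Suc t} S)"
      using IT.space_C[OF undefined_space, of "Suc t"] by simp
    have "(\<integral>\<^sup>+\<omega>. ?f \<omega> \<partial>IT.eP (Suc t) \<omega>) = (\<integral>\<^sup>+x. ?f (fun_upd \<omega> (Suc t) x) \<partial>kernel (Suc t) \<omega>)"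
      by (rule IT.nn_integral_eP[OF \<omega> f])
    also have "\<dots> = (\<integral>\<^sup>+x. (\<Prod>i<Suc t. indicator (- A) (\<omega> i)) * (indicator (- A) x * h x) \<partial>measure_pmf (K (\<omega> t)))"
    proof -
      have "(\<Prod>i<Suc t. indicator (- A) (fun_upd \<omega> (Suc t) x i)) = (\<Prod>i<Suc t. indicator (- A) (\<omega> i) :: ennreal)" for x
        by (rule prod.cong) auto
      then show ?thesis
        by (simp only: kernel_def nat.case prod.lessThan_Suc[of _ "Suc t"] fun_upd_same mult.assoc)
    qed
    also have "\<dots> = (\<Prod>i<Suc t. indicator (- A) (\<omega> i)) * ?B h (\<omega> t)"
      by (rule nn_integral_cmult) simp
    finally show "(\<integral>\<^sup>+\<omega>. ?f \<omega> \<partial>IT.eP (Suc t) \<omega>) = (\<Prod>i<Suc t. indicator (- A) (\<omega> i)) * ?B h (\<omega> t)" .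
  qed
  also have "\<dots> = indicator (- A) u * ((?B ^^ Suc t) h) u"
    using Suc.IH[of "?B h"] by (simp only: funpow_Suc_right o_apply)
  finally show ?case .
qed

lemma funpow_survive: "((\<lambda>h v. \<integral>\<^sup>+w. indicator (- A) w * h w \<partial>measure_pmf (K v)) ^^ t) (\<lambda>_. 1) = survive K A t"
  by (induction t) (auto simp: fun_eq_iff)

text \<open>The event depends on the first \<open>Suc t\<close> coordinates only, so it is a
  cylinder, and the limit measure agrees there with the finite-dimensional law.\<close>

lemma emeasure_avoid:
  "emeasure trajectories {\<omega>. \<forall>i<Suc t. \<omega> i \<notin> A} = indicator (- A) u * survive K A t u"
  "{\<omega>. \<forall>i<Suc t. \<omega> i \<notin> A} \<in> sets trajectories"
proof -
  let ?J = "{0..<Suc t}"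
  define X where "X = {\<omega> \<in> space (PiM ?J S). \<forall>i<Suc t. \<omega> i \<notin> A}"
  have X: "X \<in> sets (PiM ?J S)"
  proof -
    have "{\<omega> \<in> space (PiM ?J S). \<omega> i \<notin> A} \<in> sets (PiM ?J S)" if "i < Suc t" for i
      using measurable_sets[OF measurable_component_singleton[of i ?J S], of "- A"] that
      by (simp add: vimage_def Int_def conj_commute)
    then have "(\<Inter>i\<in>{..<Suc t}. {\<omega> \<in> space (PiM ?J S). \<omega> i \<notin> A}) \<in> sets (PiM ?J S)"
      by (intro sets.finite_INT) auto
    also have "(\<Inter>i\<in>{..<Suc t}. {\<omega> \<in> space (PiM ?J S). \<omega> i \<notin> A}) = X"
      by (auto simp: X_def)
    finally show ?thesis .
  qed
  have emb: "{\<omega>. \<forall>i<Suc t. \<omega> i \<notin> A} = IT.PF.emb UNIV ?J X"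
    by (auto simp: prod_emb_def X_def space_PiM PiE_iff)
  have "IT.PF.emb UNIV ?J X \<in> sets (PiM UNIV S)"
    using X by (intro sets_PiM_I measurable_prod_emb) auto
  then show "{\<omega>. \<forall>i<Suc t. \<omega> i \<notin> A} \<in> sets trajectories"
    unfolding emb trajectories_def by simp
  have "emeasure trajectories {\<omega>. \<forall>i<Suc t. \<omega> i \<notin> A} = emeasure (IT.CI ?J) X"
    unfolding emb trajectories_def by (rule IT.lim[OF _ X]) simp
  also have "\<dots> = emeasure (IT.C 0 (Suc t) (\<lambda>_. undefined)) (IT.PF.emb ?J ?J X)"
    by (rule IT.emeasure_CI[OF order_refl X])
  also have "IT.PF.emb ?J ?J X = X"
    using sets.sets_into_space[OF X] by (intro prod_emb_id) (simp add: space_PiM)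
  also have "emeasure (IT.C 0 (Suc t) (\<lambda>_. undefined)) X =
      (\<integral>\<^sup>+\<omega>. indicator X \<omega> \<partial>IT.C 0 (Suc t) (\<lambda>_. undefined))"
    using X IT.sets_C[OF undefined_space, of "Suc t"] by (subst nn_integral_indicator) (simp_all del: IT.C.simps)
  also have "\<dots> = (\<integral>\<^sup>+\<omega>. (\<Prod>i<Suc t. indicator (- A) (\<omega> i)) * (\<lambda>_. 1) (\<omega> t) \<partial>IT.C 0 (Suc t) (\<lambda>x. undefined))"
  proof (rule nn_integral_cong)
    fix \<omega> assume "\<omega> \<in> space (IT.C 0 (Suc t) (\<lambda>x. undefined))"
    then have "\<omega> \<in> space (PiM ?J S)"
      using IT.space_C[OF undefined_space, of "Suc t"] by simp
    then have \<omega>: "\<omega> \<in> X \<longleftrightarrow> (\<forall>i<Suc t. \<omega> i \<notin> A)"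
      by (simp add: X_def)
    show "indicator X \<omega> = (\<Prod>i<Suc t. indicator (- A) (\<omega> i)) * (\<lambda>_. 1 :: ennreal) (\<omega> t)"
    proof (cases "\<omega> \<in> X")
      case True
      then have "(\<Prod>i<Suc t. indicator (- A) (\<omega> i)) = (1 :: ennreal)"
        using \<omega> by (intro prod.neutral) simp
      then show ?thesis
        using True by simp
    next
      case False
      then obtain i where "i < Suc t" "\<omega> i \<in> A"
        using \<omega> by blast
      then have "(\<Prod>i<Suc t. indicator (- A) (\<omega> i)) = (0 :: ennreal)"
        by (intro prod_zero bexI[of _ i]) auto
      then show ?thesis
        using False by simp
    qed
  qed
  also have "\<dots> = indicator (- A) u * survive K A t u"
    using avoid_C[where A = A and h = "\<lambda>_. 1" and t = t] by (simp only: funpow_survive)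
  finally show "emeasure trajectories {\<omega>. \<forall>i<Suc t. \<omega> i \<notin> A} = indicator (- A) u * survive K A t u" .
qed

lemma expected_hitting_time:
  assumes "u \<notin> A"
  shows "(\<integral>\<^sup>+\<omega>. hitting_time A \<omega> \<partial>trajectories) = (\<Sum>t. survive K A t u)"
proof -
  have "(\<integral>\<^sup>+\<omega>. hitting_time A \<omega> \<partial>trajectories) = (\<Sum>t. \<integral>\<^sup>+\<omega>. indicator {\<omega>. \<forall>i<Suc t. \<omega> i \<notin> A} \<omega> \<partial>trajectories)"
    unfolding hitting_time_suminf using emeasure_avoid(2) by (intro nn_integral_suminf) simp
  also have "\<dots> = (\<Sum>t. survive K A t u)"
    using assms by (simp add: emeasure_avoid nn_integral_indicator)
  finally show ?thesis .
qed

end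

text \<open>First-step analysis, carried out with extended nonnegative values and hence free of
  finiteness assumptions.\<close>

lemma suminf_survive:
  "(\<Sum>t. survive K A t u) = 1 + (\<integral>\<^sup>+w. indicator (- A) w * (\<Sum>t. survive K A t w) \<partial>measure_pmf (K u))"
proof -
  have "(\<Sum>t. survive K A t u) = survive K A 0 u + (\<Sum>t. survive K A (Suc t) u)"
    using suminf_offset[of "\<lambda>t. survive K A t u" 1] by simp
  also have "(\<Sum>t. survive K A (Suc t) u) = (\<integral>\<^sup>+w. (\<Sum>t. indicator (- A) w * survive K A t w) \<partial>measure_pmf (K u))"
    by (simp del: ennreal_suminf_cmult add: nn_integral_suminf)
  also have "\<dots> = (\<integral>\<^sup>+w. indicator (- A) w * (\<Sum>t. survive K A t w) \<partial>measure_pmf (K u))"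
    by simp
  finally show ?thesis
    by simp
qed

section \<open>Walks on recommendation graphs\<close>

lemma rank_in_nth:
  assumes "distinct xs" "r < length xs"
  shows "rank_in xs (xs ! r) = Suc r"
  unfolding rank_in_def
proof (rule the_equality)
  fix i assume i: "1 \<le> i \<and> i \<le> length xs \<and> xs ! (i - 1) = xs ! r"
  then have "i - 1 = r"
    using assms nth_eq_iff_index_eq[of xs "i - 1" r] by auto
  then show "i = Suc r"
    using i by linarith
qed (use assms in auto)

definition ranked :: "rewiring_instance \<Rightarrow> nat list \<Rightarrow> bool" where
  "ranked I xs \<longleftrightarrow> distinct xs \<and> length xs = length (rank_probs I) \<and>
     (\<forall>q\<in>set (rank_probs I). 0 \<le> q) \<and> sum_list (rank_probs I) = 1"

text \<open>\<open>embed_pmf\<close> has the prescribed weights if these are nonnegative and sum to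
  1, which is what \<open>ranked\<close> supplies.\<close>

lemma nn_integral_transition:
  fixes h :: "nat \<Rightarrow> ennreal"
  assumes "ranked I (\<Gamma> u)"
  shows "(\<integral>\<^sup>+w. h w \<partial>measure_pmf (embed_pmf (transition I \<Gamma> u))) =
    (\<Sum>r<length (rank_probs I). ennreal (of_rat (rank_probs I ! r)) * h (\<Gamma> u ! r))"
proof -
  let ?d = "length (rank_probs I)"
  have d: "distinct (\<Gamma> u)" "length (\<Gamma> u) = ?d"
    and f: "\<And>r. r < ?d \<Longrightarrow> 0 \<le> rank_probs I ! r" "sum_list (rank_probs I) = 1"
    using assms by (auto simp: ranked_def)
  have nth: "transition I \<Gamma> u (\<Gamma> u ! r) = of_rat (rank_probs I ! r)" if "r < ?d" for r
    using that d by (simp add: transition_def rank_in_nth)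
  have nonneg: "0 \<le> transition I \<Gamma> u v" for v
  proof (cases "v \<in> set (\<Gamma> u)")
    case True
    then obtain r where "r < ?d" "v = \<Gamma> u ! r"
      using d by (auto simp: in_set_conv_nth)
    then show ?thesis
      using nth f by simp
  qed (simp add: transition_def)
  have bij: "bij_betw ((!) (\<Gamma> u)) {..<?d} (set (\<Gamma> u))"
    using d by (intro bij_betw_nth) simp_all
  have count: "(\<integral>\<^sup>+v. ennreal (transition I \<Gamma> u v) * g v \<partial>count_space UNIV) =
      (\<Sum>r<?d. ennreal (of_rat (rank_probs I ! r)) * g (\<Gamma> u ! r))" for g :: "nat \<Rightarrow> ennreal"
  proof -
    have "(\<integral>\<^sup>+v. ennreal (transition I \<Gamma> u v) * g v \<partial>count_space UNIV) =
        (\<Sum>v\<in>set (\<Gamma> u). ennreal (transition I \<Gamma> u v) * g v)"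
      by (rule nn_integral_count_space') (auto simp: transition_def)
    also have "\<dots> = (\<Sum>r<?d. ennreal (transition I \<Gamma> u (\<Gamma> u ! r)) * g (\<Gamma> u ! r))"
      by (rule sum.reindex_bij_betw[OF bij, symmetric])
    finally show ?thesis
      using nth by simp
  qed
  have "(\<Sum>r<?d. of_rat (rank_probs I ! r) :: real) = of_rat (sum_list (rank_probs I))"
    by (simp add: sum_list_sum_nth of_rat_sum atLeast0LessThan)
  moreover have "(\<Sum>r<?d. ennreal (of_rat (rank_probs I ! r))) = ennreal (\<Sum>r<?d. of_rat (rank_probs I ! r))"
    using f by (intro sum_ennreal) simp
  ultimately have "(\<integral>\<^sup>+v. ennreal (transition I \<Gamma> u v) \<partial>count_space UNIV) = 1"
    using count[of "\<lambda>_. 1"] f by simp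
  then have "pmf (embed_pmf (transition I \<Gamma> u)) v = transition I \<Gamma> u v" for v
    using nonneg by (intro pmf_embed_pmf) auto
  then show ?thesis
    by (simp add: nn_integral_measure_pmf count)
qed

definition hit_mean :: "rewiring_instance \<Rightarrow> recommendations \<Rightarrow> nat \<Rightarrow> ennreal" where
  "hit_mean I \<Gamma> u = (\<Sum>t. survive (\<lambda>x. embed_pmf (transition I \<Gamma> x)) (neutral_items I) t u)"

lemma segregation_score_eq: "u \<notin> neutral_items I \<Longrightarrow> segregation_score I \<Gamma> u = hit_mean I \<Gamma> u"
  unfolding segregation_score_def hit_mean_def by (rule random_walk.expected_hitting_time)

lemma hit_mean_step:
  assumes "ranked I (\<Gamma> u)"
  shows "hit_mean I \<Gamma> u = 1 + (\<Sum>r<length (rank_probs I). ennreal (of_rat (rank_probs I ! r)) *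
     (if \<Gamma> u ! r \<in> neutral_items I then 0 else hit_mean I \<Gamma> (\<Gamma> u ! r)))"
  unfolding hit_mean_def
  by (subst suminf_survive, subst nn_integral_transition[of I \<Gamma> u, OF assms])
     (auto intro!: sum.cong simp: indicator_def)

text \<open>The equation of \<open>hit_mean_step\<close> alone does not exclude the value \<open>\<infinity>\<close>, so the
  geometric series is summed.\<close>

lemma hit_mean_loop:
  assumes r: "ranked I (\<Gamma> u)" and u: "u \<notin> neutral_items I" "\<Gamma> u ! 0 = u"
    and n: "\<And>r. 0 < r \<Longrightarrow> r < length (rank_probs I) \<Longrightarrow> \<Gamma> u ! r \<in> neutral_items I"
    and p: "rank_probs I ! 0 < 1" "rank_probs I \<noteq> []"
  shows "hit_mean I \<Gamma> u = ennreal (1 / (1 - of_rat (rank_probs I ! 0)))"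
proof -
  let ?p = "of_rat (rank_probs I ! 0) :: real"
  have p': "0 \<le> ?p" "?p < 1"
    using p r by (auto simp: ranked_def)
  have "survive (\<lambda>x. embed_pmf (transition I \<Gamma> x)) (neutral_items I) t u = ennreal (?p ^ t)" for t
  proof (induction t)
    case (Suc t)
    have "(\<Sum>r<length (rank_probs I). ennreal (of_rat (rank_probs I ! r)) *
        (indicator (- neutral_items I) (\<Gamma> u ! r) * survive (\<lambda>x. embed_pmf (transition I \<Gamma> x)) (neutral_items I) t (\<Gamma> u ! r))) =
      (\<Sum>r\<in>{0}. ennreal (of_rat (rank_probs I ! r)) *
        (indicator (- neutral_items I) (\<Gamma> u ! r) * survive (\<lambda>x. embed_pmf (transition I \<Gamma> x)) (neutral_items I) t (\<Gamma> u ! r)))"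
      using n p by (intro sum.mono_neutral_right) auto
    also have "\<dots> = ennreal (?p ^ Suc t)"
      using u p' by (simp add: Suc.IH ennreal_mult)
    finally show ?case
      using nn_integral_transition[of I \<Gamma> u, OF r] by simp
  qed simp
  then have "hit_mean I \<Gamma> u = (\<Sum>t. ennreal (?p ^ t))"
    by (simp add: hit_mean_def)
  also have "\<dots> = ennreal (1 / (1 - ?p))"
    using p' by (subst suminf_ennreal2) (auto simp: suminf_geometric summable_geometric)
  finally show ?thesis .
qed

section \<open>The rewiring instance of a family of clauses\<close>

text \<open>Items come in finitely many types, each with a copy for every pair of coordinates; copies
  without a purpose are neutral. All harmful items except clauses have a loop at rank 1 and otherwise
  point to neutral items. A clause points to its literals, which are padded with items of its own so
  that an operation on a pad is of no use to any other clause, and at the last rank to the hub.\<close>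

datatype item_type = Hub | Neutral nat | Literal nat bool | Clause nat | Pad nat nat

definition item_types :: "nat \<Rightarrow> nat \<Rightarrow> nat \<Rightarrow> item_type list" where
  "item_types W A n = Hub # map Neutral [0..<Suc W] @
     concat (map (\<lambda>\<kappa>. [Literal \<kappa> False, Literal \<kappa> True]) [0..<A]) @
     map Clause [0..<n] @ concat (map (\<lambda>c. map (Pad c) [0..<W]) [0..<n])"

lemma set_item_types:
  "\<tau> \<in> set (item_types W A n) \<longleftrightarrow> (case \<tau> of Hub \<Rightarrow> True | Neutral r \<Rightarrow> r \<le> W | Literal \<kappa> b \<Rightarrow> \<kappa> < A
     | Clause c \<Rightarrow> c < n | Pad c r \<Rightarrow> c < n \<and> r < W)"
  unfolding item_types_def
  by (cases \<tau>) (auto simp: image_iff less_Suc_eq_le simp del: upt_Suc)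

lemma distinct_item_types: "distinct (item_types W A n)"
proof -
  have "distinct (concat (map (\<lambda>\<kappa>. [Literal \<kappa> False, Literal \<kappa> True]) [0..<A]))"
    by (induction A) auto
  moreover have "distinct (concat (map (\<lambda>c. map (Pad c) [0..<W]) [0..<n]))"
    by (induction n) (auto simp: distinct_map inj_on_def)
  ultimately show ?thesis
    by (auto simp: item_types_def distinct_map inj_on_def simp del: upt_Suc)
qed

definition code :: "item_type list \<Rightarrow> item_type \<Rightarrow> nat" where
  "code ts \<tau> = length (takeWhile (\<lambda>\<sigma>. \<sigma> \<noteq> \<tau>) ts)"

lemma code_less: "\<tau> \<in> set ts \<Longrightarrow> code ts \<tau> < length ts"
  unfolding code_def by (induction ts) auto

lemma nth_code: "\<tau> \<in> set ts \<Longrightarrow> ts ! code ts \<tau> = \<tau>"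
  unfolding code_def by (induction ts) auto

lemma code_nth: "distinct ts \<Longrightarrow> i < length ts \<Longrightarrow> code ts (ts ! i) = i"
  using nth_eq_iff_index_eq code_less nth_code nth_mem by metis

text \<open>The scores: the entry at index i of the list gets 1 / (r + i + 1), everything else 0.
  Strictly decreasing positive values make the list the unique top ranking.\<close>

fun pick :: "nat \<Rightarrow> nat list \<Rightarrow> nat \<Rightarrow> rat" where
  "pick r [] v = 0"
| "pick r (y # ys) v = (if v = y then 1 / of_nat (Suc r) else pick (Suc r) ys v)"

lemma pick_nth: "distinct ys \<Longrightarrow> i < length ys \<Longrightarrow> pick r ys (ys ! i) = 1 / of_nat (Suc (r + i))"
proof (induction ys arbitrary: r i)
  case (Cons y ys)
  then show ?case by (cases i) (auto dest: nth_mem)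
qed simp

lemma pick_notin: "v \<notin> set ys \<Longrightarrow> pick r ys v = 0"
  by (induction ys arbitrary: r) auto

lemma pick_range: "0 \<le> pick r ys v" "pick r ys v \<le> 1"
  by (induction ys arbitrary: r) (auto simp: field_simps)

lemma pick_pos: "v \<in> set ys \<Longrightarrow> 0 < pick r ys v"
  by (induction ys arbitrary: r) (auto simp: add_pos_nonneg)

text \<open>\<open>W\<close> bounds the lengths of clauses and leaves room for the two literals of a
  pair; lists have \<open>Suc W\<close> entries, the last slot of a clause being reserved for the
  hub. \<open>m\<close> is the ratio between the probabilities of the first \<open>W\<close> ranks
  and of the last one.\<close>

locale gadget =
  fixes cs0 :: "schema list" and A W m Z :: nat and x :: word
  assumes wf: "\<And>cl. cl \<in> set cs0 \<Longrightarrow> well_formed x Z A cl"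
    and W: "2 \<le> W" "\<And>cl. cl \<in> set cs0 \<Longrightarrow> length (snd cl) \<le> W"
    and pos: "1 \<le> A" "1 \<le> Z" "1 \<le> m"
begin

text \<open>Logically the appended clauses are tautologies. As items, they demand an operation for
  every variable.\<close>

definition cs :: "schema list" where
  "cs = cs0 @ map (\<lambda>\<kappa>. (Cst 1, [(True, \<kappa>, Var 0, Var 1), (False, \<kappa>, Var 0, Var 1)])) [0..<A]"

abbreviation "ts \<equiv> item_types W A (length cs)"

definition size :: nat where "size = length ts * Z * Z"

definition num :: "item_type \<Rightarrow> nat \<Rightarrow> nat \<Rightarrow> nat" where
  "num \<tau> t j = (code ts \<tau> * Z + t) * Z + j"

definition type_of :: "nat \<Rightarrow> item_type" where "type_of u = ts ! (u div Z div Z)"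

definition active :: "nat \<Rightarrow> nat \<Rightarrow> nat \<Rightarrow> bool" where
  "active c t j \<longleftrightarrow> aval x (env t j) (fst (cs ! c)) \<noteq> 0"

abbreviation "lits c \<equiv> snd (cs ! c)"

definition lit_num :: "nat \<Rightarrow> nat \<Rightarrow> lit \<Rightarrow> nat" where
  "lit_num t j l = (case atom x t j l of (\<kappa>, t', j') \<Rightarrow> num (Literal \<kappa> (fst l)) t' j')"

fun harm :: "item_type \<Rightarrow> nat \<Rightarrow> nat \<Rightarrow> bool" where
  "harm Hub t j = (t = 0 \<and> j = 0)"
| "harm (Neutral r) t j = False"
| "harm (Literal \<kappa> b) t j = True"
| "harm (Clause c) t j = active c t j"
| "harm (Pad c r) t j = (active c t j \<and> length (lits c) \<le> r)"

fun is_clause :: "item_type \<Rightarrow> bool" where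
  "is_clause (Clause c) = True"
| "is_clause _ = False"

text \<open>A loop item lists the neutral items 0 to W - 1 behind itself, which leaves
  \<open>Neutral W\<close> free as the target of a rewiring.\<close>

fun nb :: "item_type \<Rightarrow> nat \<Rightarrow> nat \<Rightarrow> nat \<Rightarrow> nat" where
  "nb \<tau> t j r = (if \<not> harm \<tau> t j then num (Neutral r) 0 0 else case \<tau> of
     Clause c \<Rightarrow> if r < length (lits c) then lit_num t j (lits c ! r)
       else if r < W then num (Pad c r) t j else num Hub 0 0
   | _ \<Rightarrow> if r = 0 then num \<tau> t j else num (Neutral (r - 1)) 0 0)"

declare nb.simps [simp del]

definition top_list :: "nat \<Rightarrow> nat list" where
  "top_list u = map (nb (type_of u) (u div Z mod Z) (u mod Z)) [0..<Suc W]"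

text \<open>The weights m / (W m + 1), taken W times, and 1 / (W m + 1) sum to 1. The threshold
  comes from the fact that a list whose loop was cut keeps a DCG of at least 1/6, while no original
  DCG exceeds W + 1.\<close>

definition inst :: rewiring_instance where
  "inst = \<lparr>harmful = map (\<lambda>u. harm (type_of u) (u div Z mod Z) (u mod Z)) [0..<size],
     scores = map (\<lambda>u. map (pick 0 (top_list u)) [0..<size]) [0..<size],
     rank_probs = replicate W (of_nat m / of_nat (W * m + 1)) @ [1 / of_nat (W * m + 1)],
     budget = A * Z * Z, threshold = 1 / of_nat (6 * Suc W)\<rparr>"

section \<open>Numbering of the items\<close>

lemma num_less: "\<tau> \<in> set ts \<Longrightarrow> t < Z \<Longrightarrow> j < Z \<Longrightarrow> num \<tau> t j < size"
proof -
  assume *: "\<tau> \<in> set ts" "t < Z" "j < Z"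
  have "code ts \<tau> * Z + t < Suc (code ts \<tau>) * Z"
    using * by simp
  also have "\<dots> \<le> length ts * Z"
    using code_less[OF *(1)] by (intro mult_right_mono) simp_all
  finally have "Suc (code ts \<tau> * Z + t) * Z \<le> length ts * Z * Z"
    by (intro mult_right_mono) simp_all
  then show ?thesis
    using *(3) by (simp add: num_def size_def)
qed

lemma num_dec:
  assumes "\<tau> \<in> set ts" "t < Z" "j < Z"
  shows "type_of (num \<tau> t j) = \<tau>" "num \<tau> t j div Z mod Z = t" "num \<tau> t j mod Z = j"
proof -
  have "num \<tau> t j div Z = code ts \<tau> * Z + t"
    unfolding num_def by (rule div_mod_add(1)[OF assms(3)])
  then show "num \<tau> t j div Z mod Z = t" "type_of (num \<tau> t j) = \<tau>"
    using div_mod_add[OF assms(2), of "code ts \<tau>"] nth_code[OF assms(1)] by (simp_all add: type_of_def)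
  show "num \<tau> t j mod Z = j"
    unfolding num_def by (rule div_mod_add(2)[OF assms(3)])
qed

lemma num_inject:
  assumes "\<tau> \<in> set ts" "t < Z" "j < Z" "\<tau>' \<in> set ts" "t' < Z" "j' < Z"
  shows "num \<tau> t j = num \<tau>' t' j' \<longleftrightarrow> \<tau> = \<tau>' \<and> t = t' \<and> j = j'"
  using num_dec[OF assms(1-3)] num_dec[OF assms(4-6)] by metis

lemma dec_num:
  assumes "u < size"
  shows "type_of u \<in> set ts" "u div Z mod Z < Z" "u mod Z < Z" "num (type_of u) (u div Z mod Z) (u mod Z) = u"
proof -
  have "u div Z < length ts * Z"
    using assms unfolding size_def by (rule less_mult_imp_div_less)
  then have *: "u div Z div Z < length ts"
    by (rule less_mult_imp_div_less)
  then show "type_of u \<in> set ts"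
    by (simp add: type_of_def)
  show "u div Z mod Z < Z" "u mod Z < Z"
    using pos by simp_all
  show "num (type_of u) (u div Z mod Z) (u mod Z) = u"
    unfolding num_def type_of_def code_nth[OF distinct_item_types *] by simp
qed

lemma items_cases:
  assumes "u < size"
  obtains \<tau> t j where "u = num \<tau> t j" "\<tau> \<in> set ts" "t < Z" "j < Z"
  using dec_num[OF assms] that by metis

lemma items_inst [simp]: "items inst = {..<size}"
  by (simp add: items_def inst_def)

lemma harmful_num:
  assumes "\<tau> \<in> set ts" "t < Z" "j < Z"
  shows "num \<tau> t j \<in> harmful_items inst \<longleftrightarrow> harm \<tau> t j" "num \<tau> t j \<in> neutral_items inst \<longleftrightarrow> \<not> harm \<tau> t j"
  using num_less[OF assms] num_dec[OF assms]
  by (auto simp: harmful_items_def neutral_items_def) (simp_all add: inst_def)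

lemma top_list_num:
  assumes "\<tau> \<in> set ts" "t < Z" "j < Z"
  shows "top_list (num \<tau> t j) = map (nb \<tau> t j) [0..<Suc W]"
  using num_dec[OF assms] by (simp add: top_list_def)

lemma length_top_list [simp]: "length (top_list u) = Suc W"
  by (simp add: top_list_def)

lemma zero_less_Z: "0 < Z"
  using pos by simp

lemma in_ts [simp]:
  "Hub \<in> set ts" "Neutral r \<in> set ts \<longleftrightarrow> r \<le> W" "Literal \<kappa> b \<in> set ts \<longleftrightarrow> \<kappa> < A"
  "Clause c \<in> set ts \<longleftrightarrow> c < length cs" "Pad c r \<in> set ts \<longleftrightarrow> c < length cs \<and> r < W"
  by (simp_all add: set_item_types)

text \<open>\<open>Hub\<close> heads the list of types in order that the hub gets the one number
  that is recognised by its first encoded bit.\<close>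

lemma num_Hub: "num Hub 0 0 = 0"
  by (simp add: num_def code_def item_types_def)

lemma wf_cs:
  assumes "c < length cs"
  shows "well_formed x Z A (cs ! c)" "length (lits c) \<le> W"
proof -
  have "cl \<in> set cs \<Longrightarrow> well_formed x Z A cl \<and> length (snd cl) \<le> W" for cl
    unfolding cs_def set_append Un_iff
  proof (elim disjE)
    assume "cl \<in> set cs0"
    then show ?thesis
      using wf W(2) by blast
  next
    assume "cl \<in> set (map (\<lambda>\<kappa>. (Cst 1, [(True, \<kappa>, Var 0, Var 1), (False, \<kappa>, Var 0, Var 1)])) [0..<A])"
    then show ?thesis
      using W(1) by (auto simp: well_formed_def)
  qed
  from this[of "cs ! c"] assms have "well_formed x Z A (cs ! c) \<and> length (lits c) \<le> W"
    by simp
  then show "well_formed x Z A (cs ! c)" "length (lits c) \<le> W"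
    by simp_all
qed

lemma lit_cases:
  assumes "c < length cs" "active c t j" "t < Z" "j < Z" "l \<in> set (lits c)"
  obtains \<kappa> t' j' where "atom x t j l = (\<kappa>, t', j')" "\<kappa> < A" "t' < Z" "j' < Z"
    "lit_num t j l = num (Literal \<kappa> (fst l)) t' j'"
proof -
  have "atom x t j l \<in> {..<A} \<times> {..<Z} \<times> {..<Z}"
    using wf_cs(1)[OF assms(1)] assms(2-) by (auto simp: well_formed_def active_def split: prod.splits)
  then show thesis
    using that by (auto simp: lit_num_def)
qed

lemma nb_clause:
  assumes c: "c < length cs" "active c t j" "t < Z" "j < Z" and r: "r \<le> W"
  obtains (lit) \<kappa> t' j' where "r < length (lits c)" "atom x t j (lits c ! r) = (\<kappa>, t', j')" "\<kappa> < A" "t' < Z" "j' < Z"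
      "nb (Clause c) t j r = num (Literal \<kappa> (fst (lits c ! r))) t' j'"
    | (pad) "length (lits c) \<le> r" "r < W" "nb (Clause c) t j r = num (Pad c r) t j"
    | (hub) "r = W" "nb (Clause c) t j r = num Hub 0 0"
proof -
  consider "r < length (lits c)" | "length (lits c) \<le> r" "r < W" | "r = W" "\<not> r < length (lits c)"
    using r wf_cs(2)[OF c(1)] by linarith
  then show thesis
  proof cases
    case 1
    then have "lits c ! r \<in> set (lits c)" by simp
    from lit_cases[OF c this] obtain \<kappa> t' j' where
      "atom x t j (lits c ! r) = (\<kappa>, t', j')" "\<kappa> < A" "t' < Z" "j' < Z"
      "lit_num t j (lits c ! r) = num (Literal \<kappa> (fst (lits c ! r))) t' j'" by metis
    then show thesis
      using lit[OF 1] c(2) 1 by (simp add: nb.simps)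
  next
    case 2
    then show thesis using pad c(2) by (simp add: nb.simps)
  next
    case 3
    then show thesis using hub c(2) by (simp add: nb.simps)
  qed
qed

lemma nb_loop:
  assumes "harm \<tau> t j" "\<not> is_clause \<tau>"
  shows "nb \<tau> t j r = (if r = 0 then num \<tau> t j else num (Neutral (r - 1)) 0 0)"
  using assms by (cases \<tau>) (simp_all add: nb.simps)

lemma nb_neutral: "\<not> harm \<tau> t j \<Longrightarrow> nb \<tau> t j r = num (Neutral r) 0 0"
  by (simp add: nb.simps)

lemma nb_less:
  assumes "\<tau> \<in> set ts" "t < Z" "j < Z" "r \<le> W"
  shows "nb \<tau> t j r < size"
proof (cases "harm \<tau> t j")
  case False
  then show ?thesis
    using assms zero_less_Z by (simp add: nb_neutral num_less)
next
  case h: True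
  show ?thesis
  proof (cases \<tau>)
    case (Clause c)
    then have c: "c < length cs" "active c t j"
      using assms h by simp_all
    show ?thesis
      unfolding Clause using assms(2-4)
      by (cases rule: nb_clause[OF c assms(2-4)]) (use c zero_less_Z in \<open>simp_all add: num_less\<close>)
  qed (use assms h zero_less_Z in \<open>simp_all add: nb_loop num_less\<close>)
qed

lemma nb_inj:
  assumes "\<tau> \<in> set ts" "t < Z" "j < Z" "r \<le> W" "r' \<le> W" "nb \<tau> t j r = nb \<tau> t j r'"
  shows "r = r'"
proof (cases "harm \<tau> t j")
  case False
  then show ?thesis
    using assms zero_less_Z by (simp add: nb_neutral num_inject)
next
  case h: True
  show ?thesis
  proof (cases "is_clause \<tau>")
    case False
    have "num \<tau> t j \<noteq> num (Neutral i) 0 0" if "i \<le> W" for i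
      using that h assms zero_less_Z by (cases \<tau>) (auto simp: num_inject)
    from this[of "r - 1"] this[of "r' - 1"] show ?thesis
      using assms zero_less_Z h False by (auto simp: nb_loop num_inject split: if_splits)
  next
    case True
    then obtain c where \<tau>: "\<tau> = Clause c"
      by (cases \<tau>) auto
    then have c: "c < length cs" "active c t j"
      using assms h by simp_all
    have d: "distinct (map (\<lambda>l. (fst l, atom x t j l)) (lits c))"
      using wf_cs(1)[OF c(1)] c(2) assms(2,3) by (auto simp: well_formed_def active_def split: prod.splits)
    have eq: "nb (Clause c) t j r = nb (Clause c) t j r'"
      using assms(6) by (simp add: \<tau>)
    show ?thesis
    proof (cases rule: nb_clause[OF c assms(2-4)])
      case l: (1 \<kappa> t' j')
      show ?thesis
      proof (cases rule: nb_clause[OF c assms(2,3,5)])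
        case l': (1 \<kappa>' t'' j'')
        have "(fst (lits c ! r), atom x t j (lits c ! r)) = (fst (lits c ! r'), atom x t j (lits c ! r'))"
          using l l' eq by (auto simp: num_inject)
        then show ?thesis
          using nth_eq_iff_index_eq[OF d, of r r'] l(1) l'(1) by simp
      qed (use l eq c assms zero_less_Z in \<open>auto simp: num_inject\<close>)
    next
      case p: 2
      show ?thesis
        by (cases rule: nb_clause[OF c assms(2,3,5)])
          (use p eq c assms zero_less_Z in \<open>auto simp: num_inject\<close>)
    next
      case q: 3
      show ?thesis
        by (cases rule: nb_clause[OF c assms(2,3,5)])
          (use q eq c assms zero_less_Z in \<open>auto simp: num_inject\<close>)
    qed
  qed
qed

lemma top_list_props:
  assumes "u < size"
  shows "distinct (top_list u)" "set (top_list u) \<subseteq> {..<size}"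
proof -
  obtain \<tau> t j where u: "u = num \<tau> t j" "\<tau> \<in> set ts" "t < Z" "j < Z"
    using items_cases[OF assms] .
  show "distinct (top_list u)"
    unfolding u(1) top_list_num[OF u(2-)] distinct_map
    using nb_inj[OF u(2-)] by (auto simp: inj_on_def less_Suc_eq_le simp del: upt_Suc)
  show "set (top_list u) \<subseteq> {..<size}"
    unfolding u(1) top_list_num[OF u(2-)] using nb_less[OF u(2-)] by (auto simp: less_Suc_eq_le simp del: upt_Suc)
qed

section \<open>Scores and the original lists\<close>

lemma score_inst: "u < size \<Longrightarrow> v < size \<Longrightarrow> score inst u v = pick 0 (top_list u) v"
  by (simp add: score_def inst_def)

lemma list_length_inst [simp]: "list_length inst = Suc W"
  by (simp add: list_length_def inst_def)

lemma top_ranking_top_list: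
  assumes u: "u < size"
  shows "top_ranking inst u xs \<longleftrightarrow> xs = top_list u"
proof
  note L = top_list_props[OF u]
  have sc: "score inst u (top_list u ! i) = 1 / of_nat (Suc i)" if "i < Suc W" for i
    using that subsetD[OF L(2) nth_mem, of i] pick_nth[OF L(1), of i 0] u by (simp add: score_inst)
  have sc0: "score inst u v = 0" if "v < size" "v \<notin> set (top_list u)" for v
    using that u by (simp add: score_inst pick_notin)
  have sc_pos: "0 < score inst u v" if "v \<in> set (top_list u)" for v
    using that u L(2) by (subst score_inst) (auto simp: pick_pos)
  {
    assume "xs = top_list u"
    moreover have "sorted_wrt (\<lambda>v w. score inst u w \<le> score inst u v) (top_list u)"
      unfolding sorted_wrt_iff_nth_less using sc by (auto simp: frac_le)
    ultimately show "top_ranking inst u xs"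
      unfolding top_ranking_def using L sc0 sc_pos by (force intro: less_imp_le)
  next
    assume t: "top_ranking inst u xs"
    then have xs: "length xs = Suc W" "distinct xs" "set xs \<subseteq> {..<size}"
      "sorted_wrt (\<lambda>v w. score inst u w \<le> score inst u v) xs"
      "\<And>v w. v \<in> set xs \<Longrightarrow> w < size \<Longrightarrow> w \<notin> set xs \<Longrightarrow> score inst u w \<le> score inst u v"
      by (auto simp: top_ranking_def)
    have card: "card (set xs) = card (set (top_list u))"
      using xs L by (simp add: distinct_card)
    have sub: "set (top_list u) \<subseteq> set xs"
    proof (rule ccontr)
      assume "\<not> set (top_list u) \<subseteq> set xs"
      then obtain v where v: "v \<in> set (top_list u)" "v \<notin> set xs"
        by blast
      have "\<not> set xs \<subseteq> set (top_list u)"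
        using card_subset_eq[of "set (top_list u)" "set xs"] card v by auto
      then obtain w where w: "w \<in> set xs" "w \<notin> set (top_list u)"
        by blast
      have "score inst u v \<le> score inst u w"
        using v w L xs by (intro xs(5)) auto
      moreover have "score inst u w = 0"
        using w xs(3) by (intro sc0) auto
      ultimately show False
        using sc_pos[OF v(1)] by simp
    qed
    then have set: "set xs = set (top_list u)"
      using card card_subset_eq[of "set xs" "set (top_list u)"] by auto
    show "xs = top_list u"
    proof (rule map_sorted_distinct_set_unique[where f = "\<lambda>v. - score inst u v"])
      show "inj_on (\<lambda>v. - score inst u v) (set xs \<union> set (top_list u))"
        using sc by (auto simp: set inj_on_def in_set_conv_nth)
      show "sorted (map (\<lambda>v. - score inst u v) xs)"
        using xs(4) by (simp add: sorted_map)
      show "sorted (map (\<lambda>v. - score inst u v) (top_list u))"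
        unfolding sorted_iff_nth_mono_less using sc by (auto simp: frac_le)
      show "distinct (map (\<lambda>v. - score inst u v) xs)" "distinct (map (\<lambda>v. - score inst u v) (top_list u))"
        using sc xs(2) L(1) by (auto simp: distinct_map set inj_on_def in_set_conv_nth)
    qed (rule set)
  }
qed

lemma original_inst: "u < size \<Longrightarrow> original inst u = top_list u"
  by (simp add: original_def top_ranking_top_list)


section \<open>Mean hitting times before and after rewiring\<close>

definition p :: real where "p = real m / real (W * m + 1)"
definition e :: real where "e = 1 / real (W * m + 1)"
text \<open>The mean time to leave an item with an intact loop of probability p, by the geometric
  series; a cut loop takes time 1.\<close>

definition \<zeta> :: real where "\<zeta> = 1 / (1 - p)"

lemma weights_sum: "D = w * n + 1 \<Longrightarrow> D \<noteq> 0 \<Longrightarrow> w * (n / D) + 1 / D = (1 :: 'a :: field)"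
  by (simp add: field_simps)

lemma p_e: "0 < e" "p = real m * e" "real W * p + e = 1" "e \<le> p" "p < 1 / 2"
proof -
  have q: "0 < real (W * m + 1)"
    by (simp only: of_nat_0_less_iff)
  show "0 < e" "p = real m * e"
    using q by (simp_all add: e_def p_def del: of_nat_Suc of_nat_add of_nat_mult)
  show s: "real W * p + e = 1"
    unfolding p_def e_def by (rule weights_sum) (use q in simp_all)
  show "e \<le> p"
    using pos(3) q by (simp add: e_def p_def divide_right_mono del: of_nat_Suc of_nat_add of_nat_mult)
  have "0 < p"
    using \<open>e \<le> p\<close> \<open>0 < e\<close> by simp
  then have "2 * p \<le> real W * p"
    using W(1) by (intro mult_right_mono) simp_all
  then show "p < 1 / 2"
    using s \<open>0 < e\<close> by simp
qed

lemma \<zeta>_bounds: "1 < \<zeta>" "\<zeta> < 2"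
proof -
  have "0 < p" "p < 1 / 2"
    using p_e by linarith+
  then show "1 < \<zeta>" "\<zeta> < 2"
    by (simp_all add: \<zeta>_def field_simps)
qed

lemma rank_probs_inst: "length (rank_probs inst) = Suc W"
  "r \<le> W \<Longrightarrow> of_rat (rank_probs inst ! r) = (if r < W then p else e)"
  by (auto simp: inst_def nth_append p_def e_def of_rat_divide of_rat_add of_rat_mult)

lemma rank_probs_rat:
  "\<forall>q\<in>set (rank_probs inst). 0 \<le> q" "sum_list (rank_probs inst) = 1" "sorted_wrt (\<ge>) (rank_probs inst)"
proof -
  let ?d = "of_nat (W * m + 1) :: rat"
  have d: "0 < ?d"
    by (simp only: of_nat_0_less_iff)
  show "\<forall>q\<in>set (rank_probs inst). 0 \<le> q"
    using d by (auto simp: inst_def simp del: of_nat_add of_nat_mult)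
  have "of_nat W * (of_nat m / ?d) + 1 / ?d = 1"
    by (rule weights_sum) (use d in simp_all)
  then show "sum_list (rank_probs inst) = 1"
    by (simp add: inst_def sum_list_replicate)
  have "1 / ?d \<le> of_nat m / ?d"
    using d pos(3) by (intro divide_right_mono) simp_all
  moreover have "sorted_wrt (\<ge>) (replicate n (q :: rat))" for n q
    by (induction n) auto
  ultimately show "sorted_wrt (\<ge>) (rank_probs inst)"
    by (simp add: inst_def sorted_wrt_append)
qed

lemma ranked_inst: "ranked inst xs \<longleftrightarrow> distinct xs \<and> length xs = Suc W"
  using rank_probs_rat rank_probs_inst by (auto simp: ranked_def)

lemma transition_pos:
  assumes "u < size" "r \<le> W"
  shows "0 < transition inst (original inst) u (top_list u ! r)"
  using assms top_list_props(1)[OF assms(1)] p_e rank_probs_inst(2)[OF assms(2)]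
  by (simp add: transition_def original_inst rank_in_nth)

lemma valid_inst: "valid_instance inst"
proof -
  let ?E = "{(a, b). a \<in> items inst \<and> 0 < transition inst (original inst) a b}"
  have edge: "(num \<tau> t j, nb \<tau> t j r) \<in> ?E" if "\<tau> \<in> set ts" "t < Z" "j < Z" "r \<le> W" for \<tau> t j r
    using transition_pos[OF num_less[OF that(1-3)] that(4)] num_less[OF that(1-3)] that(4)
    by (simp add: top_list_num[OF that(1-3)] nth_map_upt[of r "Suc W" 0] del: upt_Suc)
  have N: "num (Neutral 0) 0 0 \<in> neutral_items inst"
    using zero_less_Z by (simp add: harmful_num)
  have loop: "(num \<tau> t j, num (Neutral 0) 0 0) \<in> ?E" if "\<tau> \<in> set ts" "t < Z" "j < Z" "harm \<tau> t j" "\<not> is_clause \<tau>" for \<tau> t j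
    using edge[OF that(1-3), of 1] W(1) by (simp add: nb_loop[OF that(4,5)])
  have reach: "\<exists>v\<in>neutral_items inst. (u, v) \<in> ?E\<^sup>*" if u: "u \<in> harmful_items inst" for u
  proof -
    have "u < size"
      using u by (simp add: harmful_items_def)
    then obtain \<tau> t j where n: "u = num \<tau> t j" "\<tau> \<in> set ts" "t < Z" "j < Z"
      by (rule items_cases)
    have h: "harm \<tau> t j"
      using u n harmful_num(1)[of \<tau> t j] by simp
    show ?thesis
    proof (cases "is_clause \<tau>")
      case False
      show ?thesis
        using r_into_rtrancl[OF loop[OF n(2-4) h False, folded n(1)]] N by blast
    next
      case True
      then obtain c where \<tau>: "\<tau> = Clause c" by (cases \<tau>) auto
      \<comment> \<open>A clause reaches a neutral item through the hub, whose edge has positive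
        probability.\<close>
      have "nb \<tau> t j W = num Hub 0 0"
        using h wf_cs(2)[of c] n(2) by (simp add: nb.simps \<tau>)
      then have "(u, num Hub 0 0) \<in> ?E"
        using edge[OF n(2-4), of W] n(1) by simp
      moreover have "(num Hub 0 0, num (Neutral 0) 0 0) \<in> ?E"
        using zero_less_Z by (intro loop) simp_all
      ultimately have "(u, num (Neutral 0) 0 0) \<in> ?E\<^sup>*"
        by (meson converse_rtrancl_into_rtrancl r_into_rtrancl)
      then show ?thesis
        using N by blast
    qed
  qed
  have "1 \<le> budget inst"
    using pos by (simp add: inst_def)
  moreover have "set r \<subseteq> {0..1} \<and> length r = size" if "r \<in> set (scores inst)" for r
    using that pick_range by (auto simp: inst_def)
  moreover have "0 < threshold inst" "threshold inst < 1" "length (scores inst) = size" "length (harmful inst) = size"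
    by (simp_all add: inst_def)
  ultimately show ?thesis
    unfolding valid_instance_def using rank_probs_rat reach top_ranking_top_list by auto
qed

definition op_at :: "(nat \<times> nat \<times> nat) set \<Rightarrow> nat \<Rightarrow> bool" where
  "op_at O1 u \<longleftrightarrow> (\<exists>v w. (u, v, w) \<in> O1)"

lemma rewiring_unique:
  assumes "rewiring_set I O1" "(u, v, w) \<in> O1" "(u, v', w') \<in> O1"
  shows "v = v' \<longleftrightarrow> w = w'"
  using assms(1)[unfolded rewiring_set_def, THEN conjunct2, rule_format, OF conjI, OF assms(2,3)] .

lemma rewired_nth:
  assumes O: "rewiring_set inst O1" and u: "u < size" and r: "r \<le> W"
  shows "(\<exists>w. (u, top_list u ! r, w) \<in> O1) \<Longrightarrow> (u, top_list u ! r, rewired inst O1 u ! r) \<in> O1"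
    "\<not> (\<exists>w. (u, top_list u ! r, w) \<in> O1) \<Longrightarrow> rewired inst O1 u ! r = top_list u ! r"
proof -
  assume "\<exists>w. (u, top_list u ! r, w) \<in> O1"
  then obtain w where w: "(u, top_list u ! r, w) \<in> O1"
    by blast
  have "(THE w. (u, top_list u ! r, w) \<in> O1) = w"
  proof (rule the_equality)
    show "(u, top_list u ! r, w) \<in> O1"
      by (rule w)
    show "w' = w" if "(u, top_list u ! r, w') \<in> O1" for w'
      using rewiring_unique[OF O that w] by simp
  qed
  then have "rewired inst O1 u ! r = w"
    using u r w by (auto simp: rewired_def original_inst)
  then show "(u, top_list u ! r, rewired inst O1 u ! r) \<in> O1"
    using w by simp
next
  assume "\<not> (\<exists>w. (u, top_list u ! r, w) \<in> O1)"
  then show "rewired inst O1 u ! r = top_list u ! r"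
    using u r by (auto simp: rewired_def original_inst)
qed

lemma operation_inst:
  assumes "rewiring_set inst O1" "(u, v, w) \<in> O1"
  shows "u < size" "u \<in> harmful_items inst" "v \<in> harmful_items inst" "w \<in> neutral_items inst"
    "v \<in> set (top_list u)" "w \<notin> set (top_list u)"
proof -
  have *: "rewiring_operation inst (u, v, w)"
    using assms(1)[unfolded rewiring_set_def, THEN conjunct1] assms(2) by (rule bspec)
  then show u: "u < size"
    by (simp add: rewiring_operation_def harmful_items_def)
  show "u \<in> harmful_items inst" "v \<in> harmful_items inst" "w \<in> neutral_items inst"
    "v \<in> set (top_list u)" "w \<notin> set (top_list u)"
    using * original_inst[OF u] by (simp_all add: rewiring_operation_def)
qed

lemma distinct_rewired:
  assumes O: "rewiring_set inst O1" and u: "u < size"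
  shows "distinct (rewired inst O1 u)" "length (rewired inst O1 u) = Suc W"
proof -
  show len: "length (rewired inst O1 u) = Suc W"
    by (simp add: rewired_def original_inst[OF u])
  let ?x = "\<lambda>r. top_list u ! r" and ?y = "\<lambda>r. rewired inst O1 u ! r"
  have inj: "r = r'" if rr: "r < Suc W" "r' < Suc W" and eq: "?y r = ?y r'" for r r'
  proof -
    have x: "?x r = ?x r' \<Longrightarrow> r = r'"
      using rr nth_eq_iff_index_eq[OF top_list_props(1)[OF u], of r r'] by simp
    have mem: "?x r \<in> set (top_list u)" "?x r' \<in> set (top_list u)"
      using rr by simp_all
    have r: "r \<le> W" "r' \<le> W"
      using rr by simp_all
    note R = rewired_nth[OF O u r(1)] and R' = rewired_nth[OF O u r(2)]
    show ?thesis
    proof (cases "\<exists>w. (u, ?x r, w) \<in> O1")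
      case 1: True
      show ?thesis
      proof (cases "\<exists>w. (u, ?x r', w) \<in> O1")
        case True
        then have "?x r = ?x r'"
          using rewiring_unique[OF O R(1)[OF 1] R'(1)[OF True]] eq by simp
        then show ?thesis by (rule x)
      next
        case False
        then show ?thesis
          using operation_inst(6)[OF O R(1)[OF 1]] R'(2)[OF False] eq mem by simp
      qed
    next
      case 1: False
      show ?thesis
      proof (cases "\<exists>w. (u, ?x r', w) \<in> O1")
        case True
        then show ?thesis
          using operation_inst(6)[OF O R'(1)[OF True]] R(2)[OF 1] eq mem by simp
      next
        case False
        then show ?thesis
          using R(2)[OF 1] R'(2)[OF False] eq by (intro x) simp
      qed
    qed
  qed
  show "distinct (rewired inst O1 u)"
    unfolding distinct_conv_nth len
  proof (intro allI impI notI)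
    fix r r' assume "r < Suc W" "r' < Suc W" "r \<noteq> r'" "?y r = ?y r'"
    then show False
      using inj[of r r'] by simp
  qed
qed

lemma nth_top_list:
  assumes "\<tau> \<in> set ts" "t < Z" "j < Z" "r \<le> W"
  shows "top_list (num \<tau> t j) ! r = nb \<tau> t j r"
  using assms(4) by (simp add: top_list_num[OF assms(1-3)] nth_map_upt[of r "Suc W" 0] del: upt_Suc)

text \<open>All entries but the first are neutral, so an operation on such an item can only delete
  its loop. Afterwards every step leads to a neutral item.\<close>

lemma hit_mean_loop_inst:
  assumes O: "rewiring_set inst O1" and \<tau>: "\<tau> \<in> set ts" "t < Z" "j < Z" "harm \<tau> t j" "\<not> is_clause \<tau>"
  shows "hit_mean inst (rewired inst O1) (num \<tau> t j) = ennreal (if op_at O1 (num \<tau> t j) then 1 else \<zeta>)"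
proof -
  let ?u = "num \<tau> t j" and ?\<Gamma> = "rewired inst O1"
  have u: "?u < size" "?u \<in> harmful_items inst" "?u \<notin> neutral_items inst"
    using \<tau> by (simp_all add: num_less harmful_num)
  have rk: "ranked inst (?\<Gamma> ?u)"
    using distinct_rewired[OF O u(1)] by (simp add: ranked_inst)
  have nb0: "top_list ?u ! 0 = ?u"
    using nth_top_list[OF \<tau>(1-3), of 0] by (simp add: nb_loop[OF \<tau>(4,5)])
  have nbr: "top_list ?u ! r \<in> neutral_items inst" if "0 < r" "r \<le> W" for r
    using nth_top_list[OF \<tau>(1-3) that(2)] that zero_less_Z by (simp add: nb_loop[OF \<tau>(4,5)] harmful_num)
  have disj: "v \<in> neutral_items inst \<Longrightarrow> v \<notin> harmful_items inst" for v
    by (simp add: harmful_items_def neutral_items_def)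
  have rest: "?\<Gamma> ?u ! r \<in> neutral_items inst" if "0 < r" "r \<le> W" for r
    using rewired_nth[OF O u(1) that(2)] operation_inst(3)[OF O] nbr[OF that] disj by metis
  show ?thesis
  proof (cases "op_at O1 ?u")
    case True
    then obtain v w where vw: "(?u, v, w) \<in> O1"
      by (auto simp: op_at_def)
    then obtain r where r: "r < Suc W" "v = top_list ?u ! r"
      using operation_inst(5)[OF O vw] by (auto simp: in_set_conv_nth)
    then have "r = 0"
      using nbr[of r] operation_inst(3)[OF O vw] disj by (cases r) auto
    then have "\<exists>w. (?u, top_list ?u ! 0, w) \<in> O1"
      using vw r by blast
    from rewired_nth(1)[OF O u(1) _ this] have "?\<Gamma> ?u ! 0 \<in> neutral_items inst"
      using operation_inst(4)[OF O] by blast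
    then have "?\<Gamma> ?u ! r \<in> neutral_items inst" if "r < Suc W" for r
      using rest[of r] that by (cases r) auto
    then show ?thesis
      using hit_mean_step[of inst ?\<Gamma> ?u, OF rk] True by (simp add: rank_probs_inst)
  next
    case False
    then have "?\<Gamma> ?u ! 0 = ?u"
      using rewired_nth(2)[OF O u(1), of 0] nb0 by (auto simp: op_at_def)
    moreover have f0: "real_of_rat (rank_probs inst ! 0) = p"
      using rank_probs_inst(2)[of 0] W(1) by simp
    then have "real_of_rat (rank_probs inst ! 0) < 1"
      using p_e(5) by simp
    then have "rank_probs inst ! 0 < 1"
      by simp
    moreover have "rank_probs inst \<noteq> []"
      by (simp add: inst_def)
    ultimately show ?thesis
      using hit_mean_loop[of inst ?\<Gamma> ?u, OF rk u(3)] rest False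
      by (simp add: f0 \<zeta>_def rank_probs_inst less_Suc_eq_le)
  qed
qed

definition slot_value :: "(nat \<times> nat \<times> nat) set \<Rightarrow> nat \<Rightarrow> nat \<Rightarrow> real" where
  "slot_value O1 u r = (if \<exists>w. (u, top_list u ! r, w) \<in> O1 then 0
     else if op_at O1 (top_list u ! r) then 1 else \<zeta>)"

text \<open>Clauses point only to items with loops, never to clauses, and rewiring inserts only
  neutral targets; hence the means are explicit and no linear system has to be solved.\<close>

definition mean :: "(nat \<times> nat \<times> nat) set \<Rightarrow> nat \<Rightarrow> real" where
  "mean O1 u = (if is_clause (type_of u) then 1 + p * (\<Sum>r<W. slot_value O1 u r) + e * slot_value O1 u W
     else if op_at O1 u then 1 else \<zeta>)"

lemma slot_value_bounds: "0 \<le> slot_value O1 u r" "slot_value O1 u r \<le> \<zeta>"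
  using \<zeta>_bounds by (auto simp: slot_value_def)

lemma clause_slot:
  assumes "c < length cs" "active c t j" "t < Z" "j < Z" "r \<le> W"
  obtains \<tau> t' j' where "nb (Clause c) t j r = num \<tau> t' j'" "\<tau> \<in> set ts" "t' < Z" "j' < Z" "harm \<tau> t' j'" "\<not> is_clause \<tau>"
proof (cases rule: nb_clause[OF assms])
  case (1 \<kappa> t' j')
  then show thesis using that[of "Literal \<kappa> (fst (lits c ! r))" t' j'] by simp
next
  case 2
  then show thesis using that[of "Pad c r" t j] assms by simp
next
  case 3
  then show thesis using that[of Hub 0 0] zero_less_Z by simp
qed

lemma hit_mean_inst:
  assumes O: "rewiring_set inst O1" and u: "u \<in> harmful_items inst"
  shows "hit_mean inst (rewired inst O1) u = ennreal (mean O1 u)"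
proof -
  have us: "u < size"
    using u by (simp add: harmful_items_def)
  then obtain \<tau> t j where n: "u = num \<tau> t j" "\<tau> \<in> set ts" "t < Z" "j < Z"
    by (rule items_cases)
  have h: "harm \<tau> t j" and ty: "type_of u = \<tau>"
    using u n harmful_num(1)[of \<tau> t j] num_dec(1)[of \<tau> t j] by simp_all
  show ?thesis
  proof (cases "is_clause \<tau>")
    case False
    then show ?thesis
      using hit_mean_loop_inst[OF O n(2-4) h False] ty n(1) by (simp add: mean_def)
  next
    case True
    then obtain c where c: "\<tau> = Clause c" by (cases \<tau>) auto
    let ?\<Gamma> = "rewired inst O1"
    have rk: "ranked inst (?\<Gamma> u)"
      using distinct_rewired[OF O us] by (simp add: ranked_inst)
    have val: "(if ?\<Gamma> u ! r \<in> neutral_items inst then 0 else hit_mean inst ?\<Gamma> (?\<Gamma> u ! r)) = ennreal (slot_value O1 u r)"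
      if r: "r \<le> W" for r
    proof (cases "\<exists>w. (u, top_list u ! r, w) \<in> O1")
      case True
      then show ?thesis
        using rewired_nth(1)[OF O us r] operation_inst(4)[OF O] by (auto simp: slot_value_def)
    next
      case False
      have "nb \<tau> t j r = top_list u ! r"
        using nth_top_list[OF n(2-4) r] n(1) by simp
      moreover obtain \<tau>' t' j' where n': "nb (Clause c) t j r = num \<tau>' t' j'" "\<tau>' \<in> set ts" "t' < Z" "j' < Z" "harm \<tau>' t' j'" "\<not> is_clause \<tau>'"
        using clause_slot[of c t j r] h n r c by auto
      ultimately have "top_list u ! r = num \<tau>' t' j'"
        by (simp add: c)
      then show ?thesis
        using rewired_nth(2)[OF O us r False] harmful_num(2)[OF n'(2-4)] hit_mean_loop_inst[OF O n'(2-6)] n'(5) False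
        by (simp add: slot_value_def)
    qed
    have "hit_mean inst ?\<Gamma> u = 1 + (\<Sum>r<Suc W. ennreal (if r < W then p else e) * ennreal (slot_value O1 u r))"
      unfolding hit_mean_step[of inst ?\<Gamma> u, OF rk] rank_probs_inst(1)
      using val rank_probs_inst(2) by (intro arg_cong2[of _ _ _ _ "(+)"] refl sum.cong) (simp_all add: less_Suc_eq_le)
    also have "\<dots> = 1 + (\<Sum>r<Suc W. ennreal ((if r < W then p else e) * slot_value O1 u r))"
      using p_e slot_value_bounds by (simp add: ennreal_mult)
    also have "\<dots> = ennreal (1 + (\<Sum>r<Suc W. (if r < W then p else e) * slot_value O1 u r))"
      using p_e slot_value_bounds by (subst sum_ennreal) (auto simp: ennreal_plus sum_nonneg)
    also have "1 + (\<Sum>r<Suc W. (if r < W then p else e) * slot_value O1 u r) = mean O1 u"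
      using True ty by (simp add: mean_def sum_distrib_left)
    finally show ?thesis .
  qed
qed

lemma pair_schema: "\<kappa> < A \<Longrightarrow> length cs0 + \<kappa> < length cs \<and>
    cs ! (length cs0 + \<kappa>) = (Cst 1, [(True, \<kappa>, Var 0, Var 1), (False, \<kappa>, Var 0, Var 1)])"
  by (simp add: cs_def nth_append)

lemma pair_active: "\<kappa> < A \<Longrightarrow> active (length cs0 + \<kappa>) t j"
  by (simp add: active_def pair_schema)

lemma finite_harmful: "finite (harmful_items inst)"
  by (simp add: harmful_items_def)

lemma segregation_inst:
  assumes "rewiring_set inst O1"
  shows "segregation inst (rewired inst O1) = Max (mean O1 ` harmful_items inst)"
proof -
  let ?H = "harmful_items inst"
  have "num Hub 0 0 \<in> ?H"
    using zero_less_Z by (simp add: harmful_num)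
  then have H: "finite (mean O1 ` ?H)" "mean O1 ` ?H \<noteq> {}"
    using finite_harmful by auto
  have "segregation_score inst (rewired inst O1) ` ?H = ennreal ` (mean O1 ` ?H)"
    unfolding image_image
  proof (rule image_cong[OF refl])
    fix u assume u: "u \<in> ?H"
    then have "u \<notin> neutral_items inst"
      by (simp add: harmful_items_def neutral_items_def)
    then show "segregation_score inst (rewired inst O1) u = ennreal (mean O1 u)"
      using hit_mean_inst[OF assms u] by (simp add: segregation_score_eq)
  qed
  moreover have "Max (ennreal ` (mean O1 ` ?H)) = ennreal (Max (mean O1 ` ?H))"
    using H by (intro mono_Max_commute[symmetric] monoI ennreal_leI)
  moreover have "0 \<le> mean O1 u" for u
    using p_e slot_value_bounds \<zeta>_bounds by (auto simp: mean_def intro!: add_nonneg_nonneg mult_nonneg_nonneg sum_nonneg)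
  then have "0 \<le> Max (mean O1 ` ?H)"
    using H by (subst Max_ge_iff) auto
  ultimately show ?thesis
    by (simp add: segregation_def)
qed


section \<open>Hit and unhit clauses\<close>

definition clause_item :: "nat \<Rightarrow> nat \<Rightarrow> nat \<Rightarrow> bool" where
  "clause_item c t j \<longleftrightarrow> c < length cs \<and> active c t j \<and> t < Z \<and> j < Z"

lemma clause_item_harmful: "clause_item c t j \<Longrightarrow> num (Clause c) t j \<in> harmful_items inst"
  by (simp add: clause_item_def harmful_num)

lemma harmful_cases:
  assumes "u \<in> harmful_items inst"
  obtains (clause) c t j where "u = num (Clause c) t j" "clause_item c t j" "is_clause (type_of u)"
  | (loop) "\<not> is_clause (type_of u)"
proof (cases "is_clause (type_of u)")
  case True
  have "u < size"
    using assms by (simp add: harmful_items_def)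
  then obtain \<tau> t j where n: "u = num \<tau> t j" "\<tau> \<in> set ts" "t < Z" "j < Z"
    by (rule items_cases)
  moreover obtain c where "\<tau> = Clause c"
    using True n num_dec(1)[OF n(2-4)] by (cases \<tau>) auto
  ultimately show thesis
    using assms True harmful_num(1)[OF n(2-4)] by (intro clause[of c t j]) (simp_all add: clause_item_def)
qed (rule loop)

lemma mean_clause:
  assumes "clause_item c t j"
  shows "mean O1 (num (Clause c) t j) =
    1 + p * (\<Sum>r<W. slot_value O1 (num (Clause c) t j) r) + e * slot_value O1 (num (Clause c) t j) W"
  using assms by (simp add: mean_def num_dec clause_item_def)

lemma slot_value_clause:
  assumes "clause_item c t j" "r \<le> W"
  shows "slot_value O1 (num (Clause c) t j) r = (if \<exists>w. (num (Clause c) t j, nb (Clause c) t j r, w) \<in> O1 then 0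
     else if op_at O1 (nb (Clause c) t j r) then 1 else \<zeta>)"
  using assms by (simp add: slot_value_def nth_top_list clause_item_def)

lemma nb_hub: "clause_item c t j \<Longrightarrow> nb (Clause c) t j W = 0"
  using wf_cs(2)[of c] by (simp add: nb.simps clause_item_def num_Hub)

text \<open>As the weights sum to 1, this is the mean of a clause with nothing changed at it or at
  its successors.\<close>

lemma \<zeta>_split: "1 + \<zeta> = 1 + p * (real W * \<zeta>) + e * \<zeta>"
  using arg_cong[OF p_e(3), of "\<lambda>y. y * \<zeta>"] by (simp add: algebra_simps)

lemma sum_slots: "(\<Sum>r<W. slot_value O1 u r) \<le> real W * \<zeta>"
  using sum_mono[of "{..<W}" "slot_value O1 u" "\<lambda>_. \<zeta>"] slot_value_bounds(2) by simp

lemma mean_le: "mean O1 u \<le> 1 + \<zeta>"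
proof (cases "is_clause (type_of u)")
  case True
  have "p * (\<Sum>r<W. slot_value O1 u r) \<le> p * (real W * \<zeta>)" "e * slot_value O1 u W \<le> e * \<zeta>"
    using sum_slots slot_value_bounds p_e by (intro mult_left_mono; simp)+
  then show ?thesis
    using True \<zeta>_split by (simp add: mean_def)
qed (use \<zeta>_bounds in \<open>simp add: mean_def\<close>)

text \<open>An operation on the clause itself counts, whichever edge it deletes. An operation on the
  hub, its successor at index W, does not.\<close>

definition hit :: "(nat \<times> nat \<times> nat) set \<Rightarrow> nat \<Rightarrow> nat \<Rightarrow> nat \<Rightarrow> bool" where
  "hit O1 c t j \<longleftrightarrow> op_at O1 (num (Clause c) t j) \<or> (\<exists>r<W. op_at O1 (nb (Clause c) t j r))"

lemma unhit_sum:
  assumes c: "clause_item c t j" and "\<not> hit O1 c t j"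
  shows "(\<Sum>r<W. slot_value O1 (num (Clause c) t j) r) = real W * \<zeta>"
proof -
  have "slot_value O1 (num (Clause c) t j) r = \<zeta>" if "r < W" for r
    using slot_value_clause[OF c, of r O1] assms(2) that by (auto simp: hit_def op_at_def)
  then show ?thesis
    by simp
qed

text \<open>Since segregation is a maximum, one such clause caps the gain of the whole set: at e
  (\<zeta> - 1), and at 0 if there is no operation on the hub.\<close>

lemma unhit_mean:
  assumes c: "clause_item c t j" and "\<not> hit O1 c t j"
  shows "1 + \<zeta> - e * (\<zeta> - 1) \<le> mean O1 (num (Clause c) t j)"
    "\<not> op_at O1 0 \<Longrightarrow> 1 + \<zeta> \<le> mean O1 (num (Clause c) t j)"
proof -
  let ?s = "slot_value O1 (num (Clause c) t j) W"
  have s: "?s = (if op_at O1 0 then 1 else \<zeta>)"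
    using slot_value_clause[OF c order_refl, of O1] assms(2) by (auto simp: hit_def op_at_def nb_hub[OF c])
  have "e * 1 \<le> e * ?s"
    using s \<zeta>_bounds p_e by (intro mult_left_mono) auto
  then show "1 + \<zeta> - e * (\<zeta> - 1) \<le> mean O1 (num (Clause c) t j)"
    using \<zeta>_split unhit_sum[OF assms] mean_clause[OF c, of O1] by (simp add: algebra_simps)
  show "1 + \<zeta> \<le> mean O1 (num (Clause c) t j)" if "\<not> op_at O1 0"
    using \<zeta>_split unhit_sum[OF assms] mean_clause[OF c, of O1] s that by simp
qed

text \<open>Keeps the items with loops, whose mean is at most \<zeta>, below the bounds that are
  shown for clauses.\<close>

lemma loss_le_1: "p * (\<zeta> - 1) \<le> 1" "e * (\<zeta> - 1) \<le> 1"
proof -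
  have "p * (\<zeta> - 1) \<le> 1 * 1"
    using p_e \<zeta>_bounds by (intro mult_mono) simp_all
  then show "p * (\<zeta> - 1) \<le> 1"
    by simp
  moreover have "e * (\<zeta> - 1) \<le> p * (\<zeta> - 1)"
    using p_e \<zeta>_bounds by (intro mult_right_mono) simp_all
  ultimately show "e * (\<zeta> - 1) \<le> 1"
    by simp
qed

lemma hub_mean:
  assumes "op_at O1 0" "u \<in> harmful_items inst"
  shows "mean O1 u \<le> 1 + \<zeta> - e * (\<zeta> - 1)"
  using assms(2)
proof (cases rule: harmful_cases)
  case (clause c t j)
  have "slot_value O1 u W \<le> 1"
    using slot_value_clause[OF clause(2) order_refl, of O1] assms(1) by (simp add: clause(1) nb_hub[OF clause(2)])
  then have "e * slot_value O1 u W \<le> e * 1"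
    using p_e by (intro mult_left_mono) simp_all
  moreover have "p * (\<Sum>r<W. slot_value O1 u r) \<le> p * (real W * \<zeta>)"
    using sum_slots p_e by (intro mult_left_mono) simp_all
  ultimately show ?thesis
    using \<zeta>_split mean_clause[OF clause(2), of O1] by (simp add: clause(1) algebra_simps)
next
  case loop
  then show ?thesis
    using loss_le_1 \<zeta>_bounds by (simp add: mean_def)
qed

text \<open>One successor of weight p has its value lowered from \<zeta> to at most 1, which saves p
  (\<zeta> - 1).\<close>

lemma covered_mean:
  assumes "\<And>c t j. clause_item c t j \<Longrightarrow> \<exists>r<W. op_at O1 (nb (Clause c) t j r)" and "u \<in> harmful_items inst"
  shows "mean O1 u \<le> 1 + \<zeta> - p * (\<zeta> - 1)"
  using assms(2)
proof (cases rule: harmful_cases)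
  case (clause c t j)
  obtain r where r: "r < W" "op_at O1 (nb (Clause c) t j r)"
    using assms(1)[OF clause(2)] by blast
  then have "slot_value O1 u r \<le> 1"
    using slot_value_clause[OF clause(2), of r O1] by (simp add: clause(1))
  moreover have "(\<Sum>r\<in>{..<W} - {r}. slot_value O1 u r) \<le> real (W - 1) * \<zeta>"
    using sum_mono[of "{..<W} - {r}" "slot_value O1 u" "\<lambda>_. \<zeta>"] slot_value_bounds(2) r(1) by simp
  ultimately have "(\<Sum>r<W. slot_value O1 u r) \<le> real (W - 1) * \<zeta> + 1"
    using r(1) by (simp add: sum.remove[of "{..<W}" r])
  also have "\<dots> = real W * \<zeta> - (\<zeta> - 1)"
    using r(1) by (simp add: of_nat_diff algebra_simps)
  finally have "p * (\<Sum>r<W. slot_value O1 u r) \<le> p * (real W * \<zeta> - (\<zeta> - 1))"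
    using p_e by (intro mult_left_mono) simp_all
  moreover have "e * slot_value O1 u W \<le> e * \<zeta>"
    using slot_value_bounds p_e by (intro mult_left_mono) simp_all
  ultimately show ?thesis
    using \<zeta>_split mean_clause[OF clause(2), of O1] by (simp add: clause(1) algebra_simps)
next
  case loop
  then show ?thesis
    using loss_le_1 \<zeta>_bounds by (simp add: mean_def)
qed

lemma pair_item: "\<kappa> < A \<Longrightarrow> t < Z \<Longrightarrow> j < Z \<Longrightarrow> clause_item (length cs0 + \<kappa>) t j"
  by (simp add: clause_item_def pair_schema pair_active)

lemma rewired_empty: "rewired inst {} = original inst"
  by (simp add: rewired_def fun_eq_iff)

text \<open>Before rewiring, 1 + \<zeta> is an upper bound of all means and is attained at a pair
  clause.\<close>

lemma gain_inst:
  assumes "rewiring_set inst O1"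
  shows "gain inst O1 = 1 + \<zeta> - Max (mean O1 ` harmful_items inst)"
proof -
  let ?H = "harmful_items inst"
  have c: "clause_item (length cs0) 0 0"
    using pair_item[of 0 0 0] pos by simp
  have "\<not> hit {} (length cs0) 0 0"
    by (simp add: hit_def op_at_def)
  then have "1 + \<zeta> \<le> mean {} (num (Clause (length cs0)) 0 0)"
    using unhit_mean(2)[OF c] by (simp add: op_at_def)
  also have "\<dots> \<le> Max (mean {} ` ?H)"
    using clause_item_harmful[OF c] finite_harmful by (intro Max_ge) auto
  finally have "1 + \<zeta> \<le> Max (mean {} ` ?H)" .
  moreover have "Max (mean {} ` ?H) \<le> 1 + \<zeta>"
    using clause_item_harmful[OF c] finite_harmful mean_le by (intro Max.boundedI) auto
  ultimately have "Max (mean {} ` ?H) = 1 + \<zeta>"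
    by simp
  moreover have "rewiring_set inst {}"
    by (simp add: rewiring_set_def)
  ultimately show ?thesis
    using segregation_inst[OF assms] segregation_inst[of "{}"] by (simp add: gain_def rewired_empty)
qed

lemma gain_le:
  assumes "rewiring_set inst O1" "u \<in> harmful_items inst" "b \<le> mean O1 u"
  shows "gain inst O1 \<le> 1 + \<zeta> - b"
proof -
  have "b \<le> Max (mean O1 ` harmful_items inst)"
    using assms finite_harmful by (subst Max_ge_iff) auto
  then show ?thesis
    by (simp add: gain_inst[OF assms(1)])
qed

lemma gain_ge:
  assumes "rewiring_set inst O1" "\<And>u. u \<in> harmful_items inst \<Longrightarrow> mean O1 u \<le> b"
  shows "1 + \<zeta> - b \<le> gain inst O1"
proof -
  have "harmful_items inst \<noteq> {}"
    using clause_item_harmful[OF pair_item[of 0 0 0]] pos by auto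
  then have "Max (mean O1 ` harmful_items inst) \<le> b"
    using assms finite_harmful by (intro Max.boundedI) auto
  then show ?thesis
    by (simp add: gain_inst[OF assms(1)])
qed

section \<open>Feasible operations\<close>

definition loops :: "nat set" where
  "loops = {num \<tau> t j | \<tau> t j. \<tau> \<in> set ts \<and> t < Z \<and> j < Z \<and> harm \<tau> t j \<and> \<not> is_clause \<tau>}"

definition cut_loops :: "nat set \<Rightarrow> (nat \<times> nat \<times> nat) set" where
  "cut_loops U = (\<lambda>u. (u, u, num (Neutral W) 0 0)) ` U"

lemma loop_list:
  assumes "u \<in> loops"
  shows "u < size" "u \<in> harmful_items inst" "top_list u ! 0 = u"
    "\<And>r. 0 < r \<Longrightarrow> r \<le> W \<Longrightarrow> top_list u ! r = num (Neutral (r - 1)) 0 0" "num (Neutral W) 0 0 \<notin> set (top_list u)"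
proof -
  obtain \<tau> t j where u: "u = num \<tau> t j" "\<tau> \<in> set ts" "t < Z" "j < Z" "harm \<tau> t j" "\<not> is_clause \<tau>"
    using assms by (auto simp: loops_def)
  show "u < size" "u \<in> harmful_items inst"
    using u by (simp_all add: num_less harmful_num)
  have nth: "top_list u ! r = (if r = 0 then u else num (Neutral (r - 1)) 0 0)" if "r \<le> W" for r
    using nth_top_list[OF u(2-4) that] nb_loop[OF u(5,6)] u(1) by simp
  then show "top_list u ! 0 = u" "\<And>r. 0 < r \<Longrightarrow> r \<le> W \<Longrightarrow> top_list u ! r = num (Neutral (r - 1)) 0 0"
    by simp_all
  show "num (Neutral W) 0 0 \<notin> set (top_list u)"
  proof
    assume "num (Neutral W) 0 0 \<in> set (top_list u)"
    then obtain r where r: "r \<le> W" "num (Neutral W) 0 0 = top_list u ! r"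
      by (auto simp: in_set_conv_nth less_Suc_eq_le)
    show False
    proof (cases "r = 0")
      case True
      then have "num (Neutral W) 0 0 = num \<tau> t j"
        using r nth[of r] u(1) by simp
      then show False
        using u zero_less_Z by (cases \<tau>) (simp_all add: num_inject)
    next
      case False
      then have "num (Neutral W) 0 0 = num (Neutral (r - 1)) 0 0"
        using r nth[of r] by simp
      then show False
        using False r(1) zero_less_Z by (auto simp: num_inject)
    qed
  qed
qed

lemma score_bounds: "u < size \<Longrightarrow> v < size \<Longrightarrow> 0 \<le> score inst u v \<and> score inst u v \<le> 1"
  by (simp add: score_inst pick_range)

lemma weight_pos: "1 \<le> 1 + log 2 (1 + real k)"
  by simp

lemma DCG_original:
  assumes u: "u < size"
  shows "0 < DCG inst u (top_list u)" "DCG inst u (top_list u) \<le> real (Suc W)"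
proof -
  note L = top_list_props[OF u]
  have s: "0 < score inst u v" "score inst u v \<le> 1" if "v \<in> set (top_list u)" for v
    using that L u score_bounds[OF u, of v] by (auto simp: score_inst pick_pos)
  show "0 < DCG inst u (top_list u)"
    unfolding DCG_def
  proof (rule sum_pos)
    show "set (top_list u) \<noteq> {}"
      using length_top_list[of u] by (metis Zero_not_Suc empty_set length_0_conv set_empty2)
    show "0 < real_of_rat (score inst u v) / (1 + log 2 (1 + real (rank_in (top_list u) v)))" if "v \<in> set (top_list u)" for v
      using s[OF that] by (intro divide_pos_pos less_le_trans[OF zero_less_one weight_pos]) simp
  qed simp
  have "DCG inst u (top_list u) \<le> (\<Sum>v\<in>set (top_list u). 1)"
    unfolding DCG_def
  proof (rule sum_mono)
    fix v assume "v \<in> set (top_list u)"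
    then have "real_of_rat (score inst u v) \<le> 1"
      using s by simp
    then show "real_of_rat (score inst u v) / (1 + log 2 (1 + real (rank_in (top_list u) v))) \<le> 1"
      using weight_pos[of "rank_in (top_list u) v"] by (subst divide_le_eq_1) linarith
  qed
  then show "DCG inst u (top_list u) \<le> real (Suc W)"
    using distinct_card[OF L(1)] by simp
qed

lemma cut_loops_rewiring:
  assumes "U \<subseteq> loops"
  shows "rewiring_set inst (cut_loops U)"
  unfolding rewiring_set_def
proof (intro conjI allI impI ballI)
  fix op assume "op \<in> cut_loops U"
  then obtain u where u: "op = (u, u, num (Neutral W) 0 0)" "u \<in> loops"
    using assms by (auto simp: cut_loops_def)
  have "u \<in> set (top_list u)"
    using loop_list(3)[OF u(2)] nth_mem[of 0 "top_list u"] by simp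
  then show "rewiring_operation inst op"
    using loop_list[OF u(2)] zero_less_Z by (simp add: u(1) rewiring_operation_def original_inst harmful_num)
next
  fix u v w v' w' assume "(u, v, w) \<in> cut_loops U \<and> (u, v', w') \<in> cut_loops U"
  then show "v = v' \<longleftrightarrow> w = w'"
    by (auto simp: cut_loops_def)
qed

lemma op_at_cut_loops: "op_at (cut_loops U) u \<longleftrightarrow> u \<in> U"
  by (auto simp: op_at_def cut_loops_def)

lemma threshold_inst: "real_of_rat (threshold inst) = (1 / 6) / real (Suc W)"
  by (simp add: inst_def of_rat_divide of_rat_mult of_rat_add)

lemma log_2_3: "log 2 3 \<le> 2"
proof -
  have "log 2 3 \<le> log 2 (2 ^ 2)"
    by simp
  also have "\<dots> = 2"
    by (subst log_pow_cancel) simp_all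
  finally show ?thesis .
qed

text \<open>Cutting a loop changes only the first entry. The entry of rank 2 has score 1/2 and alone
  contributes (1/2) / (1 + log 2 3), which is at least 1/6.\<close>

lemma cut_loops_feasible:
  assumes U: "U \<subseteq> loops" "finite U" "card U = A * Z * Z"
  shows "feasible inst (cut_loops U)"
  unfolding feasible_def
proof (intro conjI ballI)
  note O = cut_loops_rewiring[OF U(1)]
  show "rewiring_set inst (cut_loops U)" "finite (cut_loops U)"
    using O U by (simp_all add: cut_loops_def)
  have "card (cut_loops U) = card U"
    unfolding cut_loops_def by (rule card_image) (simp add: inj_on_def)
  then show "card (cut_loops U) = budget inst"
    using U by (simp add: inst_def)
  fix u assume "u \<in> items inst"
  then have u: "u < size"
    by simp
  let ?\<Gamma> = "rewired inst (cut_loops U) u"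
  note D = DCG_original[OF u]
  have "1 / 6 \<le> DCG inst u ?\<Gamma> \<or> DCG inst u ?\<Gamma> = DCG inst u (top_list u)"
  proof (cases "u \<in> U")
    case False
    then have "?\<Gamma> = top_list u"
      using u by (auto simp: rewired_def cut_loops_def original_inst intro!: map_idI)
    then show ?thesis by simp
  next
    case True
    then have ul: "u \<in> loops"
      using U by blast
    have W1: "1 \<le> W"
      using W(1) by simp
    let ?v = "num (Neutral 0) 0 0"
    have v: "top_list u ! 1 = ?v"
      using loop_list(4)[OF ul, of 1] W1 by simp
    have vn: "?v \<in> neutral_items inst" "?v < size"
      using zero_less_Z by (simp_all add: harmful_num num_less)
    have "(u, ?v, w) \<notin> cut_loops U" for w
      using operation_inst(3)[OF O, of u ?v w] vn by (auto simp: harmful_items_def neutral_items_def)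
    then have \<Gamma>1: "?\<Gamma> ! 1 = ?v"
      using rewired_nth(2)[OF O u W1] v by simp
    note d = distinct_rewired[OF O u]
    have vin: "?v \<in> set ?\<Gamma>"
      using \<Gamma>1 d(2) W1 nth_mem[of 1 ?\<Gamma>] by simp
    have rank: "rank_in ?\<Gamma> ?v = 2"
      using rank_in_nth[OF d(1), of 1] \<Gamma>1 d(2) W1 by simp
    have sc: "score inst u ?v = 1 / 2"
      using pick_nth[OF top_list_props(1)[OF u], of 1 0] v W1 u vn by (simp add: score_inst)
    have sub: "set ?\<Gamma> \<subseteq> {..<size}"
    proof
      fix y assume "y \<in> set ?\<Gamma>"
      then obtain r where r: "r \<le> W" "y = ?\<Gamma> ! r"
        using d(2) by (auto simp: in_set_conv_nth less_Suc_eq_le)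
      then have "y \<in> neutral_items inst \<or> y = top_list u ! r"
        using rewired_nth[OF O u r(1)] operation_inst(4)[OF O] by metis
      then show "y \<in> {..<size}"
        using subsetD[OF top_list_props(2)[OF u] nth_mem, of r] r(1) by (auto simp: neutral_items_def)
    qed
    have "1 \<le> 1 + log 2 (3 :: real)"
      by simp
    then have pos: "0 < 1 + log 2 (3 :: real)"
      by linarith
    have "1 / 6 * (1 + log 2 (3 :: real)) \<le> 1 / 2"
      using log_2_3 by simp
    then have "1 / 6 \<le> (1 / 2) / (1 + log 2 (3 :: real))"
      unfolding pos_le_divide_eq[OF pos] .
    also have "\<dots> = real_of_rat (score inst u ?v) / (1 + log 2 (1 + real (rank_in ?\<Gamma> ?v)))"
      by (simp add: sc rank of_rat_divide)
    also have "\<dots> \<le> DCG inst u ?\<Gamma>"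
      unfolding DCG_def
    proof (rule member_le_sum[OF vin])
      fix y assume "y \<in> set ?\<Gamma> - {?v}"
      then show "0 \<le> real_of_rat (score inst u y) / (1 + log 2 (1 + real (rank_in ?\<Gamma> y)))"
        using sub score_bounds[OF u, of y] weight_pos[of "rank_in ?\<Gamma> y"] by (intro divide_nonneg_nonneg) auto
    qed simp
    finally show ?thesis by simp
  qed
  then show "real_of_rat (threshold inst) \<le> quality inst (rewired inst (cut_loops U)) u"
  proof
    assume "1 / 6 \<le> DCG inst u ?\<Gamma>"
    then have "(1 / 6) / real (Suc W) \<le> DCG inst u ?\<Gamma> / DCG inst u (top_list u)"
      using D by (intro frac_le) simp_all
    then show ?thesis
      by (simp only: threshold_inst quality_def original_inst[OF u])
  next
    assume "DCG inst u ?\<Gamma> = DCG inst u (top_list u)"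
    then show ?thesis
      using D by (simp add: threshold_inst quality_def original_inst[OF u])
  qed
qed

section \<open>Correctness of the reduction\<close>

definition var_index :: "(nat \<times> nat \<times> nat) set" where
  "var_index = {..<A} \<times> {..<Z} \<times> {..<Z}"

lemma card_var_index: "finite var_index" "card var_index = A * Z * Z"
  by (simp_all add: var_index_def)

definition literal_item :: "(nat \<times> nat \<times> nat) \<Rightarrow> bool \<Rightarrow> nat" where
  "literal_item v b = (case v of (\<kappa>, t, j) \<Rightarrow> num (Literal \<kappa> b) t j)"

lemma loopsI: "\<tau> \<in> set ts \<Longrightarrow> t < Z \<Longrightarrow> j < Z \<Longrightarrow> harm \<tau> t j \<Longrightarrow> \<not> is_clause \<tau> \<Longrightarrow> num \<tau> t j \<in> loops"
  unfolding loops_def by blast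

lemma literal_item_loops: "v \<in> var_index \<Longrightarrow> literal_item v b \<in> loops"
  by (cases v) (auto simp: var_index_def literal_item_def intro!: loopsI)

lemma literal_item_inject:
  "v \<in> var_index \<Longrightarrow> v' \<in> var_index \<Longrightarrow> literal_item v b = literal_item v' b' \<longleftrightarrow> v = v' \<and> b = b'"
  by (auto simp: var_index_def literal_item_def num_inject)

definition literals_of :: "(nat \<times> nat \<times> nat \<Rightarrow> bool) \<Rightarrow> nat set" where
  "literals_of a = (\<lambda>v. literal_item v (a v)) ` var_index"

lemma literals_of: "literals_of a \<subseteq> loops" "finite (literals_of a)" "card (literals_of a) = A * Z * Z"
proof -
  show "literals_of a \<subseteq> loops" "finite (literals_of a)"
    using literal_item_loops card_var_index by (auto simp: literals_of_def)
  have "inj_on (\<lambda>v. literal_item v (a v)) var_index"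
    using literal_item_inject by (auto simp: inj_on_def)
  then show "card (literals_of a) = A * Z * Z"
    unfolding literals_of_def by (simp add: card_image card_var_index)
qed

lemma nb_literal:
  assumes c: "clause_item c t j" and r: "r < length (lits c)"
  shows "atom x t j (lits c ! r) \<in> var_index" "r < W"
    "nb (Clause c) t j r = literal_item (atom x t j (lits c ! r)) (fst (lits c ! r))"
proof -
  have c': "c < length cs" "active c t j" "t < Z" "j < Z"
    using c by (simp_all add: clause_item_def)
  show rW: "r < W"
    using r wf_cs(2)[OF c'(1)] by simp
  have "atom x t j (lits c ! r) \<in> var_index \<and>
    nb (Clause c) t j r = literal_item (atom x t j (lits c ! r)) (fst (lits c ! r))"
    by (cases rule: nb_clause[OF c' less_imp_le[OF rW]]) (use r rW in \<open>auto simp: var_index_def literal_item_def\<close>)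
  then show "atom x t j (lits c ! r) \<in> var_index"
    "nb (Clause c) t j r = literal_item (atom x t j (lits c ! r)) (fst (lits c ! r))"
    by simp_all
qed

text \<open>The loops of the true literals are cut. Every clause then has a literal with a cut loop,
  the pair clauses because one of two complementary literals is true.\<close>

lemma yes_gain:
  assumes a: "satisfies x Z cs0 a"
  shows "feasible inst (cut_loops (literals_of a))" "p * (\<zeta> - 1) \<le> gain inst (cut_loops (literals_of a))"
proof -
  show "feasible inst (cut_loops (literals_of a))"
    by (rule cut_loops_feasible[OF literals_of])
  have "\<exists>r<W. op_at (cut_loops (literals_of a)) (nb (Clause c) t j r)" if c: "clause_item c t j" for c t j
  proof -
    have "\<exists>l\<in>set (lits c). a (atom x t j l) = fst l"
    proof (cases "c < length cs0")
      case True
      then have "cs ! c \<in> set cs0"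
        by (simp add: cs_def nth_append)
      with a have "case cs ! c of (g, ls) \<Rightarrow> \<forall>t<Z. \<forall>j<Z. aval x (env t j) g \<noteq> 0 \<longrightarrow> (\<exists>l\<in>set ls. a (atom x t j l) = fst l)"
        unfolding satisfies_def by (rule bspec)
      then show ?thesis
        using c by (simp add: clause_item_def active_def case_prod_unfold)
    next
      case False
      moreover have "c < length cs0 + A"
        using c by (simp add: clause_item_def cs_def)
      ultimately have "c = length cs0 + (c - length cs0)" "c - length cs0 < A"
        by linarith+
      then show ?thesis
        using pair_schema[of "c - length cs0"] by auto
    qed
    then obtain r where r: "r < length (lits c)" "a (atom x t j (lits c ! r)) = fst (lits c ! r)"
      by (auto simp: in_set_conv_nth)
    then have "nb (Clause c) t j r \<in> literals_of a"
      unfolding literals_of_def using nb_literal[OF c r(1)] r(2)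
      by (intro image_eqI[of _ _ "atom x t j (lits c ! r)"]) simp_all
    then show ?thesis
      using nb_literal(2)[OF c r(1)] by (auto simp: op_at_cut_loops)
  qed
  then show "p * (\<zeta> - 1) \<le> gain inst (cut_loops (literals_of a))"
    using gain_ge[OF cut_loops_rewiring[OF literals_of(1)] covered_mean] by simp
qed

text \<open>One literal is exchanged for the hub, which keeps the number of operations. No
  satisfying assignment is involved, so every instance is feasible and has a positive
  optimum.\<close>

lemma hub_solution:
  obtains O1 where "feasible inst O1" "e * (\<zeta> - 1) \<le> gain inst O1"
proof -
  let ?S = "literals_of (\<lambda>_. True)"
  have "?S \<noteq> {}"
    using literals_of(3)[of "\<lambda>_. True"] pos by auto
  then obtain s where s: "s \<in> ?S"
    by blast
  have hub: "0 \<in> loops"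
    using loopsI[of Hub 0 0] zero_less_Z by (simp add: num_Hub)
  have "0 \<notin> ?S"
  proof
    assume "0 \<in> ?S"
    then obtain \<kappa> t j where "\<kappa> < A" "t < Z" "j < Z" "num (Literal \<kappa> True) t j = num Hub 0 0"
      by (auto simp: literals_of_def literal_item_def var_index_def num_Hub)
    then show False
      using zero_less_Z by (simp add: num_inject)
  qed
  then have "card (insert 0 (?S - {s})) = A * Z * Z"
    using s literals_of(2,3)[of "\<lambda>_. True"] pos by (simp add: card_Suc_Diff1)
  moreover have "insert 0 (?S - {s}) \<subseteq> loops" "finite (insert 0 (?S - {s}))"
    using hub literals_of by auto
  ultimately have "feasible inst (cut_loops (insert 0 (?S - {s})))"
    by (intro cut_loops_feasible)
  moreover have "e * (\<zeta> - 1) \<le> gain inst (cut_loops (insert 0 (?S - {s})))"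
    using gain_ge[OF cut_loops_rewiring[OF \<open>insert 0 (?S - {s}) \<subseteq> loops\<close>] hub_mean]
    by (simp add: op_at_cut_loops)
  ultimately show thesis
    by (rule that)
qed

text \<open>Contains every item at which an operation can hit the pair clause of \<open>v\<close>.
  Groups of different variables are disjoint, and none contains the hub.\<close>

definition group :: "nat \<times> nat \<times> nat \<Rightarrow> nat set" where
  "group v = (case v of (\<kappa>, t, j) \<Rightarrow>
     {num \<tau> t j | \<tau>. \<tau> = Clause (length cs0 + \<kappa>) \<or> (\<exists>b. \<tau> = Literal \<kappa> b) \<or> (\<exists>r<W. \<tau> = Pad (length cs0 + \<kappa>) r)})"

lemma in_group:
  assumes "v \<in> var_index" "\<tau> \<in> set ts" "t < Z" "j < Z"
  shows "num \<tau> t j \<in> group v \<longleftrightarrow> (case v of (\<kappa>, t', j') \<Rightarrow> t = t' \<and> j = j' \<and>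
    (\<tau> = Clause (length cs0 + \<kappa>) \<or> (\<exists>b. \<tau> = Literal \<kappa> b) \<or> (\<exists>r<W. \<tau> = Pad (length cs0 + \<kappa>) r)))"
proof -
  obtain \<kappa> t' j' where v: "v = (\<kappa>, t', j')" by (cases v)
  have \<kappa>: "\<kappa> < A" "t' < Z" "j' < Z"
    using assms(1) by (simp_all add: v var_index_def)
  have eq: "num \<tau> t j = num \<sigma> t' j' \<longleftrightarrow> \<tau> = \<sigma> \<and> t = t' \<and> j = j'"
    if "\<sigma> = Clause (length cs0 + \<kappa>) \<or> (\<exists>b. \<sigma> = Literal \<kappa> b) \<or> (\<exists>r<W. \<sigma> = Pad (length cs0 + \<kappa>) r)" for \<sigma>
    using that \<kappa> assms pair_schema[OF \<kappa>(1)] by (intro num_inject) auto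
  show ?thesis
    unfolding group_def v prod.case mem_Collect_eq
  proof
    assume "\<exists>\<sigma>. num \<tau> t j = num \<sigma> t' j' \<and> (\<sigma> = Clause (length cs0 + \<kappa>) \<or> (\<exists>b. \<sigma> = Literal \<kappa> b) \<or> (\<exists>r<W. \<sigma> = Pad (length cs0 + \<kappa>) r))"
    then obtain \<sigma> where \<sigma>: "num \<tau> t j = num \<sigma> t' j'"
      "\<sigma> = Clause (length cs0 + \<kappa>) \<or> (\<exists>b. \<sigma> = Literal \<kappa> b) \<or> (\<exists>r<W. \<sigma> = Pad (length cs0 + \<kappa>) r)"
      by blast
    then show "t = t' \<and> j = j' \<and> (\<tau> = Clause (length cs0 + \<kappa>) \<or> (\<exists>b. \<tau> = Literal \<kappa> b) \<or> (\<exists>r<W. \<tau> = Pad (length cs0 + \<kappa>) r))"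
      using eq[OF \<sigma>(2)] by simp
  qed blast
qed

lemma group_cases:
  assumes "v \<in> var_index" "u \<in> group v"
  obtains \<tau> t j where "u = num \<tau> t j" "\<tau> \<in> set ts" "t < Z" "j < Z"
proof -
  obtain \<kappa> t j where v: "v = (\<kappa>, t, j)" by (cases v)
  have \<kappa>: "\<kappa> < A" "t < Z" "j < Z"
    using assms(1) by (simp_all add: v var_index_def)
  show thesis
    using assms(2) that \<kappa> pair_schema[OF \<kappa>(1)] by (auto simp: group_def v)
qed

lemma group_disjoint:
  assumes "v \<in> var_index" "v' \<in> var_index" "u \<in> group v" "u \<in> group v'"
  shows "v = v'"
proof -
  obtain \<tau> t j where u: "u = num \<tau> t j" "\<tau> \<in> set ts" "t < Z" "j < Z"
    using group_cases[OF assms(1,3)] .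
  show ?thesis
    using assms(3,4) unfolding u(1) in_group[OF assms(1) u(2-4)] in_group[OF assms(2) u(2-4)]
    by (cases v; cases v') auto
qed

lemma hit_pair_group:
  assumes v: "v = (\<kappa>, t, j)" "v \<in> var_index" and "hit O1 (length cs0 + \<kappa>) t j"
  shows "\<exists>y\<in>O1. fst y \<in> group v"
proof -
  have \<kappa>: "\<kappa> < A" "t < Z" "j < Z"
    using v by (auto simp: var_index_def)
  have "\<exists>u\<in>group v. op_at O1 u"
    using assms(3) unfolding hit_def
  proof (elim disjE exE conjE)
    assume "op_at O1 (num (Clause (length cs0 + \<kappa>)) t j)"
    then show ?thesis
      by (auto simp: group_def v(1))
  next
    fix r assume r: "r < W" "op_at O1 (nb (Clause (length cs0 + \<kappa>)) t j r)"
    have c: "length cs0 + \<kappa> < length cs" "active (length cs0 + \<kappa>) t j"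
      using pair_schema[OF \<kappa>(1)] pair_active[OF \<kappa>(1)] by simp_all
    have "nb (Clause (length cs0 + \<kappa>)) t j r \<in> group v"
    proof (cases rule: nb_clause[OF c \<kappa>(2,3) less_imp_le[OF r(1)]])
      case (1 \<kappa>' t' j')
      then have "r = 0 \<or> r = 1"
        using pair_schema[OF \<kappa>(1)] by auto
      then have "\<kappa>' = \<kappa>" "t' = t" "j' = j"
        using 1(2) pair_schema[OF \<kappa>(1)] by auto
      then show ?thesis
        using 1(6) by (auto simp: group_def v(1))
    next
      case 2
      then show ?thesis
        using r(1) by (auto simp: group_def v(1))
    next
      case 3
      then show ?thesis
        using r(1) by simp
    qed
    then show ?thesis
      using r(2) by blast
  qed
  then show ?thesis
    by (auto simp: op_at_def) force
qed

text \<open>The budget equals the number of variables. So if all pair clauses are hit, then each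
  operation belongs to the group of exactly one variable.\<close>

lemma pigeonhole:
  assumes O: "finite O1" "card O1 = A * Z * Z" and ex: "\<forall>v\<in>var_index. \<exists>y\<in>O1. fst y \<in> group v"
  shows "z \<in> O1 \<Longrightarrow> \<exists>v\<in>var_index. fst z \<in> group v"
    "z \<in> O1 \<Longrightarrow> z' \<in> O1 \<Longrightarrow> v \<in> var_index \<Longrightarrow> fst z \<in> group v \<Longrightarrow> fst z' \<in> group v \<Longrightarrow> z = z'"
proof -
  obtain h where h: "\<And>v. v \<in> var_index \<Longrightarrow> h v \<in> O1 \<and> fst (h v) \<in> group v"
    using ex by metis
  have inj: "inj_on h var_index"
    using h group_disjoint unfolding inj_on_def by metis
  then have "card (h ` var_index) = card O1"
    by (simp add: card_image card_var_index O)
  then have surj: "h ` var_index = O1"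
    using h O by (intro card_subset_eq) auto
  have image: "\<exists>w\<in>var_index. z = h w" if "z \<in> O1" for z
    using that surj by auto
  show "\<exists>v\<in>var_index. fst z \<in> group v" if "z \<in> O1"
    using image[OF that] h by auto
  show "z = z'" if z: "z \<in> O1" "z' \<in> O1" "v \<in> var_index" "fst z \<in> group v" "fst z' \<in> group v"
  proof -
    obtain w where w: "w \<in> var_index" "z = h w"
      using image[OF z(1)] by blast
    obtain w' where w': "w' \<in> var_index" "z' = h w'"
      using image[OF z(2)] by blast
    have "w = v"
      using h[OF w(1)] z(3,4) w by (intro group_disjoint[of w v "fst z"]) simp_all
    moreover have "w' = v"
      using h[OF w'(1)] z(3,5) w' by (intro group_disjoint[of w' v "fst z'"]) simp_all
    ultimately show ?thesis
      using w w' by simp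
  qed
qed

lemma all_pairs_hit_no_hub:
  assumes O: "finite O1" "card O1 = A * Z * Z"
    and hits: "\<And>\<kappa> t j. (\<kappa>, t, j) \<in> var_index \<Longrightarrow> hit O1 (length cs0 + \<kappa>) t j"
  shows "\<not> op_at O1 0"
proof
  assume "op_at O1 0"
  then obtain v w where hub: "(0, v, w) \<in> O1"
    by (auto simp: op_at_def)
  have ex: "\<exists>y\<in>O1. fst y \<in> group v" if v: "v \<in> var_index" for v
  proof -
    obtain \<kappa> t j where "v = (\<kappa>, t, j)" by (cases v)
    with v hit_pair_group[OF _ v] hits show ?thesis by simp
  qed
  obtain u where "u \<in> var_index" "0 \<in> group u"
    using pigeonhole(1)[OF O _ hub] ex by auto
  then show False
    using zero_less_Z in_group[of u Hub 0 0] by (simp add: num_Hub case_prod_unfold)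
qed

text \<open>By the counting argument all operations lie in groups of variables, hence none is on a
  clause of the formula or on its pads, and such a clause can only be hit through a literal. Each
  group has just one operation, so complementary literals are never both chosen.\<close>

lemma hits_satisfy:
  assumes O: "finite O1" "card O1 = A * Z * Z"
    and hits: "\<And>c t j. clause_item c t j \<Longrightarrow> hit O1 c t j"
  shows "satisfies x Z cs0 (\<lambda>v. op_at O1 (literal_item v True))"
proof -
  have ex: "\<exists>y\<in>O1. fst y \<in> group v" if "v \<in> var_index" for v
  proof -
    obtain \<kappa> t j where v: "v = (\<kappa>, t, j)" by (cases v)
    then have "hit O1 (length cs0 + \<kappa>) t j"
      using that by (intro hits pair_item) (auto simp: var_index_def)
    from hit_pair_group[OF v that this] show ?thesis .
  qed
  then have "\<forall>v\<in>var_index. \<exists>y\<in>O1. fst y \<in> group v"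
    by blast
  note ph = pigeonhole[OF O this]
  have lit_group: "literal_item v b \<in> group v" for v b
    by (auto simp: literal_item_def group_def split: prod.splits)
  have grouped: "\<exists>v\<in>var_index. u \<in> group v" if "op_at O1 u" for u
    using that ph(1) by (fastforce simp: op_at_def)
  have clause: "\<exists>l\<in>set (lits c). op_at O1 (literal_item (atom x t j l) True) = fst l"
    if c: "clause_item c t j" "c < length cs0" for c t j
  proof -
    have cts: "Clause c \<in> set ts" "t < Z" "j < Z" "c < length cs"
      using c by (simp_all add: clause_item_def)
    have no: "\<not> op_at O1 (num (Clause c) t j)"
    proof
      assume "op_at O1 (num (Clause c) t j)"
      from grouped[OF this] obtain v where "v \<in> var_index" "num (Clause c) t j \<in> group v" ..
      then show False
        using cts(2,3) c(2) in_group[OF _ cts(1-3), of v] by (simp add: case_prod_unfold)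
    qed
    have no_pad: "\<not> op_at O1 (num (Pad c r) t j)" if "r < W" for r
    proof
      assume "op_at O1 (num (Pad c r) t j)"
      from grouped[OF this] obtain v where "v \<in> var_index" "num (Pad c r) t j \<in> group v" ..
      then show False
        using cts c(2) that in_group[of v "Pad c r" t j] by (simp add: case_prod_unfold)
    qed
    obtain r where r: "r < W" "op_at O1 (nb (Clause c) t j r)"
      using hits[OF c(1)] no by (auto simp: hit_def)
    have rl: "r < length (lits c)"
    proof (rule ccontr)
      assume "\<not> r < length (lits c)"
      then have "nb (Clause c) t j r = num (Pad c r) t j"
        using r(1) c(1) by (simp add: nb.simps clause_item_def)
      then show False
        using r no_pad by simp
    qed
    let ?l = "lits c ! r"
    let ?v = "atom x t j ?l"
    have v: "?v \<in> var_index" "op_at O1 (literal_item ?v (fst ?l))"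
      using nb_literal[OF c(1) rl] r(2) by simp_all
    have "op_at O1 (literal_item ?v True) = fst ?l"
    proof (cases "fst ?l")
      case True
      then show ?thesis using v(2) by simp
    next
      case False
      have "\<not> op_at O1 (literal_item ?v True)"
      proof
        assume "op_at O1 (literal_item ?v True)"
        then obtain a b where ab: "(literal_item ?v True, a, b) \<in> O1"
          by (auto simp: op_at_def)
        obtain a' b' where ab': "(literal_item ?v False, a', b') \<in> O1"
          using v(2) False by (auto simp: op_at_def)
        have "(literal_item ?v True, a, b) = (literal_item ?v False, a', b')"
          by (rule ph(2)[OF ab ab' v(1)]) (simp_all add: lit_group)
        then show False
          using literal_item_inject[OF v(1) v(1), of True False] by simp
      qed
      then show ?thesis using False by simp
    qed
    then show ?thesis
      using rl by (intro bexI[of _ ?l]) simp_all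
  qed
  show ?thesis
    unfolding satisfies_def
  proof (intro ballI, clarify)
    fix g ls t j
    assume "(g, ls) \<in> set cs0" and *: "t < Z" "j < Z" "0 < aval x (env t j) g"
    then obtain c where c: "c < length cs0" "cs ! c = (g, ls)"
      by (auto simp: in_set_conv_nth cs_def nth_append)
    then have "clause_item c t j"
      using * by (simp add: clause_item_def active_def cs_def)
    from clause[OF this c(1)] show "\<exists>l\<in>set ls. op_at O1 (literal_item (atom x t j l) True) = fst l"
      by (simp add: c)
  qed
qed

lemma gain_bounds: "0 < e * (\<zeta> - 1)" "p * (\<zeta> - 1) = real m * (e * (\<zeta> - 1))"
  using p_e(1,2) \<zeta>_bounds by simp_all

text \<open>The optimum is positive, so the gain of an approximate solution is positive too. But
  some clause is unhit, and without the hub this forces the gain down to 0.\<close>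

theorem approximate_no:
  assumes "0 < \<alpha>" "approximate_solution \<alpha> inst O1" "\<nexists>a. satisfies x Z cs0 a"
  shows "op_at O1 0"
proof (rule ccontr)
  assume no: "\<not> op_at O1 0"
  have f: "feasible inst O1"
    using assms(2) by (simp add: approximate_solution_def)
  obtain O2 where O2: "optimal inst O2" "\<alpha> * gain inst O2 \<le> gain inst O1"
    using assms(2) by (auto simp: approximate_solution_def)
  obtain O3 where O3: "feasible inst O3" "e * (\<zeta> - 1) \<le> gain inst O3"
    by (rule hub_solution)
  have "e * (\<zeta> - 1) \<le> gain inst O2"
    using O2(1) O3 unfolding optimal_def by fastforce
  then have "0 < \<alpha> * gain inst O2"
    using assms(1) gain_bounds(1) by simp
  then have pos: "0 < gain inst O1"
    using O2(2) by simp
  have "finite O1" "card O1 = A * Z * Z" and rs: "rewiring_set inst O1"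
    using f by (simp_all add: feasible_def inst_def)
  then obtain c t j where "clause_item c t j" "\<not> hit O1 c t j"
    using hits_satisfy assms(3) by blast
  then have "gain inst O1 \<le> 0"
    using gain_le[OF rs clause_item_harmful unhit_mean(2)[OF _ _ no]] by simp
  then show False
    using pos by simp
qed

text \<open>An operation on the hub leaves some pair clause unhit, which caps the gain at e (\<zeta>
  - 1). This is less than \<alpha> p (\<zeta> - 1), as p = m e and \<alpha> m > 1.\<close>

theorem approximate_yes:
  assumes "1 < \<alpha> * real m" "0 < \<alpha>" "approximate_solution \<alpha> inst O1" "satisfies x Z cs0 a"
  shows "\<not> op_at O1 0"
proof
  assume hub: "op_at O1 0"
  have f: "feasible inst O1"
    using assms(3) by (simp add: approximate_solution_def)
  obtain O2 where O2: "optimal inst O2" "\<alpha> * gain inst O2 \<le> gain inst O1"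
    using assms(3) by (auto simp: approximate_solution_def)
  have "p * (\<zeta> - 1) \<le> gain inst O2"
    using O2(1) yes_gain[OF assms(4)] unfolding optimal_def by fastforce
  then have "\<alpha> * (p * (\<zeta> - 1)) \<le> \<alpha> * gain inst O2"
    using assms(2) by (intro mult_left_mono) simp_all
  then have "\<alpha> * (p * (\<zeta> - 1)) \<le> gain inst O1"
    using O2(2) by simp
  moreover have "1 * (e * (\<zeta> - 1)) < (\<alpha> * real m) * (e * (\<zeta> - 1))"
    using assms(1) gain_bounds(1) by (intro mult_strict_right_mono)
  ultimately have big: "e * (\<zeta> - 1) < gain inst O1"
    by (simp add: gain_bounds(2) mult.assoc)
  have "finite O1" "card O1 = A * Z * Z" and rs: "rewiring_set inst O1"
    using f by (simp_all add: feasible_def inst_def)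
  then obtain \<kappa> t j where v: "(\<kappa>, t, j) \<in> var_index" "\<not> hit O1 (length cs0 + \<kappa>) t j"
    using all_pairs_hit_no_hub hub by blast
  have c: "clause_item (length cs0 + \<kappa>) t j"
    using v(1) by (intro pair_item) (auto simp: var_index_def)
  have "gain inst O1 \<le> e * (\<zeta> - 1)"
    using gain_le[OF rs clause_item_harmful[OF c] unhit_mean(1)[OF c v(2)]] by simp
  then show False
    using big by simp
qed

end

section \<open>Printing the instance\<close>

definition seq :: "stm list \<Rightarrow> stm" where "seq ss = foldr Then ss Skip"
definition put :: "word \<Rightarrow> stm" where "put w = seq (map Emit w)"

lemma sem_seq [simp]: "sem x \<rho> (seq ss) = concat (map (sem x \<rho>) ss)"
  unfolding seq_def by (induction ss) auto

lemma sem_put [simp]: "sem x \<rho> (put w) = w"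
  unfolding put_def sem_seq by (induction w) auto

lemma concat_upt_mult:
  "concat (map f [0..<a * b]) = concat (map (\<lambda>i. concat (map (\<lambda>j. f (i * b + j)) [0..<b])) [0..<a])"
proof (induction a)
  case (Suc a)
  have "[0..<Suc a * b] = [0..<a * b] @ map (\<lambda>j. a * b + j) [0..<b]"
    using upt_add_eq_append[of 0 "a * b" b] map_add_upt[of "a * b" b] by (simp add: add.commute)
  then show ?case
    using Suc by (simp add: o_def)
qed simp

subsection \<open>Numbers in binary\<close>

text \<open>A positive number is a power of two iff it has no odd divisor greater than 1; this makes
  the digits of a number accessible to bounded sums.\<close>

definition has_odd_factor :: "nat \<Rightarrow> bool" where
  "has_odd_factor m \<longleftrightarrow> (\<exists>c<m. \<exists>b<Suc m. (2 * c + 3) * b = m)"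

lemma ex_odd_part: "0 < (m :: nat) \<Longrightarrow> \<exists>i q. odd q \<and> m = 2 ^ i * q"
proof (induction m rule: less_induct)
  case (less m)
  show ?case
  proof (cases "odd m")
    case True
    then show ?thesis by (intro exI[of _ 0] exI[of _ m]) simp
  next
    case False
    then obtain m' where m': "m = 2 * m'" by (auto elim: evenE)
    then have "m' < m" "0 < m'"
      using less.prems by simp_all
    then obtain i q where "odd q" "m' = 2 ^ i * q"
      using less.IH by blast
    then show ?thesis
      by (intro exI[of _ "Suc i"] exI[of _ q]) (simp add: m')
  qed
qed

lemma power_of_two_iff:
  assumes "0 < m"
  shows "(\<exists>i. m = 2 ^ i) \<longleftrightarrow> \<not> has_odd_factor m"
proof
  assume "\<exists>i. m = 2 ^ i"
  then obtain i where i: "m = 2 ^ i" ..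
  show "\<not> has_odd_factor m"
  proof
    assume "has_odd_factor m"
    then obtain c b where "(2 * c + 3) * b = m"
      by (auto simp: has_odd_factor_def)
    then have "2 * c + 3 dvd 2 ^ i"
      using i by (metis dvd_triv_left)
    then obtain j where "2 * c + 3 = 2 ^ j"
      using divides_primepow_nat[of 2 "2 * c + 3" i] by auto
    moreover have "odd (2 * c + 3)"
      by simp
    ultimately show False
      by (cases j) auto
  qed
next
  assume no: "\<not> has_odd_factor m"
  obtain i q where q: "odd q" "m = 2 ^ i * q"
    using ex_odd_part[OF assms] by blast
  have "q = 1"
  proof (rule ccontr)
    assume "q \<noteq> 1"
    then obtain c where c: "q = 2 * c + 3"
      using q(1) by (metis oddE add.assoc add_2_eq_Suc' mult_2 not0_implies_Suc one_add_one add_Suc_right mult_Suc_right numeral_3_eq_3 Suc_1 plus_1_eq_Suc mult_0_right add.commute add_cancel_right_left)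
    have "q \<le> m" "2 ^ i \<le> m"
      using q assms by simp_all
    then have "c < m" "2 ^ i < Suc m"
      using c by simp_all
    moreover have "(2 * c + 3) * 2 ^ i = m"
      using q c by simp
    ultimately have "has_odd_factor m"
      unfolding has_odd_factor_def by blast
    then show False
      using no by simp
  qed
  then show "\<exists>i. m = 2 ^ i"
    using q by auto
qed

lemma binary_digits: "binary k = map (\<lambda>i. odd (k div 2 ^ i)) [0..<length (binary k)]"
proof (induction k rule: binary.induct)
  case (1 k)
  show ?case
  proof (cases "k = 0")
    case False
    have "map (\<lambda>i. odd (k div 2 ^ i)) [0..<Suc (length (binary (k div 2)))] =
        odd k # map (\<lambda>i. odd (k div 2 div 2 ^ i)) [0..<length (binary (k div 2))]"
      by (simp add: upt_rec[of 0 "Suc _"] map_Suc_upt[symmetric] o_def div_mult2_eq del: upt_Suc)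
    then show ?thesis
      using 1[OF False] False binary.simps[of k] by simp
  qed simp
qed

lemma less_length_binary: "i < length (binary k) \<longleftrightarrow> 0 < k \<and> 2 ^ i \<le> k"
proof (induction k arbitrary: i rule: binary.induct)
  case (1 k)
  show ?case
  proof (cases "k = 0")
    case False
    then have k: "binary k = odd k # binary (k div 2)"
      using binary.simps[of k] by simp
    show ?thesis
    proof (cases i)
      case 0
      then show ?thesis using False k by simp
    next
      case (Suc j)
      have "i < length (binary k) \<longleftrightarrow> 0 < k div 2 \<and> 2 ^ j \<le> k div 2"
        using 1[OF False, of j] by (simp add: k Suc)
      also have "\<dots> \<longleftrightarrow> 0 < k \<and> 2 ^ i \<le> k"
      proof -
        have "0 < (2 :: nat) ^ j"
          by simp
        then have "0 < k div 2 \<and> 2 ^ j \<le> k div 2 \<longleftrightarrow> 2 ^ j \<le> k div 2"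
          by linarith
        also have "\<dots> \<longleftrightarrow> 2 ^ i \<le> k"
          using less_eq_div_iff_mult_less_eq[of 2 "2 ^ j" k] by (simp add: Suc mult.commute)
        finally show ?thesis
          using False by simp
      qed
      finally show ?thesis .
    qed
  qed (simp add: binary.simps[of 0])
qed

text \<open>The digits, least significant first, correspond to the powers of two up to
  \<open>k\<close> in increasing order, so one upward loop meets them in printing order.\<close>

lemma binary_filter: "binary k = map (\<lambda>m. odd (k div m)) (filter (\<lambda>m. \<not> has_odd_factor m) [1..<Suc k])"
proof -
  have "filter (\<lambda>m. \<not> has_odd_factor m) [1..<Suc k] = map (\<lambda>i. 2 ^ i) [0..<length (binary k)]"
  proof (rule sorted_distinct_set_unique)
    show "set (filter (\<lambda>m. \<not> has_odd_factor m) [1..<Suc k]) = set (map (\<lambda>i. 2 ^ i) [0..<length (binary k)])"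
    proof (intro set_eqI iffI)
      fix m assume "m \<in> set (filter (\<lambda>m. \<not> has_odd_factor m) [1..<Suc k])"
      then have m: "0 < m" "m \<le> k" "\<not> has_odd_factor m"
        by auto
      then obtain i where i: "m = 2 ^ i"
        using power_of_two_iff by blast
      then have "i < length (binary k)"
        using m(1,2) by (subst less_length_binary) linarith
      then show "m \<in> set (map (\<lambda>i. 2 ^ i) [0..<length (binary k)])"
        using i by auto
    next
      fix m :: nat assume "m \<in> set (map (\<lambda>i. 2 ^ i) [0..<length (binary k)])"
      then obtain i where i: "m = 2 ^ i" "2 ^ i \<le> k"
        by (auto simp: less_length_binary)
      then have "0 < m" "\<exists>i. m = 2 ^ i"
        by (simp, blast)
      then have "\<not> has_odd_factor m" "0 < m"
        using power_of_two_iff[of m] by simp_all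
      moreover have "1 \<le> m" "m < Suc k"
        using i \<open>0 < m\<close> by linarith+
      ultimately show "m \<in> set (filter (\<lambda>m. \<not> has_odd_factor m) [1..<Suc k])"
        by (simp del: upt_Suc)
    qed
    show "sorted (map (\<lambda>i. 2 ^ i :: nat) [0..<length (binary k)])"
      by (simp add: sorted_iff_nth_mono)
    show "distinct (map (\<lambda>i. 2 ^ i :: nat) [0..<length (binary k)])"
      by (simp add: distinct_map inj_on_def)
  qed (simp_all add: sorted_wrt_filter del: upt_Suc)
  then show ?thesis
    using binary_digits[of k] by (simp add: o_def)
qed

text \<open>Loops start at 0, so the candidate for a power of two is \<open>Var 0\<close> +
  1.\<close>

definition digit_test :: aexp where
  "digit_test = Neg (Sum (Some 1) (Add (Var 0) (Cst 1)) (Sum (Some 2) (Add (Var 0) (Cst 2))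
     (Equ (Mul (Add (Mul (Cst 2) (Var 1)) (Cst 3)) (Var 2)) (Add (Var 0) (Cst 1)))))"

text \<open>Expressions have no division. That the quotient by \<open>Var 0\<close> + 1 is odd,
  hence of the form 2c + 1, is expressed by two inequalities and a sum over c.\<close>

definition digit :: "aexp \<Rightarrow> aexp" where
  "digit k = Sum (Some 1) k (Mul (Leq (Mul (Add (Mul (Cst 2) (Var 1)) (Cst 1)) (Add (Var 0) (Cst 1))) k)
     (Less k (Mul (Add (Mul (Cst 2) (Var 1)) (Cst 2)) (Add (Var 0) (Cst 1)))))"

definition print_nat :: "aexp \<Rightarrow> stm" where
  "print_nat k = Then (For 0 k (Cond digit_test (Then (Emit True) (Cond (digit k) (Emit True) (Emit False))) Skip)) (Emit False)"

lemma of_bool_nat_eq_0: "((if Q then 1 else 0 :: nat) = 0) \<longleftrightarrow> \<not> Q"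
  by simp

lemma digit_test: "aval x (\<rho>(0 := i)) digit_test \<noteq> 0 \<longleftrightarrow> \<not> has_odd_factor (Suc i)"
proof -
  have body: "aval x (upd (Some 2) (upd (Some 1) (\<rho>(0 := i)) c) b)
      (Equ (Mul (Add (Mul (Cst 2) (Var 1)) (Cst 3)) (Var 2)) (Add (Var 0) (Cst 1))) =
      (if (2 * c + 3) * b = Suc i then 1 else 0)" for c b
    by (simp add: upd_def)
  have limits: "aval x (\<rho>(0 := i)) (Add (Var 0) (Cst 1)) = Suc i"
    "aval x (upd (Some 1) (\<rho>(0 := i)) c) (Add (Var 0) (Cst 2)) = Suc (Suc i)" for c
    by (simp_all add: upd_def)
  have "aval x (\<rho>(0 := i)) digit_test \<noteq> 0 \<longleftrightarrow>
      (\<Sum>c<Suc i. \<Sum>b<Suc (Suc i). if (2 * c + 3) * b = Suc i then 1 else 0 :: nat) = 0"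
    unfolding digit_test_def aval_compare(2) aval.simps(5) body limits by (simp only: of_bool_nat_eq_0 not_not)
  also have "\<dots> \<longleftrightarrow> (\<forall>c\<in>{..<Suc i}. \<forall>b\<in>{..<Suc (Suc i)}. (2 * c + 3) * b \<noteq> Suc i)"
    by (simp only: sum_eq_0_iff finite_lessThan of_bool_nat_eq_0)
  also have "\<dots> \<longleftrightarrow> \<not> has_odd_factor (Suc i)"
    unfolding has_odd_factor_def Ball_def lessThan_iff by blast
  finally show ?thesis .
qed

lemma digit:
  assumes k: "\<And>\<rho>. aval x \<rho> ke = k"
  shows "aval x (\<rho>(0 := i)) (digit ke) \<noteq> 0 \<longleftrightarrow> odd (k div Suc i)"
proof -
  have "aval x (\<rho>(0 := i)) (digit ke) \<noteq> 0 \<longleftrightarrow> (\<exists>c<k. (2 * c + 1) * Suc i \<le> k \<and> k < (2 * c + 2) * Suc i)"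
    by (auto simp: digit_def upd_def k sum_eq_0_iff split: if_splits)
  also have "\<dots> \<longleftrightarrow> (\<exists>c<k. k div Suc i = 2 * c + 1)"
  proof -
    have "k div Suc i = 2 * c + 1 \<longleftrightarrow> (2 * c + 1) * Suc i \<le> k \<and> k < (2 * c + 2) * Suc i" for c
      using div_nat_eqI[of "Suc i" "2 * c + 1" k] less_eq_div_iff_mult_less_eq[of "Suc i" "2 * c + 1" k]
        div_less_iff_less_mult[of "Suc i" k "2 * c + 2"] by auto
    then show ?thesis by simp
  qed
  also have "\<dots> \<longleftrightarrow> odd (k div Suc i)"
  proof
    assume "odd (k div Suc i)"
    then obtain c where c: "k div Suc i = 2 * c + 1"
      by (elim oddE)
    moreover have "k div Suc i \<le> k"
      by (rule div_le_dividend)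
    ultimately have "c < k"
      by linarith
    then show "\<exists>c<k. k div Suc i = 2 * c + 1"
      using c by blast
  qed auto
  finally show ?thesis .
qed

lemma sem_print_nat:
  assumes k: "\<And>\<rho>. aval x \<rho> ke = k"
  shows "sem x \<rho> (print_nat ke) = enc_nat k"
proof -
  have "concat (map (\<lambda>m. if \<not> has_odd_factor m then [True, odd (k div m)] else []) ms) =
      concat (map (\<lambda>b. [True, b]) (map (\<lambda>m. odd (k div m)) (filter (\<lambda>m. \<not> has_odd_factor m) ms)))" for ms :: "nat list"
    by (induction ms) auto
  from this[of "[1..<Suc k]"]
  have "enc_nat k = concat (map (\<lambda>m. if \<not> has_odd_factor m then [True, odd (k div m)] else []) [1..<Suc k]) @ [False]"
    by (simp only: enc_nat_def self_delimiting_def binary_filter[symmetric])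
  also have "[1..<Suc k] = map Suc [0..<k]"
    by (simp add: map_Suc_upt)
  also have "concat (map (\<lambda>m. if \<not> has_odd_factor m then [True, odd (k div m)] else []) (map Suc [0..<k])) @ [False] =
      sem x \<rho> (print_nat ke)"
  proof -
    have bit: "(if b then [True] else [False]) = [b]" for b
      by simp
    show ?thesis
      using digit_test[of x \<rho>] digit[OF k] by (simp add: print_nat_def k o_def bit cong: if_cong)
  qed
  finally show ?thesis ..
qed

subsection \<open>The instance\<close>

definition Ite :: "aexp \<Rightarrow> aexp \<Rightarrow> aexp \<Rightarrow> aexp" where
  "Ite g a b = Add (Mul (Neg (Neg g)) a) (Mul (Neg g) b)"

lemma aval_Ite [simp]: "aval x \<rho> (Ite g a b) = (if aval x \<rho> g \<noteq> 0 then aval x \<rho> a else aval x \<rho> b)"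
  by (simp add: Ite_def)

text \<open>Evaluation with variable 2 reset to 0, so that variable 2 can serve as a loop variable.\<close>

definition Mask :: "aexp \<Rightarrow> aexp" where
  "Mask a = Sum (Some 2) (Cst 1) a"

lemma aval_Mask [simp]: "aval x \<rho> (Mask a) = aval x (\<rho>(2 := 0)) a"
  by (simp add: Mask_def upd_def)

text \<open>Its parameters do not include the input: a program may depend on the language and on
  \<alpha>, while \<open>Z\<close> is replaced by the expression \<open>Ze\<close>.\<close>

locale printer =
  fixes cs :: "schema list" and A W m :: nat and Ze :: aexp
begin

abbreviation "ts \<equiv> item_types W A (length cs)"

definition num_e :: "item_type \<Rightarrow> aexp \<Rightarrow> aexp \<Rightarrow> aexp" where
  "num_e \<tau> te je = Add (Mul (Add (Mul (Cst (code ts \<tau>)) Ze) te) Ze) je"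

fun harm_e :: "item_type \<Rightarrow> aexp" where
  "harm_e Hub = Mul (Equ (Var 0) (Cst 0)) (Equ (Var 1) (Cst 0))"
| "harm_e (Neutral r) = Cst 0"
| "harm_e (Literal \<kappa> b) = Cst 1"
| "harm_e (Clause c) = fst (cs ! c)"
| "harm_e (Pad c r) = (if length (snd (cs ! c)) \<le> r then fst (cs ! c) else Cst 0)"

fun lit_e :: "lit \<Rightarrow> aexp" where
  "lit_e (b, \<kappa>, te, je) = num_e (Literal \<kappa> b) te je"

definition nb_e :: "item_type \<Rightarrow> nat \<Rightarrow> aexp" where
  "nb_e \<tau> r = Ite (harm_e \<tau>) (case \<tau> of
     Clause c \<Rightarrow> if r < length (snd (cs ! c)) then lit_e (snd (cs ! c) ! r)
       else if r < W then num_e (Pad c r) (Var 0) (Var 1) else num_e Hub (Cst 0) (Cst 0)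
   | _ \<Rightarrow> if r = 0 then num_e \<tau> (Var 0) (Var 1) else num_e (Neutral (r - 1)) (Cst 0) (Cst 0))
   (num_e (Neutral r) (Cst 0) (Cst 0))"

text \<open>The only rationals are 0 and reciprocals of ranks, so their codes are hard-wired and no
  rational arithmetic is performed.\<close>

fun print_score :: "nat \<Rightarrow> aexp list \<Rightarrow> stm" where
  "print_score r [] = put (enc_rat 0)"
| "print_score r (y # ys) = Cond (Equ (Var 2) (Mask y)) (put (enc_rat (1 / of_nat (Suc r)))) (print_score (Suc r) ys)"

definition size_e :: aexp where
  "size_e = Mul (Mul (Cst (length ts)) Ze) Ze"

definition print_harmful :: stm where
  "print_harmful = Then (seq (map (\<lambda>\<tau>. For 0 Ze (For 1 Ze
     (Then (Emit True) (Cond (harm_e \<tau>) (Emit True) (Emit False))))) ts)) (Emit False)"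

definition print_scores :: stm where
  "print_scores = Then (seq (map (\<lambda>\<tau>. For 0 Ze (For 1 Ze (Then (Emit True) (Then
     (For 2 size_e (Then (Emit True) (print_score 0 (map (nb_e \<tau>) [0..<Suc W])))) (Emit False))))) ts)) (Emit False)"

definition print_instance :: stm where
  "print_instance = seq [print_harmful, print_scores,
     put (enc_list enc_rat (replicate W (of_nat m / of_nat (W * m + 1)) @ [1 / of_nat (W * m + 1)])),
     print_nat (Mul (Mul (Cst A) Ze) Ze), put (enc_rat (1 / of_nat (6 * Suc W)))]"

end

context gadget
begin

interpretation P: printer cs A W m Ze for Ze .

context
  fixes Ze :: aexp
  assumes Ze: "\<And>\<rho>. aval x \<rho> Ze = Z"
begin

lemma aval_num_e: "aval x \<rho> (P.num_e Ze \<tau> te je) = num \<tau> (aval x \<rho> te) (aval x \<rho> je)"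
  by (simp add: P.num_e_def num_def Ze)

lemma aval_harm_e: "aval x (env t j) (P.harm_e \<tau>) \<noteq> 0 \<longleftrightarrow> harm \<tau> t j"
  by (cases \<tau>) (auto simp: active_def split: if_splits)

lemma aval_lit_e: "aval x (env t j) (P.lit_e Ze l) = lit_num t j l"
  by (cases l) (simp add: aval_num_e lit_num_def)

lemma aval_nb_e: "aval x (env t j) (P.nb_e Ze \<tau> r) = nb \<tau> t j r"
proof (cases "harm \<tau> t j")
  case True
  then show ?thesis
    using aval_harm_e[of t j \<tau>] by (cases \<tau>) (simp_all add: P.nb_e_def nb.simps aval_num_e aval_lit_e)
next
  case False
  then show ?thesis
    using aval_harm_e[of t j \<tau>] by (simp add: P.nb_e_def nb.simps aval_num_e)
qed

lemma env_2: "(env t j)(2 := v, 2 := 0) = env t j"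
  by (auto simp: env_def fun_eq_iff)

lemma sem_print_score:
  "sem x ((env t j)(2 := v)) (P.print_score r ys) = enc_rat (pick r (map (aval x (env t j)) ys) v)"
  using env_2[of t j v] by (induction ys arbitrary: r) (simp_all add: env_2)

text \<open>Item numbers are mixed-radix codes, so counting through them amounts to nested loops
  over type and coordinates; the outer one is unrolled.\<close>

lemma concat_items:
  "concat (map (\<lambda>u. f (type_of u) (u div Z mod Z) (u mod Z)) [0..<size]) =
   concat (map (\<lambda>\<tau>. concat (map (\<lambda>t. concat (map (f \<tau> t) [0..<Z])) [0..<Z])) ts)"
proof -
  have "concat (map (\<lambda>u. f (type_of u) (u div Z mod Z) (u mod Z)) [0..<size]) =
    concat (map (\<lambda>i. concat (map (\<lambda>t. concat (map (\<lambda>j.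
      f (type_of ((i * Z + t) * Z + j)) (((i * Z + t) * Z + j) div Z mod Z) (((i * Z + t) * Z + j) mod Z))
      [0..<Z])) [0..<Z])) [0..<length ts])"
    unfolding size_def by (simp only: concat_upt_mult)
  also have "\<dots> = concat (map (\<lambda>i. concat (map (\<lambda>t. concat (map (f (ts ! i) t) [0..<Z])) [0..<Z])) [0..<length ts])"
    by (intro arg_cong[of _ _ concat] map_cong refl) (simp add: type_of_def div_mod_add)
  also have "\<dots> = concat (map (\<lambda>\<tau>. concat (map (\<lambda>t. concat (map (f \<tau> t) [0..<Z])) [0..<Z])) (map ((!) ts) [0..<length ts]))"
    by (simp add: o_def)
  finally show ?thesis
    by (simp only: map_nth)
qed

lemma env_eq: "(\<lambda>_. 0)(0 := t, Suc 0 := j) = env t j"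
  by (simp add: env_def)

lemma sem_print_harmful: "sem x (\<lambda>_. 0) (P.print_harmful Ze) = enc_list (\<lambda>b. [b]) (harmful inst)"
proof -
  have bit: "(if b then [True] else [False]) = [b]" for b
    by simp
  have "enc_list (\<lambda>b. [b]) (harmful inst) =
      concat (map (\<lambda>u. [True, harm (type_of u) (u div Z mod Z) (u mod Z)]) [0..<size]) @ [False]"
    by (simp add: enc_list_def inst_def o_def)
  also have "\<dots> = sem x (\<lambda>_. 0) (P.print_harmful Ze)"
    unfolding concat_items[of "\<lambda>\<tau> t j. [True, harm \<tau> t j]"] using aval_harm_e
    by (simp add: P.print_harmful_def Ze o_def env_eq bit cong: if_cong)
  finally show ?thesis ..
qed

lemma sem_print_row:
  "sem x (env t j) (For 2 (P.size_e Ze) (Then (Emit True) (P.print_score 0 (map (P.nb_e Ze \<tau>) [0..<Suc W])))) @ [False] =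
   enc_list enc_rat (map (pick 0 (map (nb \<tau> t j) [0..<Suc W])) [0..<size])"
proof -
  have size: "aval x \<rho> (P.size_e Ze) = size" for \<rho>
    by (simp add: P.size_e_def size_def Ze)
  have nbs: "map (aval x (env t j)) (map (P.nb_e Ze \<tau>) [0..<Suc W]) = map (nb \<tau> t j) [0..<Suc W]"
    by (simp add: aval_nb_e del: upt_Suc)
  show ?thesis
    unfolding sem.simps size sem_print_score nbs by (simp add: enc_list_def o_def del: upt_Suc)
qed

lemma sem_print_scores: "sem x (\<lambda>_. 0) (P.print_scores Ze) = enc_list (enc_list enc_rat) (scores inst)"
proof -
  let ?row = "\<lambda>\<tau> t j. enc_list enc_rat (map (pick 0 (map (nb \<tau> t j) [0..<Suc W])) [0..<size])"
  have "enc_list (enc_list enc_rat) (scores inst) =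
      concat (map (\<lambda>u. True # ?row (type_of u) (u div Z mod Z) (u mod Z)) [0..<size]) @ [False]"
    by (simp add: enc_list_def[of "enc_list enc_rat"] inst_def o_def top_list_def del: upt_Suc)
  also have "\<dots> = concat (map (\<lambda>\<tau>. concat (map (\<lambda>t. concat (map (\<lambda>j. True # ?row \<tau> t j) [0..<Z])) [0..<Z])) ts) @ [False]"
    by (simp only: concat_items[of "\<lambda>\<tau> t j. True # ?row \<tau> t j"])
  also have "\<dots> = sem x (\<lambda>_. 0) (P.print_scores Ze)"
    unfolding sem_print_row[symmetric] P.print_scores_def sem.simps(3) sem_seq map_map
    by (simp add: Ze env_eq[simplified] o_def del: upt_Suc)
  finally show ?thesis ..
qed

theorem sem_print_instance: "sem x (\<lambda>_. 0) (P.print_instance Ze) = enc_instance inst"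
proof -
  have "sem x (\<lambda>_. 0) (print_nat (Mul (Mul (Cst A) Ze) Ze)) = enc_nat (A * Z * Z)"
    by (rule sem_print_nat) (simp add: Ze)
  then show ?thesis
    by (simp add: P.print_instance_def sem_print_harmful sem_print_scores enc_instance_def)
      (simp add: inst_def)
qed

end

end

section \<open>The hardness theorem\<close>

text \<open>What a solution has to provide for the reader: yes iff no operation is on item 0, with a
  length polynomial in the original input.\<close>

definition decides_by :: "(word \<Rightarrow> bool) \<Rightarrow> nat poly \<Rightarrow> word \<Rightarrow> word \<Rightarrow> bool" where
  "decides_by P b x y \<longleftrightarrow> (\<exists>xs. y = enc_operations xs \<and> length y \<le> poly b (length x) \<and>
     [P x] = [\<forall>(u, v, w)\<in>set xs. u \<noteq> 0])"

theorem NP_reduction: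
  assumes L: "L \<in> class_NP" and \<alpha>: "0 < \<alpha>"
  obtains pre r q b where "prepares pre r q" "\<And>x. r x \<in> rewiring_inputs"
    "\<And>x y. answer (approximate_solution \<alpha>) (r x) y \<Longrightarrow> decides_by (\<lambda>x. x \<in> L) b x y"
proof -
  obtain cs0 A Ze Z where Ze: "\<And>x \<rho>. aval x \<rho> Ze = Z x" and Z: "\<And>x. 1 \<le> Z x" and A: "1 \<le> A"
    and wf: "\<And>x cl. cl \<in> set cs0 \<Longrightarrow> well_formed x (Z x) A cl"
    and sat: "\<And>x. x \<in> L \<longleftrightarrow> (\<exists>a. satisfies x (Z x) cs0 a)"
    using NP_schemas[OF L] by metis
  \<comment> \<open>\<alpha> is fixed before the reduction is built, so \<open>m\<close> is a
    constant that is wired into the printed weights.\<close>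
  obtain m :: nat where m: "1 < \<alpha> * real m"
    using reals_Archimedean3[OF \<alpha>, rule_format, of 1] by (auto simp: mult.commute)
  have m1: "1 \<le> m"
    using m by (cases m) auto
  define W where "W = 2 + sum_list (map (\<lambda>cl. length (snd cl)) cs0)"
  have W: "length (snd cl) \<le> W" if "cl \<in> set cs0" for cl
  proof -
    have "length (snd cl) \<in> set (map (\<lambda>cl. length (snd cl)) cs0)"
      using that by simp
    from member_le_sum_list[OF this] show ?thesis
      by (simp add: W_def)
  qed
  have g: "gadget cs0 A W m (Z x) x" for x
    by unfold_locales (use wf Z A m1 W in \<open>auto simp: W_def\<close>)
  define I where "I x = gadget.inst cs0 A W m (Z x) x" for x
  define r where "r x = enc_instance (I x)" for x
  have valid: "valid_instance (I x)" for x
    unfolding I_def by (rule gadget.valid_inst[OF g])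
  have print: "sem x (\<lambda>_. 0) (printer.print_instance (gadget.cs cs0 A) A W m Ze) = r x" for x
    unfolding r_def I_def by (rule gadget.sem_print_instance[OF g Ze])
  obtain pre q where pre: "prepares pre r q"
    using prepares_stm[of "printer.print_instance (gadget.cs cs0 A) A W m Ze"] unfolding print by blast
  obtain z where z: "\<And>x \<rho> N. (\<forall>i. \<rho> i \<le> N) \<Longrightarrow> length x \<le> N \<Longrightarrow> aval x \<rho> Ze \<le> poly z N"
    using aval_bound by metis
  have zb: "Z x \<le> poly z (length x)" for x
    using z[of "\<lambda>_. 0" "length x" x] by (simp add: Ze)
  define F where "F = length (item_types W A (length (gadget.cs cs0 A)))"
  define b where "b = smult A (z * z) * (smult (6 * F) (z * z) + 4) + 1"
  show thesis
  proof
    show "prepares pre r q"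
      by (rule pre)
    fix x
    interpret G: gadget cs0 A W m "Z x" x
      by (rule g)
    have Ix: "I x = G.inst"
      by (simp add: I_def)
    obtain O1 where "feasible G.inst O1"
      using G.hub_solution by blast
    then show "r x \<in> rewiring_inputs"
      using valid[of x] unfolding rewiring_inputs_def r_def Ix by blast
    fix y
    assume "answer (approximate_solution \<alpha>) (r x) y"
    then obtain J xs where J: "valid_instance J" "r x = enc_instance J" "y = enc_operations xs" "distinct xs"
      "approximate_solution \<alpha> J (set xs)"
      by (auto simp: answer_def)
    have "J = G.inst"
      using enc_instance_inject[OF J(1) valid[of x]] J(2) by (simp add: r_def Ix)
    then have sol: "approximate_solution \<alpha> G.inst (set xs)"
      using J(5) by simp
    then have f: "rewiring_set G.inst (set xs)" "card (set xs) = A * Z x * Z x"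
      by (simp_all add: approximate_solution_def feasible_def G.inst_def)
    have less: "u < G.size \<and> v < G.size \<and> w < G.size" if "(u, v, w) \<in> set xs" for u v w
      using G.operation_inst[OF f(1) that] by (simp add: harmful_items_def neutral_items_def)
    have "length xs = A * Z x * Z x"
      using f(2) J(4) by (simp add: distinct_card)
    then have "length y \<le> A * Z x * Z x * (6 * (F * Z x * Z x) + 4) + 1"
      using length_enc_operations[of xs G.size, OF less] by (simp add: J(3) G.size_def F_def)
    also have "\<dots> \<le> A * poly z (length x) * poly z (length x) * (6 * (F * poly z (length x) * poly z (length x)) + 4) + 1"
      using zb by (intro add_mono mult_mono order_refl) simp_all
    also have "\<dots> = poly b (length x)"
      by (simp add: b_def mult.assoc)
    finally have len: "length y \<le> poly b (length x)" .
    have "x \<in> L \<longleftrightarrow> \<not> G.op_at (set xs) 0"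
      using G.approximate_yes[OF m \<alpha> sol] G.approximate_no[OF \<alpha> sol] sat by blast
    also have "\<dots> \<longleftrightarrow> (\<forall>(u, v, w)\<in>set xs. u \<noteq> 0)"
      by (auto simp: G.op_at_def intro!: gr0I)
    finally show "decides_by (\<lambda>x. x \<in> L) b x y"
      using len J(3) unfolding decides_by_def by blast
  qed
qed

lemma NP_hard_approximate:
  assumes "0 < \<alpha>"
  shows "NP_hard_search rewiring_inputs (answer (approximate_solution \<alpha>))"
  unfolding NP_hard_search_def
proof
  fix L assume "L \<in> class_NP"
  then obtain pre r q b where r: "prepares pre r q" "\<And>x. r x \<in> rewiring_inputs"
    "\<And>x y. answer (approximate_solution \<alpha>) (r x) y \<Longrightarrow> decides_by (\<lambda>x. x \<in> L) b x y"
    using NP_reduction[OF _ assms] by metis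
  have post: "concludes 2 (reader 2) (decides_by (\<lambda>x. x \<in> L) b) (\<lambda>x. [x \<in> L]) (smult 6 b + 2)"
    unfolding decides_by_def by (rule concludes_reader) simp
  obtain M p where M: "turing_machine M"
    "\<forall>g. (\<forall>x. decides_by (\<lambda>x. x \<in> L) b x (g (r x))) \<longrightarrow> (\<forall>x. outputs_within M g x (poly p (length x)) [x \<in> L])"
    using oracle_machine[OF r(1) post] by blast
  have "\<forall>x. outputs_within M g x (poly p (length x)) [x \<in> L]"
    if "solves g rewiring_inputs (answer (approximate_solution \<alpha>))" for g
    using that r(2,3) M(2) unfolding solves_def by simp
  then show "\<exists>M (p :: nat poly). turing_machine M \<and> (\<forall>g. solves g rewiring_inputs (answer (approximate_solution \<alpha>)) \<longrightarrow>
      (\<forall>x. outputs_within M g x (poly p (length x)) [x \<in> L]))"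
    using M(1) by blast
qed

text \<open>An optimal set is its own witness for the factor 1, so a solver of the exact problem
  also solves this approximation.\<close>

lemma optimal_approximate: "answer optimal x y \<Longrightarrow> answer (approximate_solution 1) x y"
  unfolding answer_def approximate_solution_def optimal_def by fastforce

theorem theorem3p1:
  "NP_hard_search rewiring_inputs (answer optimal) \<and>
   (\<forall>\<alpha>>0. NP_hard_search rewiring_inputs (answer (approximate_solution \<alpha>))) \<and>
   (\<forall>\<alpha>>0. (\<exists>g. poly_time_computable g \<and> solves g rewiring_inputs (answer (approximate_solution \<alpha>)))
      \<longrightarrow> class_P = class_NP)"
proof (intro conjI allI impI)
  show "NP_hard_search rewiring_inputs (answer optimal)"
    using NP_hard_approximate[of 1] optimal_approximate
    unfolding NP_hard_search_def solves_def by (meson zero_less_one)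
  show "NP_hard_search rewiring_inputs (answer (approximate_solution \<alpha>))" if "0 < \<alpha>" for \<alpha>
    by (rule NP_hard_approximate[OF that])
  fix \<alpha> :: real
  assume \<alpha>: "0 < \<alpha>" and "\<exists>g. poly_time_computable g \<and> solves g rewiring_inputs (answer (approximate_solution \<alpha>))"
  then obtain g where g: "poly_time_computable g" "solves g rewiring_inputs (answer (approximate_solution \<alpha>))"
    by blast
  \<comment> \<open>The same reduction, with the assumed algorithm simulated where the oracle
    machine asks its query.\<close>
  have "L \<in> class_P" if L: "L \<in> class_NP" for L
  proof -
    obtain pre r q b where r: "prepares pre r q" "\<And>x. r x \<in> rewiring_inputs"
      "\<And>x y. answer (approximate_solution \<alpha>) (r x) y \<Longrightarrow> decides_by (\<lambda>x. x \<in> L) b x y"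
      using NP_reduction[OF L \<alpha>] by metis
    have post: "concludes 3 (reader 3) (decides_by (\<lambda>x. x \<in> L) b) (\<lambda>x. [x \<in> L]) (smult 6 b + 2)"
      unfolding decides_by_def by (rule concludes_reader) simp
    have "decides_by (\<lambda>x. x \<in> L) b x (g (r x))" for x
      using g(2) r(2,3) unfolding solves_def by simp
    then show ?thesis
      using composed_machine[OF r(1) g(1) post] by (simp add: class_P_def)
  qed
  then show "class_P = class_NP"
    using P_subset_NP by blast
qed

end
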